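(* Let $C$ be a cardioid-like curve and $T$ a deltoid-like curve, and let $T_{\rm conc}$ be an arc of $T$ between two cusps which has negative curvature and total tangent-direction variation less than $\pi$. Then there is a similarity $\phi$ of the plane (a composition of a rotation, a translation and a uniform scaling) such that $\phi(C)$ is inscribed in $T$ (i.e. $\phi(C)$ lies in the closure of the bounded domain enclosed by $T$), $\phi(C)$ intersects all three sides of $T$ (the three arcs between cusps), and $\phi(C)$ intersects $T_{\rm conc}$ at two points.
   Context: A Jordan curve is cardioid-like if it is smooth and has positive curvature with respect to counterclockwise orientation except at a single (inward) cusp singularity. A Jordan curve is deltoid-like if it is smooth except at three outward cusps and at least one of the arcs between the cusp points has negative curvature with total variation of the tangent direction along the arc less than $\pi$. *)

theory Defs
  imports "HOL-Complex_Analysis.Winding_Numbers"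
begin

text \<open>Plane = complex numbers. A closed curve is given by a 1-periodic
  parametrisation g :: real => complex whose restriction to [0,1] is a simple
  closed path (Jordan curve).\<close>

primrec vd_iter :: "nat \<Rightarrow> (real \<Rightarrow> complex) \<Rightarrow> real \<Rightarrow> complex" where
  "vd_iter 0 g = g"
| "vd_iter (Suc n) g = (\<lambda>t. vector_derivative (vd_iter n g) (at t))"

definition smooth_regular_on :: "(real \<Rightarrow> complex) \<Rightarrow> real set \<Rightarrow> bool" where
  "smooth_regular_on g S \<longleftrightarrow> open S \<and>
     (\<forall>n. \<forall>t\<in>S. (vd_iter n g has_vector_derivative vd_iter (Suc n) g t) (at t)) \<and>
     (\<forall>t\<in>S. vd_iter 1 g t \<noteq> 0)"

definition curvature :: "(real \<Rightarrow> complex) \<Rightarrow> real \<Rightarrow> real" where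
  "curvature g t = Im (cnj (vd_iter 1 g t) * vd_iter 2 g t) / (norm (vd_iter 1 g t)) ^ 3"

definition jordan_param :: "(real \<Rightarrow> complex) \<Rightarrow> bool" where
  "jordan_param g \<longleftrightarrow> (\<forall>t. g (t + 1) = g t) \<and> continuous_on UNIV g \<and> simple_path g"

definition ccw :: "(real \<Rightarrow> complex) \<Rightarrow> bool" where
  "ccw g \<longleftrightarrow> (\<forall>z\<in>inside (path_image g). winding_number g z = 1)"

text \<open>Cusp at parameter t0 with cusp direction v: the unit tangent tends to v from
  the right and to -v from the left (both branches leave the cusp point in direction v).\<close>
definition cusp :: "(real \<Rightarrow> complex) \<Rightarrow> real \<Rightarrow> complex \<Rightarrow> bool" where
  "cusp g t0 v \<longleftrightarrow> norm v = 1 \<and>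
     ((\<lambda>t. vd_iter 1 g t / complex_of_real (norm (vd_iter 1 g t))) \<longlongrightarrow> v) (at_right t0) \<and>
     ((\<lambda>t. vd_iter 1 g t / complex_of_real (norm (vd_iter 1 g t))) \<longlongrightarrow> - v) (at_left t0)"

definition inward_cusp :: "(real \<Rightarrow> complex) \<Rightarrow> real \<Rightarrow> bool" where
  "inward_cusp g t0 \<longleftrightarrow> (\<exists>v. cusp g t0 v \<and>
     (\<forall>\<^sub>F s in at_right 0. g t0 - complex_of_real s * v \<in> inside (path_image g)))"

definition outward_cusp :: "(real \<Rightarrow> complex) \<Rightarrow> real \<Rightarrow> bool" where
  "outward_cusp g t0 \<longleftrightarrow> (\<exists>v. cusp g t0 v \<and>
     (\<forall>\<^sub>F s in at_right 0. g t0 - complex_of_real s * v \<in> outside (path_image g)))"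

definition cardioid_param :: "(real \<Rightarrow> complex) \<Rightarrow> real \<Rightarrow> bool" where
  "cardioid_param g t0 \<longleftrightarrow> jordan_param g \<and> ccw g \<and>
     smooth_regular_on g {t. \<forall>k::int. t \<noteq> t0 + of_int k} \<and>
     (\<forall>t. (\<forall>k::int. t \<noteq> t0 + of_int k) \<longrightarrow> curvature g t > 0) \<and>
     inward_cusp g t0"

definition cardioid_like :: "complex set \<Rightarrow> bool" where
  "cardioid_like C \<longleftrightarrow> (\<exists>g t0. cardioid_param g t0 \<and> C = path_image g)"

definition deltoid_param :: "(real \<Rightarrow> complex) \<Rightarrow> real \<Rightarrow> real \<Rightarrow> real \<Rightarrow> bool" where
  "deltoid_param g t1 t2 t3 \<longleftrightarrow> jordan_param g \<and> ccw g \<and> t1 < t2 \<and> t2 < t3 \<and> t3 < t1 + 1 \<and>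
     smooth_regular_on g {t. \<forall>k::int. t \<noteq> t1 + of_int k \<and> t \<noteq> t2 + of_int k \<and> t \<noteq> t3 + of_int k} \<and>
     outward_cusp g t1 \<and> outward_cusp g t2 \<and> outward_cusp g t3"

definition tangent_variation_less :: "(real \<Rightarrow> complex) \<Rightarrow> real \<Rightarrow> real \<Rightarrow> real \<Rightarrow> bool" where
  "tangent_variation_less g a b c \<longleftrightarrow>
     (\<exists>V. ((\<lambda>t. \<bar>curvature g t\<bar> * norm (vd_iter 1 g t)) has_integral V) {a..b} \<and> V < c)"

definition concave_arc :: "(real \<Rightarrow> complex) \<Rightarrow> real \<Rightarrow> real \<Rightarrow> bool" where
  "concave_arc g a b \<longleftrightarrow> (\<forall>t\<in>{a<..<b}. curvature g t < 0) \<and> tangent_variation_less g a b pi"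

definition deltoid_like :: "complex set \<Rightarrow> bool" where
  "deltoid_like T \<longleftrightarrow> (\<exists>g t1 t2 t3. deltoid_param g t1 t2 t3 \<and> T = path_image g \<and>
     (concave_arc g t1 t2 \<or> concave_arc g t2 t3 \<or> concave_arc g t3 (t1 + 1)))"

definition similarity :: "(complex \<Rightarrow> complex) \<Rightarrow> bool" where
  "similarity \<phi> \<longleftrightarrow> (\<exists>a b. a \<noteq> 0 \<and> \<phi> = (\<lambda>z. a * z + b))"

end

theory Submission
  imports Defs "HOL-Complex_Analysis.Riemann_Mapping"
begin

text \<open>
  Parametrise the cardioid by its tangent angle. Hopf's secant argument, with the cusp as base point,
  shows that the angle runs through an interval of length \<open>3\<pi>\<close>: near the cusp all secants between the
  two branches lie in a half-plane, and the rotation of the curve seen from the cusp is the winding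
  number around a point just behind the cusp, which is one because the cusp points inward. Hence the
  cardioid has two feet, one on each side of the cusp, which realise the same tangent directions.

  Since the concave arc turns by less than \<open>\<pi>\<close>, for any two of its points \<open>g s\<^sub>1\<close>, \<open>g s\<^sub>2\<close> with
  \<open>s\<^sub>1 < s\<^sub>2\<close> there is exactly one similarity that puts the left foot tangentially on \<open>g s\<^sub>1\<close> and the
  right foot tangentially on \<open>g s\<^sub>2\<close>. It depends continuously on \<open>(s\<^sub>1, s\<^sub>2)\<close>, shrinks to a point on the
  diagonal, and the copy of the cardioid meets the arc in no third point, because every other point
  lies strictly above one of the two tangent lines.

  In the triangle of pairs \<open>(s\<^sub>1, s\<^sub>2)\<close> start from the diagonal and enlarge the copy as long as it is
  inscribed. It can leave the closed domain only by hitting one of the other two sides. One leg of the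
  triangle consists of positions touching the second side and the other leg of positions touching
  the third, so by unicoherence of the triangle some inscribed position touches both.
\<close>

section \<open>Continuous angle functions\<close>

text \<open>The value 3\<pi> is a sum of rotations of the secant along the two legs of its parameter
  triangle: the ray from the cusp to the moving point turns by 2\<pi>, the same ray reversed turns
  by 2\<pi> again, and the missing corner, where both ends of the secant are at the cusp,
  contributes -\<pi>. The similarity attached to a pair is found from one real unknown, the rotation
  angle: the segment between the feet has to be parallel to the chord. No derivative of that
  equation is taken; every root is a strict upward crossing, since a larger angle turns the segment
  and slides both feet, and the three effects have the same sign. The diagonal is the delicate
  place. There the equation says nothing about the angle, and the copies shrink continuously only
  because the segment between the feet stays bounded away from zero. The enlargement is not followed
  along a path, as inscribed positions need not form one; a last inscribed position is replaced by
  the relative frontier of a region beyond the inscribed component of the diagonal, which is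
  connected and made of positions touching another side.\<close>

lemma angle_lift_exists:
  fixes f :: "'a::real_normed_vector \<Rightarrow> complex"
  assumes "continuous_on S f" "contractible S" "\<And>x. x \<in> S \<Longrightarrow> f x \<noteq> 0"
  obtains b :: "'a \<Rightarrow> real" where "continuous_on S b"
    "\<And>x. x \<in> S \<Longrightarrow> f x = complex_of_real (norm (f x)) * cis (b x)"
proof -
  obtain q where q: "continuous_on S q" "\<And>x. x \<in> S \<Longrightarrow> f x = exp (q x)"
    using continuous_logarithm_on_contractible[OF assms] by blast
  show thesis
  proof
    show "continuous_on S (\<lambda>x. Im (q x))" using q(1) by (intro continuous_intros)
    show "f x = complex_of_real (norm (f x)) * cis (Im (q x))" if "x \<in> S" for x
      using exp_eq_polar[of "q x"] unfolding q(2)[OF that] norm_exp_eq_Re exp_of_real by simp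
  qed
qed

text \<open>Values with the same \<open>cis\<close> differ by multiples of 2\<pi>, so the range is
  discrete. Two angle functions of one quantity are compared this way throughout: their difference
  is a constant with known \<open>cis\<close>.\<close>

lemma continuous_cis_constant:
  fixes d :: "'a::topological_space \<Rightarrow> real"
  assumes "connected S" "continuous_on S d" "\<And>x. x \<in> S \<Longrightarrow> cis (d x) = w" "x \<in> S" "y \<in> S"
  shows "d x = d y"
proof -
  have "d constant_on S"
  proof (rule continuous_discrete_range_constant[OF assms(1,2)])
    fix x assume x: "x \<in> S"
    show "\<exists>e>0. \<forall>y. y \<in> S \<and> d y \<noteq> d x \<longrightarrow> e \<le> norm (d y - d x)"
    proof (intro exI[of _ 1] conjI allI impI)
      fix y assume y: "y \<in> S \<and> d y \<noteq> d x"
      then have "cis (d y) = cis (d x)" using assms(3) x by auto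
      then have "cis (d y - d x) = 1" by (simp add: cis_divide[symmetric])
      then have "cos (d y - d x) = 1" by (metis cis.sel(1) one_complex.sel(1))
      then obtain n :: int where n: "d y - d x = of_int n * 2 * pi"
        by (auto simp: cos_one_2pi_int)
      then have "n \<noteq> 0" using y by auto
      then have "1 \<le> \<bar>real_of_int n\<bar>" by linarith
      moreover have "1 \<le> 2 * pi" using pi_gt3 by simp
      ultimately have "1 * 1 \<le> \<bar>real_of_int n\<bar> * (2 * pi)" by (intro mult_mono) auto
      then show "1 \<le> norm (d y - d x)" using n by (simp add: abs_mult)
    qed simp
  qed
  then show ?thesis using assms(4,5) unfolding constant_on_def by metis
qed

text \<open>Leaving the interval would force a value \<pi>/2 away from \<open>c\<close>, where the
  cosine vanishes. The bound \<pi> at \<open>x0\<close> only selects the branch; the sign of the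
  cosine sharpens it to \<pi>/2.\<close>

lemma continuous_angle_in_half_plane:
  fixes b :: "'a::topological_space \<Rightarrow> real"
  assumes "connected S" "continuous_on S b" "\<And>x. x \<in> S \<Longrightarrow> cos (b x - c) > 0"
    and "x0 \<in> S" "\<bar>b x0 - c\<bar> < pi" "x \<in> S"
  shows "\<bar>b x - c\<bar> < pi/2"
proof -
  have conn: "connected (b ` S)" using assms(1,2) connected_continuous_image by blast
  have z0: "\<bar>b x0 - c\<bar> < pi/2"
  proof (rule ccontr)
    assume "\<not> \<bar>b x0 - c\<bar> < pi/2"
    then have "cos \<bar>b x0 - c\<bar> \<le> cos (pi/2)" using assms(5)
      by (intro cos_monotone_0_pi_le) auto
    then show False using assms(3)[OF assms(4)] by simp
  qed
  show ?thesis
  proof (rule ccontr)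
    assume "\<not> ?thesis"
    then consider "b x - c \<ge> pi/2" | "b x - c \<le> - pi/2" by linarith
    then show False
    proof cases
      case 1
      then have "c + pi/2 \<in> b ` S"
        using connectedD_interval[OF conn, of "b x0" "b x" "c + pi/2"] abs_less_iff[of "b x0 - c" "pi/2"] z0 assms(4,6) by auto
      then obtain y where "y \<in> S" "b y - c = pi/2" by force
      then show False using assms(3)[of y] by (metis cos_pi_half less_irrefl)
    next
      case 2
      then have "c - pi/2 \<in> b ` S"
        using connectedD_interval[OF conn, of "b x" "b x0" "c - pi/2"] abs_less_iff[of "b x0 - c" "pi/2"] z0 assms(4,6) by auto
      then obtain y where "y \<in> S" "b y - c = - (pi/2)" by force
      then show False using assms(3)[of y] by (metis cos_minus cos_pi_half less_irrefl)
    qed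
  qed
qed

text \<open>By the first sign the argument of \<open>z\<close>, measured from \<open>p\<close>, lies
  in (0, \<pi>). Beyond \<open>q\<close> the sine of the excess could not be negative, which
  contradicts the second sign.\<close>

lemma angle_between:
  assumes "Im (cis (- p) * z) > 0" "Im (cis (- q) * z) < 0" "p < q" "q - p \<le> pi"
  obtains w where "p < w" "w < q" "z = complex_of_real (norm z) * cis w"
proof -
  define y where "y = Arg (cis (- p) * z)"
  have nz: "z \<noteq> 0" using assms(1) by auto
  have y: "cis (- p) * z = complex_of_real (norm z) * cis y"
    unfolding y_def using rcis_cmod_Arg[of "cis (- p) * z"] by (simp add: rcis_def norm_mult)
  have y0: "0 < y" "y < pi"
    using assms(1) Arg_lt_pi[of "cis (- p) * z"] unfolding y_def by blast+
  have z: "z = complex_of_real (norm z) * cis (p + y)"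
  proof -
    have "z = cis p * (cis (-p) * z)" by (simp add: cis_mult flip: mult.assoc)
    also have "\<dots> = complex_of_real (norm z) * (cis p * cis y)" unfolding y by (simp only: mult_ac)
    finally show ?thesis by (simp only: cis_mult)
  qed
  have "cis (- q) * (complex_of_real (norm z) * cis (p + y)) = complex_of_real (norm z) * (cis (-q) * cis (p + y))"
    by (simp only: mult_ac)
  then have "cis (- q) * z = complex_of_real (norm z) * cis (p + y - q)"
    unfolding z[symmetric] cis_mult by (simp add: algebra_simps)
  then have "norm z * sin (p + y - q) < 0" using assms(2) by simp
  then have "sin (p + y - q) < 0" by (simp add: mult_less_0_iff)
  then have "p + y < q" using y0 assms(3,4) sin_ge_zero[of "p+y-q"] by (cases "p + y < q") auto
  then show thesis using that[of "p + y"] y0 z by auto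
qed

text \<open>The logarithm of the modulus and the angle together lift \<open>p - z\<close> through
  the exponential. On a closed path the modulus cancels, so only the increment of the angle
  remains.\<close>

lemma winding_number_angle_lift:
  assumes "path p" "pathfinish p = pathstart p" "z \<notin> path_image p"
    and b: "continuous_on {0..1} b"
    "\<And>x. x \<in> {0..1} \<Longrightarrow> p x - z = complex_of_real (norm (p x - z)) * cis (b x)"
  shows "winding_number p z = complex_of_real ((b 1 - b 0) / (2*pi))"
proof -
  define q where "q x = complex_of_real (ln (norm (p x - z))) + \<i> * complex_of_real (b x)" for x
  have nz: "norm (p x - z) > 0" if "x \<in> {0..1}" for x
    using assms(3) that unfolding path_image_def by auto
  have contp: "continuous_on {0..1} p" using assms(1) by (simp add: path_def)
  have "path q" unfolding path_def q_def
    using nz by (intro continuous_intros b contp) (force+)?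
  have e: "exp (q x) = p x - z" if "x \<in> {0..1}" for x
    unfolding q_def using nz[OF that] b(2)[OF that]
    by (simp add: exp_add cis_conv_exp[symmetric] exp_of_real exp_ln)
  have "winding_number p z = winding_number (\<lambda>w. p w - z) 0" by (rule winding_number_offset)
  also have "\<dots> = winding_number (exp \<circ> q) 0"
    by (rule winding_number_cong) (simp add: e)
  also have "\<dots> = (q 1 - q 0) / (2 * of_real pi * \<i>)"
    using winding_number_compose_exp[OF \<open>path q\<close>] by (simp add: pathfinish_def pathstart_def)
  also have "\<dots> = complex_of_real ((b 1 - b 0) / (2*pi))"
    using assms(2) by (simp add: q_def pathfinish_def pathstart_def divide_simps algebra_simps)
  finally show ?thesis .
qed

lemma arc_direction:
  fixes c c' :: "real \<Rightarrow> complex"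
  assumes "a < b" "continuous_on {a..b} c"
    and "\<And>t. t \<in> {a<..<b} \<Longrightarrow> (c has_vector_derivative c' t) (at t)"
    and "\<And>t. t \<in> {a<..<b} \<Longrightarrow> Im (w * c' t) > 0"
  shows "Im (w * (c b - c a)) > 0"
proof -
  define f where "f t = Im (w * c t)" for t
  have der: "(f has_real_derivative Im (w * c' t)) (at t)" if "t \<in> {a<..<b}" for t
  proof -
    have "((\<lambda>t. w * c t) has_vector_derivative w * c' t) (at t)"
      by (rule has_vector_derivative_mult_right[OF assms(3)[OF that]])
    then have "((\<lambda>t. Im (w * c t)) has_vector_derivative Im (w * c' t)) (at t)"
      using bounded_linear.has_vector_derivative[OF bounded_linear_Im] by blast
    then show ?thesis unfolding f_def by (simp add: has_real_derivative_iff_has_vector_derivative)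
  qed
  have "f a < f b"
  proof (rule DERIV_pos_imp_increasing_open[OF assms(1)])
    show "\<And>x. \<lbrakk>a < x; x < b\<rbrakk> \<Longrightarrow> \<exists>y. (f has_real_derivative y) (at x) \<and> 0 < y"
      using der assms(4) by auto
    show "continuous_on {a..b} f" unfolding f_def using assms(2) by (intro continuous_intros)
  qed
  then show ?thesis unfolding f_def by (simp add: algebra_simps)
qed

section \<open>Tangent angles and periodic Jordan parametrisations\<close>

text \<open>The unit tangent is extended to the closed interval by its one-sided limits, so the ends
  may be cusps. The derivative obtained for the angle is the signed curvature times the
  speed.\<close>

lemma tangent_angle_exists:
  fixes c' c'' :: "real \<Rightarrow> complex"
  assumes "a < b"
    and der: "\<And>t. t \<in> {a<..<b} \<Longrightarrow> (c' has_vector_derivative c'' t) (at t)"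
    and nz: "\<And>t. t \<in> {a<..<b} \<Longrightarrow> c' t \<noteq> 0"
    and v: "norm v = 1" "((\<lambda>t. c' t / complex_of_real (norm (c' t))) \<longlongrightarrow> v) (at_right a)"
    and w: "norm w = 1" "((\<lambda>t. c' t / complex_of_real (norm (c' t))) \<longlongrightarrow> w) (at_left b)"
  obtains \<theta> where "continuous_on {a..b} \<theta>" "cis (\<theta> a) = v" "cis (\<theta> b) = w"
    "\<And>t. t \<in> {a<..<b} \<Longrightarrow> c' t = complex_of_real (norm (c' t)) * cis (\<theta> t)"
    "\<And>t. t \<in> {a<..<b} \<Longrightarrow>
      (\<theta> has_real_derivative Im (cnj (c' t) * c'' t) / (norm (c' t))\<^sup>2) (at t)"
proof -
  let ?u = "\<lambda>t. c' t / complex_of_real (norm (c' t))"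
  define \<tau> where "\<tau> t = (if t \<le> a then v else if t \<ge> b then w else ?u t)" for t
  have contc: "isCont c' t" if "t \<in> {a<..<b}" for t
    using der[OF that] has_vector_derivative_continuous by blast
  have cont: "continuous_on {a..b} \<tau>"
  proof (rule continuous_on_IccI)
    have "\<forall>\<^sub>F t in at_right a. ?u t = \<tau> t"
      unfolding eventually_at_right_field using \<open>a < b\<close> by (intro exI[of _ b]) (auto simp: \<tau>_def)
    then show "(\<tau> \<longlongrightarrow> \<tau> a) (at_right a)"
      using Lim_transform_eventually[OF v(2)] by (simp add: \<tau>_def)
    have "\<forall>\<^sub>F t in at_left b. ?u t = \<tau> t"
      unfolding eventually_at_left_field using \<open>a < b\<close> by (intro exI[of _ a]) (auto simp: \<tau>_def)
    then show "(\<tau> \<longlongrightarrow> \<tau> b) (at_left b)"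
      using Lim_transform_eventually[OF w(2)] \<open>a < b\<close> by (simp add: \<tau>_def)
    show "(\<tau> \<longlongrightarrow> \<tau> x) (at x)" if "a < x" "x < b" for x
    proof -
      have "(?u \<longlongrightarrow> ?u x) (at x)"
        using contc[of x] nz[of x] that unfolding isCont_def by (intro tendsto_intros) auto
      moreover have "\<forall>\<^sub>F t in at x. ?u t = \<tau> t"
        using that eventually_at_topological[of "\<lambda>t. ?u t = \<tau> t" x UNIV]
        by (auto intro!: exI[of _ "{a<..<b}"] simp: \<tau>_def)
      moreover have "\<tau> x = ?u x" using that by (simp add: \<tau>_def)
      ultimately show ?thesis using Lim_transform_eventually by force
    qed
  qed (fact \<open>a < b\<close>)
  have norm1: "norm (\<tau> t) = 1" if "t \<in> {a..b}" for t
    using that v(1) w(1) nz[of t] by (auto simp: \<tau>_def norm_divide)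
  obtain \<theta> where th: "continuous_on {a..b} \<theta>"
    "\<And>t. t \<in> {a..b} \<Longrightarrow> \<tau> t = complex_of_real (norm (\<tau> t)) * cis (\<theta> t)"
    using angle_lift_exists[OF cont] norm1 convex_imp_contractible
    by (metis convex_real_interval(5) norm_zero zero_neq_one)
  have th2: "cis (\<theta> t) = \<tau> t" if "t \<in> {a..b}" for t using th(2)[OF that] norm1[OF that] by simp
  have polar: "c' t = complex_of_real (norm (c' t)) * cis (\<theta> t)" if "t \<in> {a<..<b}" for t
    using th2[of t] that nz[OF that] by (auto simp: \<tau>_def)
  have "(\<theta> has_real_derivative Im (cnj (c' t) * c'' t) / (norm (c' t))\<^sup>2) (at t)"
    if t: "t \<in> {a<..<b}" for t
  proof -
    \<comment> \<open>Near \<open>t\<close> this quotient stays in the unit ball about 1, away from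
      the branch cut. The imaginary part of its principal logarithm is therefore a differentiable
      local angle, and it agrees with \<theta> up to the constant \<open>\<theta> t\<close>.\<close>
    define f where "f x = c' x / c' t" for x
    have ft: "f t = 1" using nz[OF t] by (simp add: f_def)
    have "isCont f t" unfolding f_def using contc[OF t] nz[OF t] by (intro continuous_intros)
    then have "\<forall>\<^sub>F x in nhds t. f x \<in> ball 1 1"
      using ft by (metis isCont_def tendsto_at_iff_tendsto_nhds topological_tendstoD open_ball centre_in_ball zero_less_one)
    then obtain d where d: "d > 0" "\<And>x. dist x t < d \<Longrightarrow> f x \<in> ball 1 1"
      unfolding eventually_nhds_metric by blast
    define e where "e = min d (min (t - a) (b - t))"
    have e: "e > 0" using t d(1) by (auto simp: e_def)
    have sub: "ball t e \<subseteq> {a<..<b}" by (auto simp: e_def dist_real_def ball_def)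
    have fpos: "Re (f x) > 0" "f x \<notin> \<real>\<^sub>\<le>\<^sub>0" if "x \<in> ball t e" for x
    proof -
      have "cmod (1 - f x) < 1" using d(2)[of x] that by (auto simp: e_def dist_commute dist_norm)
      then have "\<bar>Re (1 - f x)\<bar> < 1" using abs_Re_le_cmod[of "1 - f x"] by linarith
      then show "Re (f x) > 0" by simp
      then show "f x \<notin> \<real>\<^sub>\<le>\<^sub>0" using complex_nonpos_Reals_iff by force
    qed
    define h where "h x = \<theta> x - \<theta> t - Im (Ln (f x))" for x
    have eq0: "h x = 0" if x: "x \<in> ball t e" for x
    proof -
      have "h x = h t"
      proof (rule continuous_cis_constant[of "ball t e" h 1])
        show "continuous_on (ball t e) h" unfolding h_def
        proof (intro continuous_intros)
          show "continuous_on (ball t e) \<theta>"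
            using th(1) by (rule continuous_on_subset) (use sub in auto)
          show "continuous_on (ball t e) f" unfolding f_def
            using sub contc nz t by (intro continuous_intros continuous_at_imp_continuous_on) auto
          show "\<And>z. z \<in> ball t e \<Longrightarrow> f z \<notin> \<real>\<^sub>\<le>\<^sub>0" by (fact fpos(2))
        qed
        show "cis (h y) = 1" if y: "y \<in> ball t e" for y
        proof -
          have y': "y \<in> {a<..<b}" using y sub by auto
          have nf: "f y \<noteq> 0" using fpos[OF y] by auto
          have "f y = complex_of_real (norm (f y)) * cis (Im (Ln (f y)))"
            using exp_Ln[OF nf] exp_eq_polar[of "Ln (f y)"] by (metis norm_exp_eq_Re)
          moreover have "f y = complex_of_real (norm (f y)) * cis (\<theta> y - \<theta> t)"
          proof -
            have "f y = (complex_of_real (norm (c' y)) * cis (\<theta> y)) / (complex_of_real (norm (c' t)) * cis (\<theta> t))"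
              unfolding f_def using polar[OF y'] polar[OF t] by argo
            then show ?thesis by (simp add: f_def norm_divide norm_mult cis_divide[symmetric])
          qed
          ultimately have "cis (\<theta> y - \<theta> t) = cis (Im (Ln (f y)))"
            using nf by (metis mult_left_cancel norm_eq_zero of_real_eq_0_iff)
          then show ?thesis unfolding h_def by (simp add: cis_divide[symmetric])
        qed
      qed (use e x in auto)
      also have "h t = 0" using ft by (simp add: h_def)
      finally show ?thesis .
    qed
    have "(f has_vector_derivative c'' t / c' t) (at t)"
      unfolding f_def using der[OF t] by (rule has_vector_derivative_divide)
    then have "((Ln \<circ> f) has_vector_derivative c'' t / c' t * 1) (at t)"
    proof (rule field_vector_diff_chain_at)
      show "(Ln has_field_derivative 1) (at (f t))"
        unfolding ft using has_field_derivative_Ln[of 1] by simp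
    qed
    then have "((\<lambda>x. Im ((Ln \<circ> f) x)) has_vector_derivative Im (c'' t / c' t * 1)) (at t)"
      using bounded_linear.has_vector_derivative[OF bounded_linear_Im] by blast
    then have "((\<lambda>x. \<theta> t + Im (Ln (f x))) has_real_derivative Im (c'' t / c' t)) (at t)"
      by (auto simp: has_real_derivative_iff_has_vector_derivative intro!: derivative_eq_intros)
    then have "(\<theta> has_real_derivative Im (c'' t / c' t)) (at t)"
      by (rule has_field_derivative_transform_within_open[OF _ open_ball[of t e]])
        (use e eq0[unfolded h_def] in \<open>force+\<close>)
    moreover have "Im (c'' t / c' t) = Im (cnj (c' t) * c'' t) / (norm (c' t))\<^sup>2"
      by (subst complex_div_cnj) (simp add: Im_divide_of_real mult.commute flip: of_real_power)
    ultimately show ?thesis by simp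
  qed
  moreover have "cis (\<theta> a) = v" "cis (\<theta> b) = w"
    using th2[of a] th2[of b] \<open>a < b\<close> by (auto simp: \<tau>_def)
  ultimately show thesis using that th(1) polar by blast
qed

section \<open>Periodicity, injectivity and change of base point for Jordan parametrisations\<close>

lemma jordan_param_periodic:
  fixes k :: int
  assumes "jordan_param g"
  shows "g (t + of_int k) = g t"
proof -
  have per: "g (t + 1) = g t" for t using assms(1) by (simp add: jordan_param_def)
  have pern: "g (t + real n) = g t" for t and n :: nat
  proof (induction n)
    case (Suc n)
    have "g (t + real (Suc n)) = g ((t + real n) + 1)" by (simp add: algebra_simps)
    then show ?case using per Suc by simp
  qed simp
  show ?thesis
  proof (cases "k \<ge> 0")
    case True then show ?thesis using pern[of t "nat k"] by simp
  next
    case False then show ?thesis using pern[of "t + of_int k" "nat (-k)"] by simp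
  qed
qed

lemma jordan_param_inj:
  assumes "jordan_param g" "g x = g y" "x \<in> {a..<a+1}" "y \<in> {a..<a+1}"
  shows "x = y"
proof -
  note peri = jordan_param_periodic[OF assms(1)]
  have fr: "g (frac t) = g t" for t
    using peri[of t "- \<lfloor>t\<rfloor>"] by (simp add: frac_def)
  have "loop_free g" using assms(1) by (auto simp: jordan_param_def simple_path_def)
  then have "frac x = frac y"
    using assms(2) frac_lt_1[of x] frac_lt_1[of y] fr frac_ge_0[of x] frac_ge_0[of y]
    unfolding loop_free_def by (metis atLeastAtMost_iff less_eq_real_def less_irrefl)
  then have "x - y = of_int (\<lfloor>x\<rfloor> - \<lfloor>y\<rfloor>)" by (simp add: frac_def algebra_simps)
  moreover have "\<bar>x - y\<bar> < 1" using assms(3,4) by auto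
  ultimately have "\<bar>\<lfloor>x\<rfloor> - \<lfloor>y\<rfloor>\<bar> < 1" by linarith
  with \<open>x - y = of_int (\<lfloor>x\<rfloor> - \<lfloor>y\<rfloor>)\<close> show ?thesis by simp
qed

text \<open>Reducing the shift modulo 1 turns it into a \<open>shiftpath\<close>. The loop can then
  be read from any parameter, such as the cusp, or half a period before a contact point.\<close>

lemma jordan_param_shift:
  fixes g :: "real \<Rightarrow> complex" and s :: real
  assumes "jordan_param g"
  defines "h \<equiv> \<lambda>t. g (s + t)"
  shows "path h" "pathfinish h = pathstart h" "path_image h = path_image g"
    "\<And>z. z \<notin> path_image g \<Longrightarrow> winding_number h z = winding_number g z"
proof -
  note peri = jordan_param_periodic[OF assms(1)]
  have per: "g (t + 1) = g t" for t using peri[of t 1] by simp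
  have cont: "continuous_on UNIV g" and "path g"
    using assms(1) by (auto simp: jordan_param_def simple_path_def)
  have loop: "pathfinish g = pathstart g" using per[of 0] by (simp add: pathfinish_def pathstart_def)
  show "path h" unfolding h_def path_def
    by (rule continuous_on_compose2[OF cont]) (auto intro!: continuous_intros)
  show "pathfinish h = pathstart h" using per[of s] by (simp add: h_def pathfinish_def pathstart_def)
  define r where "r = frac s"
  have r: "r \<in> {0..1}" using frac_ge_0[of s] frac_lt_1[of s] by (simp add: r_def)
  have h: "h t = shiftpath r g t" for t
  proof -
    have "h t = g (r + t)" using peri[of "r + t" "\<lfloor>s\<rfloor>"] by (simp add: h_def r_def frac_def algebra_simps)
    moreover have "g (r + t) = g (r + t - 1)" using per[of "r + t - 1"] by simp
    ultimately show ?thesis by (simp add: shiftpath_def)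
  qed
  then have h': "h = shiftpath r g" by auto
  show "path_image h = path_image g" unfolding h'
    using path_image_shiftpath[OF _ loop] r by auto
  show "winding_number h z = winding_number g z" if "z \<notin> path_image g" for z
    unfolding h' by (rule winding_number_shiftpath[OF \<open>path g\<close> that loop r])
qed

section \<open>Total turning of a curve with one inward cusp\<close>

text \<open>The point is exposed: it is the only point of \<open>S\<close> on a supporting line, so
  deleting it is the same as intersecting with an open half-plane. Parameter domains can thus lose a
  corner where a direction is undefined and remain contractible.\<close>

lemma convex_delete_corner:
  fixes S :: "(real \<times> real) set"
  assumes "convex S" "p \<in> S"
    and ext: "\<And>x y. (x, y) \<in> S \<Longrightarrow> \<alpha> * x + \<beta> * y \<le> \<alpha> * fst p + \<beta> * snd p"
    and uniq: "\<And>x y. (x, y) \<in> S \<Longrightarrow> \<alpha> * x + \<beta> * y = \<alpha> * fst p + \<beta> * snd p \<Longrightarrow> (x, y) = p"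
  shows "convex (S - {p})"
proof -
  let ?f = "\<lambda>z. \<alpha> * fst z + \<beta> * snd (z::real\<times>real)"
  have eq: "S - {p} = S \<inter> {z. ?f z < ?f p}"
    using ext uniq by (force simp: less_le)
  have "{z. ?f z < ?f p} = {z. inner (\<alpha>, \<beta>) z < ?f p}" by (auto simp: inner_prod_def)
  then show ?thesis unfolding eq using convex_halfspace_lt assms(1) by (metis convex_Int)
qed

lemma cis_small_angle:
  assumes "\<bar>x\<bar> \<le> pi/2"
  shows "cis x = 1 \<Longrightarrow> x = 0" "cis x = \<i> \<Longrightarrow> x = pi/2" "cis x = -\<i> \<Longrightarrow> x = -pi/2"
proof -
  have x: "x = arcsin (sin x)" using assms arcsin_sin[of x] by (simp add: abs_le_iff)
  show "cis x = 1 \<Longrightarrow> x = 0" using x by (metis arcsin_0 cis.sel(2) one_complex.sel(2))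
  show "cis x = \<i> \<Longrightarrow> x = pi/2" using x by (metis arcsin_1 cis.sel(2) imaginary_unit.sel(2))
  show "cis x = -\<i> \<Longrightarrow> x = -pi/2" using x by (metis arcsin_minus_1 cis.sel(2) imaginary_unit.sel(2) uminus_complex.sel(2) minus_divide_left)
qed

lemma cis_dist_le: "norm (cis x - cis y) \<le> \<bar>x - y\<bar>"
proof -
  have "cis x - cis y = cis y * (cis (x - y) - 1)" by (simp add: cis_mult algebra_simps)
  then have "norm (cis x - cis y) = norm (cis (x - y) - 1)" by (simp add: norm_mult)
  also have "\<dots> = 2 * \<bar>sin ((x - y) / 2)\<bar>"
    using dist_exp_i_1[of "x - y"] by (simp add: cis_conv_exp)
  also have "\<dots> \<le> \<bar>x - y\<bar>" using abs_sin_x_le_abs_x[of "(x - y) / 2"] by (simp add: abs_divide)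
  finally show ?thesis .
qed

text \<open>The cusp is at 0 and both branches leave it downwards, so the points just behind it are
  small positive multiples of \<open>\<i>\<close>, and \<open>wind\<close> expresses that the cusp
  points inward. Convexity enters through \<open>mono\<close> and \<open>dir\<close>: a stretch with
  tangent angles in [e, e + \<pi>] has its chord strictly to the left of direction \<open>e\<close>.
  Of the final angle only \<open>cis (\<theta> 1)\<close> is prescribed; the multiple of 2\<pi> is
  what has to be found.\<close>

locale normalized_cusp_curve =
  fixes c :: "real \<Rightarrow> complex" and \<theta> :: "real \<Rightarrow> real"
  assumes cont: "continuous_on {0..1} c" and ends: "c 0 = 0" "c 1 = 0"
    and inj: "\<And>s t. \<lbrakk>0 \<le> s; s < t; t \<le> 1; (s, t) \<noteq> (0, 1)\<rbrakk> \<Longrightarrow> c s \<noteq> c t"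
    and contt: "continuous_on {0..1} \<theta>"
    and mono: "\<And>s t. \<lbrakk>0 \<le> s; s < t; t \<le> 1\<rbrakk> \<Longrightarrow> \<theta> s < \<theta> t"
    and dir: "\<And>s t e. \<lbrakk>0 \<le> s; s < t; t \<le> 1; e \<le> \<theta> s; \<theta> t \<le> e + pi\<rbrakk> \<Longrightarrow> Im (cis (-e) * (c t - c s)) > 0"
    and th0: "\<theta> 0 = - pi/2" and th1: "cis (\<theta> 1) = \<i>"
    and wind: "\<forall>\<^sub>F \<sigma> in at_right 0. \<i> * complex_of_real \<sigma> \<notin> c ` {0..1} \<and> winding_number c (\<i> * complex_of_real \<sigma>) = 1"
begin

section \<open>Secant directions on the triangle of parameter pairs\<close>

definition "tri = {(s::real, t::real). 0 \<le> s \<and> s \<le> t \<and> t \<le> 1} - {(0,1)}"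

text \<open>On the diagonal the tangent takes the place of the secant. The corner (0, 1) is absent
  from \<open>tri\<close> because there both ends of the secant coincide with the cusp.\<close>

definition "secdir = (\<lambda>(s, t). if s = t then cis (\<theta> s) else (c t - c s) / complex_of_real (norm (c t - c s)))"

lemma convex_tri: "convex tri"
  unfolding tri_def
proof (rule convex_delete_corner[where \<alpha> = "-1" and \<beta> = 1])
  have "{(s::real, t::real). 0 \<le> s \<and> s \<le> t \<and> t \<le> 1} =
    {z. inner (-1, 0) z \<le> 0} \<inter> {z. inner (1, -1) z \<le> 0} \<inter> {z. inner (0, 1) z \<le> 1}"
    by (auto simp: inner_prod_def)
  then show "convex {(s::real, t::real). 0 \<le> s \<and> s \<le> t \<and> t \<le> 1}"
    by (simp only: convex_Int convex_halfspace_le)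
qed auto

lemma norm_secdir: "z \<in> tri \<Longrightarrow> norm (secdir z) = 1"
  using inj by (force simp: tri_def secdir_def norm_divide split: if_splits prod.splits)

lemma secant_angle:
  assumes "0 \<le> s" "s < t" "t \<le> 1" "\<theta> t - \<theta> s < pi"
  obtains w where "\<theta> s < w" "w < \<theta> t" "c t - c s = complex_of_real (norm (c t - c s)) * cis w"
proof (rule angle_between)
  show "Im (cis (- \<theta> s) * (c t - c s)) > 0" using assms by (intro dir) auto
  have "Im (cis (- (\<theta> t - pi)) * (c t - c s)) > 0" using assms by (intro dir) auto
  moreover have "cis (- (\<theta> t - pi)) = - cis (- \<theta> t)" by (simp add: complex_eq_iff)
  ultimately show "Im (cis (- \<theta> t) * (c t - c s)) < 0" by simp
qed (use assms mono in auto)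

text \<open>Only the diagonal needs an argument. There \<open>secant_angle\<close> traps the secant
  angle between the tangent angles at its two ends, so continuity of \<theta> suffices, also at the
  two cusp parameters.\<close>

lemma continuous_secdir: "continuous_on tri secdir"
  unfolding continuous_on_eq_continuous_within
proof
  fix z assume z: "z \<in> tri"
  obtain s t where st: "z = (s, t)" "0 \<le> s" "s \<le> t" "t \<le> 1" "(s, t) \<noteq> (0,1)"
    using z by (auto simp: tri_def)
  show "continuous (at z within tri) secdir"
  proof (cases "s = t")
    case False
    define U where "U = tri \<inter> {z. fst z \<noteq> snd z}"
    have cU: "continuous_on U (\<lambda>z. c (snd z))" "continuous_on U (\<lambda>z. c (fst z))"
      by (auto intro!: continuous_on_compose2[OF cont] continuous_intros simp: U_def tri_def)
    have "c (fst x) \<noteq> c (snd x)" if "x \<in> U" for x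
      using inj[of "fst x" "snd x"] that by (auto simp: U_def tri_def)
    then have "continuous_on U (\<lambda>z. (c (snd z) - c (fst z)) / complex_of_real (norm (c (snd z) - c (fst z))))"
      by (intro continuous_intros cU) force
    then have "continuous_on U secdir"
      by (rule continuous_on_cong[THEN iffD1, rotated 2]) (auto simp: U_def secdir_def)
    then have "continuous (at z within U) secdir"
      using z st False by (simp add: continuous_on_eq_continuous_within U_def)
    moreover have "at z within tri = at z within U"
    proof (rule at_within_nhd)
      show "open {z::real \<times> real. fst z \<noteq> snd z}"
        by (intro open_Collect_neq continuous_intros)
    qed (use z st False in \<open>auto simp: U_def\<close>)
    ultimately show ?thesis by simp
  next
    case True
    show ?thesis unfolding continuous_within_eps_delta
    proof (intro allI impI)
      fix e :: real assume e: "e > 0"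
      \<comment> \<open>The cap at 1 keeps the two tangent angles less than 2 apart, hence less than
        \<pi>, as \<open>secant_angle\<close> requires.\<close>
      define e' where "e' = min e 1"
      have "e' > 0" using e by (simp add: e'_def)
      then obtain d where d: "d > 0" "\<And>x. x \<in> {0..1} \<Longrightarrow> dist x s < d \<Longrightarrow> dist (\<theta> x) (\<theta> s) < e'"
        using contt st True unfolding continuous_on_iff by (metis atLeastAtMost_iff)
      have "dist (secdir y) (secdir z) < e" if y: "y \<in> tri" "dist y z < d" for y
      proof -
        obtain a b where ab: "y = (a, b)" "0 \<le> a" "a \<le> b" "b \<le> 1" "(a, b) \<noteq> (0,1)"
          using y by (auto simp: tri_def)
        have "dist a s < d" "dist b s < d"
          using y(2) dist_fst_le[of y z] dist_snd_le[of y z] ab st True by auto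
        then have near: "dist (\<theta> a) (\<theta> s) < e'" "dist (\<theta> b) (\<theta> s) < e'" using d(2) ab by auto
        have "\<exists>w. \<theta> a \<le> w \<and> w \<le> \<theta> b \<and> secdir y = cis w"
        proof (cases "a = b")
          case True then show ?thesis using ab by (auto simp: secdir_def)
        next
          case False
          have "\<theta> b - \<theta> a < pi" using near pi_gt3 by (auto simp: dist_real_def e'_def)
          then obtain w where w: "\<theta> a < w" "w < \<theta> b" "c b - c a = complex_of_real (norm (c b - c a)) * cis w"
            using secant_angle[of a b] ab False by auto
          have "c b - c a \<noteq> 0" using inj[of a b] ab False by auto
          then have "(c b - c a) / complex_of_real (norm (c b - c a)) = cis w"
            using w(3) by (metis nonzero_mult_div_cancel_left norm_eq_zero of_real_eq_0_iff)
          then show ?thesis using w ab False by (auto simp: secdir_def intro!: exI[of _ w])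
        qed
        then obtain w where w: "\<theta> a \<le> w" "w \<le> \<theta> b" "secdir y = cis w" by blast
        have "dist (secdir y) (secdir z) \<le> \<bar>w - \<theta> s\<bar>"
          using cis_dist_le w(3) st True by (simp add: dist_norm secdir_def)
        also have "\<dots> < e" using w near by (auto simp: dist_real_def e'_def)
        finally show ?thesis .
      qed
      then show "\<exists>d>0. \<forall>y\<in>tri. dist y z < d \<longrightarrow> dist (secdir y) (secdir z) < e"
        using d(1) by blast
    qed
  qed
qed

text \<open>The first branch starts downwards and turns left, so during its first quarter turn it
  stays right of the axis. The three companions put it below the cusp, and put the last branch to
  the left of the axis and below the cusp.\<close>

lemma Re_pos_near_start: "Re (c s) > 0" if "0 < s" "s \<le> 1" "\<theta> s \<le> 0"
proof -
  have "\<theta> s \<le> -pi/2 + pi" using that(3) pi_gt_zero by linarith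
  then show ?thesis using dir[of 0 s "-pi/2"] that th0 ends by simp
qed

lemma Re_neg_near_end: "Re (c s) < 0" if "0 \<le> s" "s < 1" "\<theta> 1 - pi/2 \<le> \<theta> s"
proof -
  have "\<theta> 1 - pi \<le> \<theta> s" using that(3) pi_gt_zero by linarith
  have "cis (-(\<theta> 1 - pi)) = cis pi / cis (\<theta> 1)" unfolding cis_divide by simp
  then have "cis (-(\<theta> 1 - pi)) = \<i>" using th1 by simp
  then show ?thesis using dir[of s 1 "\<theta> 1 - pi"] \<open>\<theta> 1 - pi \<le> \<theta> s\<close> that ends by simp
qed

lemma Im_neg_near_start: "Im (c s) < 0" if "0 < s" "s \<le> 1" "\<theta> s \<le> 0"
  using dir[of 0 s "-pi"] that th0 ends by (simp add: cis_pi)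

lemma Im_neg_near_end: "Im (c s) < 0" if "0 \<le> s" "s < 1" "\<theta> 1 - pi/2 \<le> \<theta> s"
proof -
  have "cis (-(\<theta> 1 - pi/2)) = cis (pi/2) / cis (\<theta> 1)" unfolding cis_divide by simp
  then have "cis (-(\<theta> 1 - pi/2)) = 1" using th1 by simp
  then show ?thesis using dir[of s 1 "\<theta> 1 - pi/2"] that ends by simp
qed

lemma ends_nbhd:
  obtains \<epsilon> where "0 < \<epsilon>" "\<epsilon> < 1/2" "\<And>s. 0 \<le> s \<Longrightarrow> s \<le> \<epsilon> \<Longrightarrow> \<theta> s \<le> 0"
    "\<And>s. 1 - \<epsilon> \<le> s \<Longrightarrow> s \<le> 1 \<Longrightarrow> \<theta> 1 - pi/2 \<le> \<theta> s"
proof -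
  have p: "pi/2 > 0" by simp
  obtain d1 where d1: "d1 > 0" "\<And>x. x \<in> {0..1} \<Longrightarrow> dist x 0 < d1 \<Longrightarrow> dist (\<theta> x) (\<theta> 0) < pi/2"
    using contt p unfolding continuous_on_iff by (metis atLeastAtMost_iff order_refl zero_le_one)
  obtain d2 where d2: "d2 > 0" "\<And>x. x \<in> {0..1} \<Longrightarrow> dist x 1 < d2 \<Longrightarrow> dist (\<theta> x) (\<theta> 1) < pi/2"
    using contt p unfolding continuous_on_iff by (metis atLeastAtMost_iff order_refl zero_le_one)
  define \<epsilon> where "\<epsilon> = min (1/3) (min (d1/2) (d2/2))"
  have *: "0 < \<epsilon>" "\<epsilon> < 1/2" "\<epsilon> < d1" "\<epsilon> < d2" using d1(1) d2(1) by (auto simp: \<epsilon>_def)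
  show thesis
  proof (rule that[of \<epsilon>])
    show "\<theta> s \<le> 0" if "0 \<le> s" "s \<le> \<epsilon>" for s
      using d1(2)[of s] that * th0 unfolding dist_real_def by (smt (verit) atLeastAtMost_iff field_sum_of_halves)
    show "\<theta> 1 - pi/2 \<le> \<theta> s" if "1 - \<epsilon> \<le> s" "s \<le> 1" for s
      using d2(2)[of s] that * unfolding dist_real_def by (smt (verit) atLeastAtMost_iff field_sum_of_halves)
  qed (use * in auto)
qed


text \<open>Let \<open>A\<close> be the secant angle that equals \<theta> on the diagonal, and let
  \<open>a t = A (0, t)\<close>. On the other leg the ray is reversed, so
  \<open>A (t, 1) = a t + M\<close> with a constant \<open>M\<close>. The limits at the missing
  corner are \<open>l = \<theta> 1 - M\<close> and \<open>m = M - pi/2\<close>. The corner gives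
  \<open>l - m = pi\<close>, the winding number gives \<open>l = 3*pi/2\<close>, and eliminating
  \<open>M\<close> gives the total turning. Since \<open>a\<close> runs from -\<pi>/2 to 3\<pi>/2,
  it takes the value \<pi>/2, which is the point on the axis.\<close>

lemma turning_and_axis:
  shows "\<theta> 1 = 5*pi/2" "\<exists>t\<in>{0..1}. \<exists>y>0. c t = \<i> * complex_of_real y"
proof -
  obtain A0 where A0: "continuous_on tri A0"
    "\<And>z. z \<in> tri \<Longrightarrow> secdir z = complex_of_real (norm (secdir z)) * cis (A0 z)"
    using angle_lift_exists[OF continuous_secdir convex_imp_contractible[OF convex_tri]] norm_secdir
    by (metis norm_zero zero_neq_one)
  define k0 where "k0 = A0 (0,0) - \<theta> 0"
  have diag: "(\<lambda>t. (t,t)) ` {0..1} \<subseteq> tri" by (auto simp: tri_def)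
  have k0: "A0 (t,t) - \<theta> t = k0" if "t \<in> {0..1}" for t
    unfolding k0_def
  proof (rule continuous_cis_constant[of "{0..1}" "\<lambda>t. A0 (t,t) - \<theta> t" 1])
    show "continuous_on {0..1} (\<lambda>t. A0 (t,t) - \<theta> t)"
      by (intro continuous_intros contt continuous_on_compose2[OF A0(1) _ diag])
    show "cis (A0 (x,x) - \<theta> x) = 1" if "x \<in> {0..1}" for x
    proof -
      have "(x,x) \<in> tri" using that diag by auto
      then have "cis (A0 (x,x)) = cis (\<theta> x)" using A0(2)[of "(x,x)"] by (simp add: secdir_def)
      then show ?thesis unfolding cis_divide[symmetric] by simp
    qed
  qed (use that in auto)
  have cisk0: "cis k0 = 1"
  proof -
    have "(0,0) \<in> tri" by (auto simp: tri_def)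
    then have "cis (A0 (0,0)) = cis (\<theta> 0)" using A0(2)[of "(0,0)"] by (simp add: secdir_def)
    then show ?thesis unfolding k0_def cis_divide[symmetric] by simp
  qed
  define A where "A z = A0 z - k0" for z
  have contA: "continuous_on tri A" unfolding A_def by (intro continuous_intros A0(1))
  have cisA: "cis (A z) = secdir z" if "z \<in> tri" for z
    using A0(2)[OF that] norm_secdir[OF that] cisk0 unfolding A_def cis_divide[symmetric] by simp
  have Adiag: "A (t,t) = \<theta> t" if "t \<in> {0..1}" for t using k0[OF that] by (simp add: A_def)
  have cA: "c t - c s = complex_of_real (norm (c t - c s)) * cis (A (s,t))" if "(s,t) \<in> tri" "s \<noteq> t" for s t
    using cisA[OF that(1)] that(2) by (simp add: secdir_def)
  define a where "a t = A (0, t)" for t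
  have ca: "c t = complex_of_real (norm (c t)) * cis (a t)" if "t \<in> {0<..<1}" for t
    using cA[of 0 t] that ends by (auto simp: tri_def a_def)
  have cnz: "c t \<noteq> 0" if "t \<in> {0<..<1}" for t using inj[of 0 t] that ends by auto
  have conta: "continuous_on {0..<1} a" unfolding a_def
    by (rule continuous_on_compose2[OF contA]) (auto intro!: continuous_intros simp: tri_def)
  have contA1: "continuous_on {0<..1} (\<lambda>t. A (t, 1))"
    by (rule continuous_on_compose2[OF contA]) (auto intro!: continuous_intros simp: tri_def)
  define M where "M = A (1/2, 1) - a (1/2)"
  have cisM': "cis (A (t,1) - a t) = -1" if t: "t \<in> {0<..<1}" for t
  proof -
    have "(t,1) \<in> tri" "(0,t) \<in> tri" using t by (auto simp: tri_def)
    then have "cis (A (t,1)) = - cis (a t)" using cisA t ends by (simp add: secdir_def a_def)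
    then show ?thesis unfolding cis_divide[symmetric] by simp
  qed
  have M: "A (t,1) = a t + M" if "t \<in> {0<..<1}" for t
  proof -
    have "A (t,1) - a t = M" unfolding M_def
    proof (rule continuous_cis_constant[of "{0<..<1}" "\<lambda>t. A (t,1) - a t" "-1"])
      show "continuous_on {0<..<1} (\<lambda>t. A (t,1) - a t)"
        by (intro continuous_intros continuous_on_subset[OF contA1] continuous_on_subset[OF conta]) auto
    qed (use that cisM' in auto)
    then show ?thesis by simp
  qed
  have cisM: "cis M = -1" using cisM'[of "1/2"] by (simp add: M_def)
  define l where "l = \<theta> 1 - M"
  define m where "m = - pi/2 + M"
  have limA1: "((\<lambda>t. A (t,1)) \<longlongrightarrow> \<theta> 1) (at_left 1)"
    using continuous_on_Icc_at_leftD[OF continuous_on_subset[OF contA1, of "{1/2..1}"]] Adiag[of 1] by (auto simp: subset_iff)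
  have lima1: "(a \<longlongrightarrow> l) (at_left 1)"
  proof -
    have "((\<lambda>t. A (t,1) - M) \<longlongrightarrow> l) (at_left 1)" unfolding l_def by (intro tendsto_intros limA1)
    moreover have "\<forall>\<^sub>F t in at_left 1. A (t,1) - M = a t"
      unfolding eventually_at_left_field by (intro exI[of _ 0]) (auto simp: M)
    ultimately show ?thesis by (rule Lim_transform_eventually)
  qed
  have lima0: "(a \<longlongrightarrow> -pi/2) (at_right 0)"
    using continuous_on_Icc_at_rightD[OF continuous_on_subset[OF conta, of "{0..1/2}"]] Adiag[of 0] th0
    by (auto simp: a_def subset_iff)
  have limA0: "((\<lambda>t. A (t,1)) \<longlongrightarrow> m) (at_right 0)"
  proof -
    have "((\<lambda>t. a t + M) \<longlongrightarrow> m) (at_right 0)" unfolding m_def by (intro tendsto_intros lima0)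
    moreover have "\<forall>\<^sub>F t in at_right 0. a t + M = A (t,1)"
      unfolding eventually_at_right_field by (intro exI[of _ 1]) (auto simp: M)
    ultimately show ?thesis by (rule Lim_transform_eventually)
  qed
  obtain \<epsilon> where \<epsilon>: "0 < \<epsilon>" "\<epsilon> < 1/2" "\<And>s. 0 \<le> s \<Longrightarrow> s \<le> \<epsilon> \<Longrightarrow> \<theta> s \<le> 0"
    "\<And>s. 1 - \<epsilon> \<le> s \<Longrightarrow> s \<le> 1 \<Longrightarrow> \<theta> 1 - pi/2 \<le> \<theta> s"
    using ends_nbhd by blast
  have cisl: "cis l = -\<i>" unfolding l_def cis_divide[symmetric] th1 cisM by simp
  have cism: "cis m = \<i>" unfolding m_def cis_mult[symmetric] cisM by (simp add: complex_eq_iff)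
  \<comment> \<open>Near the excluded corner all secants point into the left half-plane.\<close>
  have corner: "l - m = pi"
  proof -
    define N where "N = ({0..\<epsilon>} \<times> {1-\<epsilon>..1}) - {(0,1)}"
    have Ntri: "N \<subseteq> tri" using \<epsilon> by (auto simp: N_def tri_def)
    have "convex N" unfolding N_def
      by (rule convex_delete_corner[where \<alpha> = "-1" and \<beta> = 1]) (use \<epsilon> in \<open>auto intro!: convex_Times\<close>)
    then have connN: "connected N" by (rule convex_connected)
    have ReN: "cos (A z) < 0" if "z \<in> N" for z
    proof -
      define s t where "s = fst z" and "t = snd z"
      then have st: "z = (s,t)" "0 \<le> s" "s \<le> \<epsilon>" "1 - \<epsilon> \<le> t" "t \<le> 1" "(s,t) \<noteq> (0,1)"
        using that by (auto simp: N_def)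
      have "s = 0 \<or> Re (c s) > 0" 
        using Re_pos_near_start[of s] \<epsilon>(3)[of s] st(2,3) \<epsilon>(2) by (cases "s = 0") auto
      moreover have "t = 1 \<or> Re (c t) < 0"
        using Re_neg_near_end[of t] \<epsilon>(4)[of t] st(4,5) \<epsilon>(2) by (cases "t = 1") auto
      ultimately have neg: "Re (c t - c s) < 0" using st(6) ends by auto
      have "(s,t) \<in> tri" "s \<noteq> t" using Ntri that st \<epsilon>(2) by auto
      then have "Re (c t - c s) = norm (c t - c s) * cos (A (s,t))" using arg_cong[OF cA[of s t], of Re] by simp
      then show ?thesis using neg st by (simp add: mult_less_0_iff)
    qed
    define x0 where "x0 = (0::real, 1 - \<epsilon>)"
    have x0: "x0 \<in> N" using \<epsilon> by (auto simp: N_def x0_def)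
    define n where "n = \<lfloor>A x0 / (2*pi)\<rfloor>"
    \<comment> \<open>\<open>c0\<close> is the angle of the leftward direction within \<pi> of
      \<open>A x0\<close>. It exists because \<open>A x0\<close> is not a multiple of
      2\<pi>.\<close>
    define c0 where "c0 = pi + of_int n * (2*pi)"
    have n: "of_int n * (2*pi) \<le> A x0" "A x0 < (of_int n + 1) * (2*pi)"
      unfolding n_def by (simp_all flip: pos_le_divide_eq pos_divide_less_eq)
    have "A x0 \<noteq> of_int n * (2*pi)"
    proof
      assume "A x0 = of_int n * (2*pi)"
      then have "cos (A x0) = 1" by (simp add: cos_one_2pi_int)
      then show False using ReN[OF x0] by simp
    qed
    then have A0c: "\<bar>A x0 - c0\<bar> < pi" using n by (auto simp: c0_def algebra_simps abs_less_iff)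
    have cisc0: "cis c0 = -1" unfolding c0_def cis_mult[symmetric]
      using cis_multiple_2pi[of "of_int n"] by (simp add: mult_ac)
    have cosc: "cos (x - c0) = - cos x" for x
    proof -
      have "cis (x - c0) = - cis x" unfolding cis_divide[symmetric] cisc0 by simp
      then show ?thesis by (metis cis.sel(1) uminus_complex.sel(1))
    qed
    have bd: "\<bar>A z - c0\<bar> < pi/2" if "z \<in> N" for z
      by (rule continuous_angle_in_half_plane[OF connN continuous_on_subset[OF contA Ntri] _ x0 A0c that])
        (use ReN cosc in auto)
    have "\<bar>l - c0\<bar> \<le> pi/2"
    proof (rule tendsto_upperbound)
      show "((\<lambda>t. \<bar>a t - c0\<bar>) \<longlongrightarrow> \<bar>l - c0\<bar>) (at_left 1)" by (intro tendsto_intros lima1)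
      show "\<forall>\<^sub>F t in at_left 1. \<bar>a t - c0\<bar> \<le> pi/2"
        unfolding eventually_at_left_field
        using \<epsilon> bd by (intro exI[of _ "1-\<epsilon>"]) (auto simp: a_def N_def less_imp_le)
    qed simp
    moreover have "cis (l - c0) = \<i>" unfolding cis_divide[symmetric] cisl cisc0 by simp
    ultimately have 1: "l - c0 = pi/2" using cis_small_angle by blast
    have "\<bar>m - c0\<bar> \<le> pi/2"
    proof (rule tendsto_upperbound)
      show "((\<lambda>t. \<bar>A (t,1) - c0\<bar>) \<longlongrightarrow> \<bar>m - c0\<bar>) (at_right 0)" by (intro tendsto_intros limA0)
      show "\<forall>\<^sub>F t in at_right 0. \<bar>A (t,1) - c0\<bar> \<le> pi/2"
        unfolding eventually_at_right_field
        using \<epsilon> bd by (intro exI[of _ \<epsilon>]) (auto simp: N_def less_imp_le)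
    qed simp
    moreover have "cis (m - c0) = -\<i>" unfolding cis_divide[symmetric] cism cisc0 by simp
    ultimately have "m - c0 = -pi/2" using cis_small_angle by blast
    with 1 show ?thesis by simp
  qed
  \<comment> \<open>The winding number around points just behind the cusp is the rotation of the curve seen from the cusp.\<close>
  have seen: "l = 3*pi/2"
  proof -
    obtain s0 where s0: "s0 > 0" "\<And>\<sigma>. 0 < \<sigma> \<Longrightarrow> \<sigma> < s0 \<Longrightarrow>
        \<i> * complex_of_real \<sigma> \<notin> c ` {0..1} \<and> winding_number c (\<i> * complex_of_real \<sigma>) = 1"
      using wind unfolding eventually_at_right_field by auto
    define r where "r = s0/2"
    have r: "0 < r" "r < s0" using s0 by (auto simp: r_def)
    \<comment> \<open>The edge at height 0 views the curve from the cusp, the edge at height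
      \<open>r\<close> from the point behind it. The two deleted corners are the places where the
      viewpoint lies on the curve.\<close>
    define W where "W = {0..1::real} \<times> {0..r} - {(0,0)} - {(1,0)}"
    have "convex ({0..1} \<times> {0..r} - {(0::real,0::real)})"
      by (rule convex_delete_corner[where \<alpha> = "-1" and \<beta> = "-1"]) (use r in \<open>auto intro!: convex_Times\<close>)
    then have "convex W" unfolding W_def
      by (rule convex_delete_corner[where \<alpha> = "1" and \<beta> = "-1"]) (use r in auto)
    define f where "f z = c (fst z) - \<i> * complex_of_real (snd z)" for z :: "real \<times> real"
    have contf: "continuous_on W f" unfolding f_def
      by (intro continuous_intros continuous_on_compose2[OF cont]) (auto simp: W_def)
    have fnz: "f z \<noteq> 0" if "z \<in> W" for z
    proof (cases "snd z = 0")
      case True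
      then have "fst z \<in> {0<..<1}" using that by (cases z) (auto simp: W_def less_le)
      then show ?thesis using cnz True by (simp add: f_def)
    next
      case False
      then have z: "0 < snd z" "snd z < s0" "fst z \<in> {0..1}" using that r by (auto simp: W_def)
      show ?thesis
      proof
        assume "f z = 0"
        then have "c (fst z) = \<i> * complex_of_real (snd z)" by (simp add: f_def)
        then show False using s0(2)[OF z(1,2)] z(3) by (metis imageI)
      qed
    qed
    obtain B where B: "continuous_on W B" "\<And>z. z \<in> W \<Longrightarrow> f z = complex_of_real (norm (f z)) * cis (B z)"
      using angle_lift_exists[OF contf convex_imp_contractible[OF \<open>convex W\<close>] fnz] by blast
    have BIm: "Im (f z) = norm (f z) * sin (B z)" if "z \<in> W" for z
      using arg_cong[OF B(2)[OF that], of Im] by simp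
    define B0 where "B0 = B (0, r)"
    define B1 where "B1 = B (1, r)"
    have inW: "(0,r) \<in> W" "(1,r) \<in> W" using r by (auto simp: W_def)
    have cisB: "cis B0 = -\<i>" "cis B1 = -\<i>"
    proof -
      have *: "f (0,r) = -\<i> * complex_of_real r" "f (1,r) = -\<i> * complex_of_real r" using ends by (auto simp: f_def)
      have "complex_of_real r * cis B0 = complex_of_real r * -\<i>" "complex_of_real r * cis B1 = complex_of_real r * -\<i>"
        using B(2)[OF inW(1)] B(2)[OF inW(2)] r unfolding * B0_def B1_def by (simp_all add: norm_mult mult.commute)
      then show "cis B0 = -\<i>" "cis B1 = -\<i>" using r by (simp_all only: mult_left_cancel of_real_eq_0_iff)
    qed
    have B01: "B1 - B0 = 2*pi"
    proof -
      have "winding_number c (\<i> * complex_of_real r) = complex_of_real ((B (1,r) - B (0,r)) / (2*pi))"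
      proof (rule winding_number_angle_lift)
        show "path c" "pathfinish c = pathstart c"
          using cont ends by (auto simp: path_def pathfinish_def pathstart_def)
        show "\<i> * complex_of_real r \<notin> path_image c" using s0(2)[OF r] by (simp add: path_image_def)
        have sub: "(\<lambda>x. (x, r)) ` {0..1} \<subseteq> W" using r by (auto simp: W_def)
        show "continuous_on {0..1} (\<lambda>x. B (x, r))"
          by (rule continuous_on_compose2[OF B(1) _ sub]) (intro continuous_intros)
        show "c x - \<i> * complex_of_real r = complex_of_real (norm (c x - \<i> * complex_of_real r)) * cis (B (x, r))"
          if "x \<in> {0..1}" for x
          using B(2)[of "(x,r)"] subsetD[OF sub imageI[OF that]] by (simp add: f_def)
      qed
      then have "complex_of_real ((B1 - B0) / (2*pi)) = 1" using s0(2)[OF r] by (simp add: B0_def B1_def)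
      then have "(B1 - B0) / (2*pi) = 1" by (metis of_real_eq_1_iff)
      then show ?thesis by (simp add: field_simps)
    qed
    have shift: "cos (x - y) = - sin x" if "cis y = -\<i>" for x y
    proof -
      have "cis (x - y) = cis x * \<i>" unfolding cis_divide[symmetric] that by (simp add: divide_simps)
      then show ?thesis by (metis cis.sel(1) cis.sel(2) times_complex.sel(1) imaginary_unit.sel mult_zero_right mult.right_neutral diff_0)
    qed
    \<comment> \<open>On the edge x = 0 the difference vector is vertical and points down, and the
      nearby branch lies below the cusp. The angle therefore cannot drift by a quarter turn while
      the viewpoint moves to the cusp.\<close>
    have near0: "\<bar>B (t,0) - B0\<bar> < pi/2" if t: "t \<in> {0<..\<epsilon>}" for t
    proof -
      let ?N = "{0..\<epsilon>} \<times> {0..r} - {(0::real,0::real)}"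
      have NW: "?N \<subseteq> W" using \<epsilon> r by (auto simp: W_def)
      have "convex ?N"
        by (rule convex_delete_corner[where \<alpha> = "-1" and \<beta> = "-1"]) (use \<epsilon> r in \<open>auto intro!: convex_Times\<close>)
      show ?thesis
      proof (rule continuous_angle_in_half_plane[OF convex_connected[OF \<open>convex ?N\<close>] continuous_on_subset[OF B(1) NW], of _ "(0,r)"])
        fix z assume z: "z \<in> ?N"
        have "Im (c (fst z)) < 0 \<or> fst z = 0"
          using Im_neg_near_start[of "fst z"] \<epsilon>(2) \<epsilon>(3)[of "fst z"] z by (cases "fst z = 0") auto
        then have "Im (f z) < 0" using z ends by (cases z) (auto simp: f_def)
        then have "sin (B z) < 0" using BIm[of z] z NW by (auto simp: mult_less_0_iff)
        then show "cos (B z - B0) > 0" using shift[OF cisB(1)] by simp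
      qed (use t \<epsilon> r in \<open>auto simp: B0_def\<close>)
    qed
    have near1: "\<bar>B (t,0) - B1\<bar> < pi/2" if t: "t \<in> {1-\<epsilon>..<1}" for t
    proof -
      let ?N = "{1-\<epsilon>..1} \<times> {0..r} - {(1::real,0::real)}"
      have NW: "?N \<subseteq> W" using \<epsilon> r by (auto simp: W_def)
      have "convex ?N"
        by (rule convex_delete_corner[where \<alpha> = "1" and \<beta> = "-1"]) (use \<epsilon> r in \<open>auto intro!: convex_Times\<close>)
      show ?thesis
      proof (rule continuous_angle_in_half_plane[OF convex_connected[OF \<open>convex ?N\<close>] continuous_on_subset[OF B(1) NW], of _ "(1,r)"])
        fix z assume z: "z \<in> ?N"
        have "Im (c (fst z)) < 0 \<or> fst z = 1"
          using Im_neg_near_end[of "fst z"] \<epsilon>(2) \<epsilon>(4)[of "fst z"] z by (cases "fst z = 1") auto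
        then have "Im (f z) < 0" using z ends by (cases z) (auto simp: f_def)
        then have "sin (B z) < 0" using BIm[of z] z NW by (auto simp: mult_less_0_iff)
        then show "cos (B z - B1) > 0" using shift[OF cisB(2)] by simp
      qed (use t \<epsilon> r in \<open>auto simp: B1_def\<close>)
    qed
    define k where "k = B (1/2,0) - a (1/2)"
    have cisk': "cis (B (t,0) - a t) = 1" if t: "t \<in> {0<..<1}" for t
    proof -
      have "(t,0) \<in> W" using t r by (auto simp: W_def)
      then have "c t = complex_of_real (norm (c t)) * cis (B (t,0))" using B(2)[of "(t,0)"] by (simp add: f_def)
      then have "cis (B (t,0)) = cis (a t)" using ca[OF t] cnz[OF t]
        by (metis mult_left_cancel norm_eq_zero of_real_eq_0_iff)
      then show ?thesis unfolding cis_divide[symmetric] by simp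
    qed
    have k: "B (t,0) = a t + k" if "t \<in> {0<..<1}" for t
    proof -
      have "B (t,0) - a t = k" unfolding k_def
      proof (rule continuous_cis_constant[of "{0<..<1}" "\<lambda>t. B (t,0) - a t" 1])
        show "continuous_on {0<..<1} (\<lambda>t. B (t,0) - a t)"
          by (intro continuous_intros continuous_on_subset[OF conta] continuous_on_compose2[OF B(1)])
            (use r in \<open>auto simp: W_def\<close>)
      qed (use that cisk' in auto)
      then show ?thesis by simp
    qed
    have cisk: "cis k = 1" using cisk'[of "1/2"] by (simp add: k_def)
    have "\<bar>-pi/2 + k - B0\<bar> \<le> pi/2"
    proof (rule tendsto_upperbound)
      show "((\<lambda>t. \<bar>a t + k - B0\<bar>) \<longlongrightarrow> \<bar>-pi/2 + k - B0\<bar>) (at_right 0)" by (intro tendsto_intros lima0)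
      show "\<forall>\<^sub>F t in at_right 0. \<bar>a t + k - B0\<bar> \<le> pi/2"
        unfolding eventually_at_right_field
        using \<epsilon> near0 k by (intro exI[of _ \<epsilon>]) (auto simp: less_imp_le)
    qed simp
    moreover have "cis (-pi/2 + k - B0) = 1"
      unfolding cis_divide[symmetric] cis_mult[symmetric] cisB cisk by (simp add: complex_eq_iff)
    ultimately have 0: "-pi/2 + k - B0 = 0" using cis_small_angle by blast
    have "\<bar>l + k - B1\<bar> \<le> pi/2"
    proof (rule tendsto_upperbound)
      show "((\<lambda>t. \<bar>a t + k - B1\<bar>) \<longlongrightarrow> \<bar>l + k - B1\<bar>) (at_left 1)" by (intro tendsto_intros lima1)
      show "\<forall>\<^sub>F t in at_left 1. \<bar>a t + k - B1\<bar> \<le> pi/2"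
        unfolding eventually_at_left_field
        using \<epsilon> near1 k by (intro exI[of _ "1-\<epsilon>"]) (auto simp: less_imp_le)
    qed simp
    moreover have "cis (l + k - B1) = 1"
      unfolding cis_divide[symmetric] cis_mult[symmetric] cisB cisk cisl by simp
    ultimately have "l + k - B1 = 0" using cis_small_angle by blast
    with 0 B01 show ?thesis by simp
  qed
  show "\<theta> 1 = 5*pi/2" using corner seen by (simp add: l_def m_def)
  show "\<exists>t\<in>{0..1}. \<exists>y>0. c t = \<i> * complex_of_real y"
  proof -
    have "\<forall>\<^sub>F t in at_left 1. a t > pi/2"
      by (rule order_tendstoD(1)[OF lima1]) (use seen pi_gt_zero in linarith)
    moreover have "\<forall>\<^sub>F t in at_left 1. t \<in> {0<..<1::real}"
      unfolding eventually_at_left_field by (intro exI[of _ 0]) auto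
    ultimately obtain t1 where t1: "a t1 > pi/2" "t1 \<in> {0<..<1}"
      using eventually_happens[OF eventually_conj] trivial_limit_at_left_real by blast
    have "\<exists>t\<ge>0. t \<le> t1 \<and> a t = pi/2"
    proof (rule IVT')
      show "a 0 \<le> pi/2" using Adiag[of 0] th0 by (simp add: a_def)
      show "continuous_on {0..t1} a" using conta by (rule continuous_on_subset) (use t1 in auto)
    qed (use t1 in auto)
    then obtain t where t: "0 \<le> t" "t \<le> t1" "a t = pi/2" by blast
    have "t \<noteq> 0" using t Adiag[of 0] th0 by (auto simp: a_def)
    then have tt: "t \<in> {0<..<1}" using t t1 by auto
    have "c t = \<i> * complex_of_real (norm (c t))" using ca[OF tt] t(3) by (simp add: mult.commute)
    then show ?thesis using cnz[OF tt] tt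
      by (intro bexI[of _ t] exI[of _ "norm (c t)"]) auto
  qed
qed

end

section \<open>Copies of the cardioid resting on a concave arc\<close>

text \<open>The argument of \<open>K\<close> is the tangent angle. The convexity of the curve enters only through \<open>dirK\<close>.\<close>
locale cardioid_normal_form =
  fixes K :: "real \<Rightarrow> complex"
  assumes contK: "continuous_on {-pi/2..5*pi/2} K"
    and K_start: "K (-pi/2) = 0" and K_end: "K (5*pi/2) = 0"
    and dirK: "\<And>p q e. \<lbrakk>-pi/2 \<le> p; p < q; q \<le> 5*pi/2; e \<le> p; q \<le> e + pi\<rbrakk> \<Longrightarrow> Im (cis (-e) * (K q - K p)) > 0"
    and axis: "\<exists>p\<in>{-pi/2..5*pi/2}. \<exists>y>0. K p = \<i> * complex_of_real y"
begin

text \<open>This variant and the next two shift \<open>e\<close> by \<pi> or 2\<pi>: a half turn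
  flips the sign, a full turn does nothing. They are needed because the parameter of the left foot
  exceeds its tangent direction by 2\<pi>.\<close>

lemma dirK_neg:
  assumes "-pi/2 \<le> p" "p < q" "q \<le> 5*pi/2" "e - pi \<le> p" "q \<le> e"
  shows "Im (cis (-e) * (K q - K p)) < 0"
proof -
  have "Im (cis (-(e - pi)) * (K q - K p)) > 0" using assms by (intro dirK) auto
  moreover have "cis (-(e - pi)) = - cis (-e)" by (simp add: complex_eq_iff)
  ultimately show ?thesis by simp
qed

lemma dirK_period:
  assumes "-pi/2 \<le> p" "p < q" "q \<le> 5*pi/2" "e + 2*pi \<le> p" "q \<le> e + 2*pi + pi"
  shows "Im (cis (-e) * (K q - K p)) > 0"
proof -
  have "Im (cis (-(e + 2*pi)) * (K q - K p)) > 0" using assms by (intro dirK) auto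
  moreover have "cis (-(e + 2*pi)) = cis (-e)" using cis_divide[of "-e" "2*pi"] by simp
  ultimately show ?thesis by (simp only:)
qed

lemma dirK_period_neg:
  assumes "-pi/2 \<le> p" "p < q" "q \<le> 5*pi/2" "e + pi \<le> p" "q \<le> e + 2*pi"
  shows "Im (cis (-e) * (K q - K p)) < 0"
proof -
  have "Im (cis (-(e + pi)) * (K q - K p)) > 0" using assms by (intro dirK) auto
  moreover have "cis (-(e + pi)) = - cis (-e)" by (simp add: complex_eq_iff)
  ultimately show ?thesis by simp
qed

lemma Re_K_right: "-pi/2 < p \<Longrightarrow> p \<le> pi/2 \<Longrightarrow> Re (K p) > 0"
  using dirK[of "-pi/2" p "-pi/2"] K_start by simp

lemma Re_K_left: "3*pi/2 \<le> p \<Longrightarrow> p < 5*pi/2 \<Longrightarrow> Re (K p) < 0"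
proof -
  assume a: "3*pi/2 \<le> p" "p < 5*pi/2"
  have "Im (cis (-(-pi/2)) * (K (5*pi/2) - K p)) > 0"
    using a pi_gt_zero by (intro dirK_period) linarith+
  then show ?thesis using K_end by simp
qed

text \<open>The crossing of the axis above the cusp separates the two halves of the outer arc, and each
  tangent line passes below the cusp.\<close>
lemma above_one_tangent:
  assumes p: "-pi/2 < p2" "p2 < p1" "p1 < pi/2"
    and below2: "Im (cis (-p2) * (K (p1 + 2*pi) - K p2)) < 0"
    and below1: "Im (cis (-p1) * (K p2 - K (p1 + 2*pi))) < 0"
    and q: "q \<in> {-pi/2..5*pi/2}" "q \<noteq> p2" "q \<noteq> p1 + 2*pi"
  shows "Im (cis (-p2) * (K q - K p2)) > 0 \<or> Im (cis (-p1) * (K q - K (p1 + 2*pi))) > 0"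
proof -
  note pg = pi_gt_zero
  define n2 where "n2 x = Im (cis (-p2) * (K x - K p2))" for x
  define n1 where "n1 x = Im (cis (-p1) * (K x - K (p1 + 2*pi)))" for x
  have n2d: "n2 x - n2 y = Im (cis (-p2) * (K x - K y))" for x y by (simp add: n2_def algebra_simps)
  have n1d: "n1 x - n1 y = Im (cis (-p1) * (K x - K y))" for x y by (simp add: n1_def algebra_simps)
  have n20: "n2 p2 = 0" and n10: "n1 (p1 + 2*pi) = 0" by (simp_all add: n2_def n1_def)
  have cusp2: "n2 (-pi/2) > 0" using dirK_neg[of "-pi/2" p2 p2] p n2d[of p2 "-pi/2"] n20 pg by auto
  have cusp1: "n1 (5*pi/2) > 0"
    using dirK_period[of "p1 + 2*pi" "5*pi/2" p1] p n1d[of "5*pi/2" "p1+2*pi"] n10 pg by auto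
  have "n2 q > 0 \<or> n1 q > 0"
  proof -
    consider "q < p2" | "p2 < q" "q \<le> p2 + pi" | "p2 + pi < q" "q < p1 + pi"
      | "p1 + pi \<le> q" "q < p1 + 2*pi" | "q > p1 + 2*pi" using q by linarith
    then show ?thesis
    proof cases
      case 1
      then show ?thesis using dirK_neg[of q p2 p2] p q n2d[of p2 q] n20 pg by auto
    next
      case 2
      then show ?thesis using dirK[of p2 q p2] p q n2d[of q p2] n20 pg by auto
    next
      case 4
      then show ?thesis using dirK_period_neg[of q "p1 + 2*pi" p1] p q n1d[of "p1+2*pi" q] n10 pg by auto
    next
      case 5
      then show ?thesis using dirK_period[of "p1 + 2*pi" q p1] p q n1d[of q "p1+2*pi"] n10 pg by auto
    next
      \<comment> \<open>In this range the height over the right foot's tangent is falling and the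
        height over the left foot's tangent is rising, so neither tangent decides alone. The axis
        point \<open>x\<close> is above both, because the cusp is and \<open>cos\<close> is positive
        at \<open>p1\<close> and \<open>p2\<close>. If \<open>q\<close> precedes \<open>x\<close>,
        it inherits the first height; if it follows, the second.\<close>
      case 3
      obtain x y where x: "x \<in> {-pi/2..5*pi/2}" "y > 0" "K x = \<i> * complex_of_real y" using axis by blast
      have "K x \<noteq> 0" using x by simp
      then have "x \<noteq> -pi/2" "x \<noteq> 5*pi/2" using K_start K_end by metis+
      then have xr: "pi/2 < x" "x < 3*pi/2"
        using Re_K_right[of x] Re_K_left[of x] x by (auto simp: not_less[symmetric])
      have h2: "n2 x > 0"
      proof -
        have "n2 x = n2 (-pi/2) + y * cos p2" using n2d[of x "-pi/2"] x(3) K_start by (simp add: algebra_simps)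
        moreover have "cos p2 > 0" using p by (intro cos_gt_zero_pi) linarith+
        ultimately show ?thesis using cusp2 x(2) by (simp add: add_pos_pos)
      qed
      have h1: "n1 x > 0"
      proof -
        have "n1 x = n1 (5*pi/2) + y * cos p1" using n1d[of x "5*pi/2"] x(3) K_end by (simp add: algebra_simps)
        moreover have "cos p1 > 0" using p by (intro cos_gt_zero_pi) linarith+
        ultimately show ?thesis using cusp1 x(2) by (simp add: add_pos_pos)
      qed
      consider "x = q" | "x > q" "x \<le> p2 + 2*pi" | "x > q" "x > p2 + 2*pi" | "x < q" "x \<ge> p1" | "x < q" "x < p1"
        by linarith
      then show ?thesis
      proof cases
        case 1 then show ?thesis using h2 by simp
      next
        case a: 2
        have "n2 x < n2 q" using dirK_period_neg[of q x p2] a 3 p q x n2d[of x q] by auto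
        then show ?thesis using h2 by simp
      next
        case a: 3
        then show ?thesis using xr p by linarith
      next
        case a: 4
        have "n1 x < n1 q" using dirK[of x q p1] a 3 p q x n1d[of q x] by auto
        then show ?thesis using h1 by simp
      next
        case a: 5
        then show ?thesis using xr p by linarith
      qed
    qed
  qed
  then show ?thesis by (simp add: n1_def n2_def)
qed

end

section \<open>Arcs that turn clockwise by less than \<pi>\<close>

locale concave_arc_data =
  fixes g :: "real \<Rightarrow> complex" and \<theta> :: "real \<Rightarrow> real" and t1 t2 :: real
  assumes t12: "t1 < t2" and contg: "continuous_on {t1..t2} g" and contt: "continuous_on {t1..t2} \<theta>"
    and decr: "\<And>s t. \<lbrakk>t1 \<le> s; s < t; t \<le> t2\<rbrakk> \<Longrightarrow> \<theta> t < \<theta> s"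
    and total: "\<theta> t1 - \<theta> t2 < pi"
    and dirg: "\<And>s t e. \<lbrakk>t1 \<le> s; s < t; t \<le> t2; e \<le> \<theta> t; \<theta> s \<le> e + pi\<rbrakk> \<Longrightarrow> Im (cis (-e) * (g t - g s)) > 0"
begin

lemma decr_le: "t1 \<le> s \<Longrightarrow> s \<le> t \<Longrightarrow> t \<le> t2 \<Longrightarrow> \<theta> t \<le> \<theta> s"
  using decr[of s t] by (cases "s = t") auto

lemma variation_lt_pi: "t1 \<le> s \<Longrightarrow> s \<le> t \<Longrightarrow> t \<le> t2 \<Longrightarrow> \<theta> s - \<theta> t < pi"
  using total decr_le[of t1 s] decr_le[of t t2] by linarith

lemma dirg_neg:
  assumes "t1 \<le> s" "s < t" "t \<le> t2" "e - pi \<le> \<theta> t" "\<theta> s \<le> e"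
  shows "Im (cis (-e) * (g t - g s)) < 0"
proof -
  have "Im (cis (-(e - pi)) * (g t - g s)) > 0" using assms by (intro dirg) auto
  moreover have "cis (-(e - pi)) = - cis (-e)" by (simp add: complex_eq_iff)
  ultimately show ?thesis by simp
qed

text \<open>Chords leaving the point of tangency point to the right of the tangent and chords
  arriving at it point to the left. The bound \<pi> on the total turning makes this hold on the
  whole arc, not merely near the point.\<close>

lemma below_tangent:
  assumes "s \<in> {t1..t2}" "t \<in> {t1..t2}" "t \<noteq> s"
  shows "Im (cis (-\<theta> s) * (g t - g s)) < 0"
proof (cases "s < t")
  case True
  then show ?thesis using dirg_neg[of s t "\<theta> s"] variation_lt_pi[of s t] assms by auto
next
  case False
  then have "Im (cis (-\<theta> s) * (g s - g t)) > 0"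
    using dirg[of t s "\<theta> s"] variation_lt_pi[of t s] assms by auto
  then show ?thesis by (simp add: algebra_simps)
qed

lemma chord_angle:
  assumes "t1 \<le> s" "s < t" "t \<le> t2"
  obtains b where "\<theta> t < b" "b < \<theta> s" "g t - g s = complex_of_real (norm (g t - g s)) * cis b" "g t \<noteq> g s"
proof -
  have 1: "Im (cis (-\<theta> t) * (g t - g s)) > 0" using below_tangent[of t s] assms by (simp add: algebra_simps)
  then have "g t \<noteq> g s" by auto
  moreover have "Im (cis (-\<theta> s) * (g t - g s)) < 0" using below_tangent[of s t] assms by simp
  ultimately show thesis using angle_between[OF 1 _ decr[OF assms]] variation_lt_pi[of s t] assms that
    by (metis less_eq_real_def)
qed

end

text \<open>After one root the function is positive, but it must reach the next root from negative
  values; the intermediate value theorem then produces a root in between. Compactness of the zero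
  set provides a next root.\<close>

lemma unique_upcrossing:
  fixes f :: "real \<Rightarrow> real"
  assumes cont: "continuous_on {l..u} f"
    and up: "\<And>x. x \<in> {l..u} \<Longrightarrow> f x = 0 \<Longrightarrow> \<exists>e>0. \<forall>d. 0 < d \<and> d < e \<longrightarrow> f (x + d) > 0 \<and> f (x - d) < 0"
    and xy: "x \<in> {l..u}" "y \<in> {l..u}" "f x = 0" "f y = 0"
  shows "x = y"
proof -
  have "False" if xy: "x \<in> {l..u}" "y \<in> {l..u}" "f x = 0" "f y = 0" "x < y" for x y
  proof -
    obtain e where e: "e > 0" "\<And>d. 0 < d \<Longrightarrow> d < e \<Longrightarrow> f (x + d) > 0" using up xy by blast
    define x' where "x' = x + min (e/2) ((y-x)/2)"
    have "min (e/2) ((y-x)/2) > 0" "min (e/2) ((y-x)/2) < e" using e xy by auto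
    then have x': "f x' > 0" "x < x'" using e(2) by (auto simp: x'_def)
    have "x' < y" using xy by (auto simp: x'_def min_def field_simps)
    define Z where "Z = {x'..y} \<inter> f -` {0}"
    have sub: "{x'..y} \<subseteq> {l..u}" using x' xy by auto
    have "closed Z" unfolding Z_def
      using continuous_closed_preimage[OF continuous_on_subset[OF cont sub]] by auto
    moreover have "bounded Z" unfolding Z_def by (rule bounded_subset[of "{x'..y}"]) auto
    ultimately have "compact Z" by (simp add: compact_eq_bounded_closed)
    moreover have "y \<in> Z" using \<open>x' < y\<close> xy by (simp add: Z_def)
    ultimately obtain z where z: "z \<in> Z" "\<And>w. w \<in> Z \<Longrightarrow> z \<le> w" using compact_attains_inf[of Z] by auto
    have z': "x' < z" "z \<le> y" "f z = 0" using z(1) x' by (auto simp: Z_def less_le)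
    obtain e0 where e0: "e0 > 0" "\<And>d. 0 < d \<Longrightarrow> d < e0 \<Longrightarrow> f (z - d) < 0"
      using up[of z] z' sub by fastforce
    define w where "w = z - min (e0/2) ((z-x')/2)"
    have mp: "min (e0/2) ((z-x')/2) > 0" "min (e0/2) ((z-x')/2) < e0" using e0(1) z' by auto
    have "min (e0/2) ((z-x')/2) < z - x'" using z' by (intro min.strict_coboundedI2) simp
    then have w: "f w < 0" "w < z" "x' < w" using mp e0(2) unfolding w_def by auto
    have "\<exists>v\<ge>x'. v \<le> w \<and> f v = 0"
    proof (rule IVT2')
      show "continuous_on {x'..w} f" using cont by (rule continuous_on_subset) (use sub w z' in auto)
    qed (use w x' in auto)
    then obtain v where "x' \<le> v" "v \<le> w" "f v = 0" by blast
    then have "v \<in> Z" using w z' by (auto simp: Z_def)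
    then show False using z(2)[of v] \<open>v \<le> w\<close> w by simp
  qed
  from this[of x y] this[of y x] show ?thesis using xy by (meson linorder_neqE_linordered_idom)
qed

section \<open>The equation for the rotation angle of a copy with two prescribed contact
  points\<close>

locale contact_family = cardioid_normal_form K + concave_arc_data g \<theta> t1 t2
  for K g \<theta> t1 t2
begin

text \<open>The angle is clamped to [-\<pi>/2, \<pi>/2], which makes both feet continuous functions
  of every real number, so that continuity can be stated on \<open>D \<times> UNIV\<close>. For
  admissible tilts the clamp is inactive.\<close>

definition "foot_r x = K (max (-pi/2) (min (pi/2) x))"
definition "foot_l x = K (2*pi + max (-pi/2) (min (pi/2) x))"
definition "gap s1 s2 \<alpha> = foot_r (\<theta> s2 - \<alpha>) - foot_l (\<theta> s1 - \<alpha>)"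

text \<open>The copy rotated by \<open>\<alpha>\<close> has the right tangents at both feet; it fits if the segment joining the
  feet is parallel to the chord of the arc.\<close>
definition "defect s1 s2 \<alpha> = Im (cnj (g s2 - g s1) * cis \<alpha> * gap s1 s2 \<alpha>)"

lemma foot_r_eq: "x \<in> {-pi/2..pi/2} \<Longrightarrow> foot_r x = K x" by (auto simp: foot_r_def)
lemma foot_l_eq: "x \<in> {-pi/2..pi/2} \<Longrightarrow> foot_l x = K (x + 2*pi)" by (auto simp: foot_l_def add.commute)

lemma continuous_foot_r: "continuous_on UNIV foot_r"
  unfolding foot_r_def
proof (rule continuous_on_compose2[OF contK])
  show "(\<lambda>x. max (- pi / 2) (min (pi / 2) x)) ` UNIV \<subseteq> {- pi / 2..5 * pi / 2}"
    using pi_gt_zero by (auto simp: max_def min_def)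
qed (intro continuous_intros)

lemma continuous_foot_l: "continuous_on UNIV foot_l"
  unfolding foot_l_def
proof (rule continuous_on_compose2[OF contK])
  show "(\<lambda>x. 2*pi + max (- pi / 2) (min (pi / 2) x)) ` UNIV \<subseteq> {- pi / 2..5 * pi / 2}"
    using pi_gt_zero by (auto simp: max_def min_def)
qed (intro continuous_intros)

text \<open>The right foot is right of the axis and the left foot left of it, unless a foot is at
  the cusp. Both cannot be there, since this would require
  \<open>\<theta> s1 - \<theta> s2 = pi\<close>. Pairs on the diagonal are included for the sake of
  \<open>gap_bound\<close>.\<close>

lemma Re_gap_pos:
  assumes "t1 \<le> s1" "s1 \<le> s2" "s2 \<le> t2" "\<alpha> \<in> {\<theta> s1 - pi/2..\<theta> s2 + pi/2}"
  shows "Re (gap s1 s2 \<alpha>) > 0"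
proof -
  have v: "\<theta> s1 - \<theta> s2 < pi" "\<theta> s2 \<le> \<theta> s1" using variation_lt_pi decr_le assms by auto
  have e: "foot_r (\<theta> s2 - \<alpha>) = K (\<theta> s2 - \<alpha>)" "foot_l (\<theta> s1 - \<alpha>) = K (\<theta> s1 - \<alpha> + 2*pi)"
    using assms v by (auto intro!: foot_r_eq foot_l_eq)
  have r: "Re (K (\<theta> s2 - \<alpha>)) > 0 \<or> \<theta> s2 - \<alpha> = -pi/2 \<and> K (\<theta> s2 - \<alpha>) = 0"
    using Re_K_right[of "\<theta> s2 - \<alpha>"] assms v K_start
    by (cases "\<theta> s2 - \<alpha> = -pi/2") auto
  have "\<theta> s1 - \<alpha> + 2*pi = 5*pi/2 \<or> \<theta> s1 - \<alpha> < pi/2" using assms by auto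
  then have l: "Re (K (\<theta> s1 - \<alpha> + 2*pi)) < 0 \<or> \<theta> s1 - \<alpha> = pi/2 \<and> K (\<theta> s1 - \<alpha> + 2*pi) = 0"
  proof
    assume "\<theta> s1 - \<alpha> + 2*pi = 5*pi/2"
    moreover from this have "\<theta> s1 - \<alpha> = pi/2" by linarith
    ultimately show ?thesis using K_end by metis
  next
    assume "\<theta> s1 - \<alpha> < pi/2"
    then show ?thesis using Re_K_left[of "\<theta> s1 - \<alpha> + 2*pi"] assms v by auto
  qed
  show ?thesis unfolding gap_def e using r l v by auto
qed

lemma defect_polar:
  assumes "g s2 - g s1 = complex_of_real (norm (g s2 - g s1)) * cis b"
  shows "defect s1 s2 \<alpha> = norm (g s2 - g s1) * Im (cis (-(b - \<alpha>)) * gap s1 s2 \<alpha>)"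
proof -
  have "cnj (g s2 - g s1) = complex_of_real (norm (g s2 - g s1)) * cis (-b)"
    by (subst assms) (simp add: cis_cnj)
  then have "cnj (g s2 - g s1) * cis \<alpha> * gap s1 s2 \<alpha> =
      complex_of_real (norm (g s2 - g s1)) * ((cis (-b) * cis \<alpha>) * gap s1 s2 \<alpha>)"
    by (simp only: mult_ac)
  then show ?thesis unfolding defect_def cis_mult by (simp add: algebra_simps)
qed

lemma defect_sign:
  assumes "g s2 - g s1 = complex_of_real (norm (g s2 - g s1)) * cis b" "g s2 \<noteq> g s1" "b - \<alpha> = c"
  shows "defect s1 s2 \<alpha> > 0 \<longleftrightarrow> Im (cis (-c) * gap s1 s2 \<alpha>) > 0"
    "defect s1 s2 \<alpha> < 0 \<longleftrightarrow> Im (cis (-c) * gap s1 s2 \<alpha>) < 0"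
  unfolding defect_polar[OF assms(1)] assms(3)
  using assms(2) by (simp_all only: zero_less_mult_iff mult_less_0_iff mult_eq_0_iff zero_less_norm_iff norm_not_less_zero norm_eq_zero right_minus_eq) auto

text \<open>A vanishing defect makes the gap parallel or antiparallel to the chord. The angle of the
  gap is within \<pi>/2 of 0 by \<open>Re_gap_pos\<close>, and \<open>b - \<alpha>\<close> is so by
  admissibility of \<alpha>, which excludes the antiparallel case.\<close>

lemma gap_polar:
  assumes s: "t1 \<le> s1" "s1 < s2" "s2 \<le> t2" and \<alpha>: "\<alpha> \<in> {\<theta> s1 - pi/2..\<theta> s2 + pi/2}"
    and b: "\<theta> s2 < b" "b < \<theta> s1" "g s2 - g s1 = complex_of_real (norm (g s2 - g s1)) * cis b" "g s2 \<noteq> g s1"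
    and z: "defect s1 s2 \<alpha> = 0"
  shows "gap s1 s2 \<alpha> = complex_of_real (norm (gap s1 s2 \<alpha>)) * cis (b - \<alpha>)" "gap s1 s2 \<alpha> \<noteq> 0"
proof -
  let ?W = "gap s1 s2 \<alpha>"
  have pos: "Re ?W > 0" using Re_gap_pos s \<alpha> by auto
  then show nz: "?W \<noteq> 0" by auto
  define c where "c = Arg ?W"
  have c: "?W = complex_of_real (norm ?W) * cis c" using rcis_cmod_Arg[of ?W] by (simp add: rcis_def c_def)
  have c2: "\<bar>c\<bar> < pi/2" using pos Arg_Re_pos[of ?W] by (simp add: c_def)
  have "cis (-(b - \<alpha>)) * ?W = complex_of_real (norm ?W) * (cis (-(b - \<alpha>)) * cis c)"
    by (subst c) (simp only: mult_ac)
  then have "Im (cis (-(b - \<alpha>)) * ?W) = norm ?W * sin (\<alpha> + c - b)" unfolding cis_mult by (simp add: algebra_simps)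
  then have "sin (\<alpha> + c - b) = 0" using z defect_polar[OF b(3)] nz b(4) by simp
  moreover have "\<bar>\<alpha> + c - b\<bar> < pi" using c2 \<alpha> b by (auto simp: abs_less_iff)
  ultimately have "\<alpha> + c - b = 0" using sin_eq_0_pi[of "\<alpha> + c - b"] unfolding abs_less_iff by auto
  then have "c = b - \<alpha>" by simp
  then show "?W = complex_of_real (norm ?W) * cis (b - \<alpha>)" using c by simp
qed

text \<open>At each end of the admissible interval one foot is the cusp, so the gap is a chord of
  the branch carrying the other foot. All tangent angles of that piece lie on one side of the chord
  direction, which fixes the sign.\<close>

lemma defect_at_ends:
  assumes s: "t1 \<le> s1" "s1 < s2" "s2 \<le> t2"
  shows "defect s1 s2 (\<theta> s2 + pi/2) > 0" "defect s1 s2 (\<theta> s1 - pi/2) < 0"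
proof -
  obtain b where b: "\<theta> s2 < b" "b < \<theta> s1" "g s2 - g s1 = complex_of_real (norm (g s2 - g s1)) * cis b" "g s2 \<noteq> g s1"
    using chord_angle[OF s] by blast
  have v: "\<theta> s1 - \<theta> s2 < pi" using variation_lt_pi s by auto
  \<comment> \<open>The right foot is at the cusp. Its value 0 is written as
    \<open>K (5*pi/2)\<close>, so that both points lie on the left branch.\<close>
  have 1: "gap s1 s2 (\<theta> s2 + pi/2) = K (5*pi/2) - K (\<theta> s1 - \<theta> s2 - pi/2 + 2*pi)"
    unfolding gap_def using foot_r_eq[of "-pi/2"] foot_l_eq[of "\<theta> s1 - \<theta> s2 - pi/2"] v b K_start K_end
    by (simp add: algebra_simps)
  have "Im (cis (-(b - (\<theta> s2 + pi/2))) * gap s1 s2 (\<theta> s2 + pi/2)) > 0"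
    unfolding 1 using v b by (intro dirK_period) auto
  then show "defect s1 s2 (\<theta> s2 + pi/2) > 0" by (simp only: defect_sign[OF b(3,4) refl])
  have 2: "gap s1 s2 (\<theta> s1 - pi/2) = K (\<theta> s2 - \<theta> s1 + pi/2) - K (-pi/2)"
    unfolding gap_def using foot_r_eq[of "\<theta> s2 - \<theta> s1 + pi/2"] foot_l_eq[of "pi/2"] v b K_start K_end
    by (simp add: algebra_simps)
  have "Im (cis (-(b - (\<theta> s1 - pi/2))) * gap s1 s2 (\<theta> s1 - pi/2)) < 0"
    unfolding 2 using v b by (intro dirK_neg) auto
  then show "defect s1 s2 (\<theta> s1 - pi/2) < 0" by (simp only: defect_sign[OF b(3,4) refl])
qed

text \<open>Raising \<alpha> by \<open>d\<close> has three effects. The gap turns by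
  \<open>d\<close> against the chord; the right foot slides back along directions below the chord
  direction \<open>c\<close>; the left foot slides back along directions above it. All three raise
  the defect, so the crossing is strict without differentiability of \<open>K\<close>. Lowering
  \<alpha> is symmetric.\<close>

lemma defect_upcrossing:
  assumes s: "t1 \<le> s1" "s1 < s2" "s2 \<le> t2" and \<alpha>: "\<alpha> \<in> {\<theta> s1 - pi/2..\<theta> s2 + pi/2}"
    and z: "defect s1 s2 \<alpha> = 0"
  shows "\<exists>e>0. \<forall>d. 0 < d \<and> d < e \<longrightarrow> defect s1 s2 (\<alpha> + d) > 0 \<and> defect s1 s2 (\<alpha> - d) < 0"
proof -
  obtain b where b: "\<theta> s2 < b" "b < \<theta> s1" "g s2 - g s1 = complex_of_real (norm (g s2 - g s1)) * cis b" "g s2 \<noteq> g s1"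
    using chord_angle[OF s] by blast
  have v: "\<theta> s1 - \<theta> s2 < pi" using variation_lt_pi s by auto
  have \<alpha>': "\<theta> s1 - pi/2 < \<alpha>" "\<alpha> < \<theta> s2 + pi/2"
    using \<alpha> z defect_at_ends[OF s] by (auto simp: less_le)
  note W = gap_polar[OF s \<alpha> b z]
  define p1 where "p1 = \<theta> s1 - \<alpha>"
  define p2 where "p2 = \<theta> s2 - \<alpha>"
  define c where "c = b - \<alpha>"
  have ord: "p2 < c" "c < p1" "-pi/2 < p2" "p1 < pi/2" using b \<alpha>' by (auto simp: p1_def p2_def c_def)
  \<comment> \<open>With this margin the shifted foot angles stay in [-\<pi>/2, \<pi>/2], and the
    pieces over which the feet slide stay on their sides of the turned chord direction.\<close>
  define e where "e = Min {c - p2, p1 - c, p2 + pi/2, pi/2 - p1}"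
  have e: "e > 0" "e \<le> c - p2" "e \<le> p1 - c" "e \<le> p2 + pi/2" "e \<le> pi/2 - p1"
    unfolding e_def using ord by auto
  show ?thesis
  proof (intro exI[of _ e] conjI allI impI)
    fix d assume "0 < d \<and> d < e"
    then have d: "0 < d" "d < e" by auto
    have sind: "sin d > 0" using d e ord by (intro sin_gt_zero) linarith+
    have S0: "gap s1 s2 \<alpha> = K p2 - K (p1 + 2*pi)"
      unfolding gap_def using foot_r_eq[of p2] foot_l_eq[of p1] ord by (simp add: p1_def p2_def)
    have Sp: "gap s1 s2 (\<alpha> + d) = K (p2 - d) - K (p1 - d + 2*pi)"
      unfolding gap_def using foot_r_eq[of "p2-d"] foot_l_eq[of "p1-d"] ord d e
      by (simp add: p1_def p2_def algebra_simps)
    have Sm: "gap s1 s2 (\<alpha> - d) = K (p2 + d) - K (p1 + d + 2*pi)"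
      unfolding gap_def using foot_r_eq[of "p2+d"] foot_l_eq[of "p1+d"] ord d e
      by (simp add: p1_def p2_def algebra_simps)
    have W': "Im (cis (-(c - x)) * gap s1 s2 \<alpha>) = norm (gap s1 s2 \<alpha>) * sin x" for x
    proof -
      have "cis (-(c - x)) * gap s1 s2 \<alpha> = complex_of_real (norm (gap s1 s2 \<alpha>)) * (cis (-(c-x)) * cis c)"
        by (subst W(1)) (simp only: c_def mult_ac)
      then show ?thesis unfolding cis_mult by simp
    qed
    have "Im (cis (-(c - d)) * (K p2 - K (p2 - d))) < 0" using ord d e by (intro dirK_neg) linarith+
    moreover have "Im (cis (-(c - d)) * (K (p1 + 2*pi) - K (p1 - d + 2*pi))) > 0"
      using ord d e by (intro dirK_period) linarith+
    moreover have "Im (cis (-(c - d)) * gap s1 s2 (\<alpha> + d)) = Im (cis (-(c - d)) * gap s1 s2 \<alpha>)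
        - Im (cis (-(c - d)) * (K p2 - K (p2 - d))) + Im (cis (-(c - d)) * (K (p1 + 2*pi) - K (p1 - d + 2*pi)))"
      unfolding Sp S0 by (simp add: algebra_simps)
    moreover have "norm (gap s1 s2 \<alpha>) * sin d > 0" using sind W(2) by simp
    ultimately have "Im (cis (-(c - d)) * gap s1 s2 (\<alpha> + d)) > 0" unfolding W' by linarith
    moreover have "b - (\<alpha> + d) = c - d" by (simp add: c_def)
    ultimately show "defect s1 s2 (\<alpha> + d) > 0" using defect_sign(1)[OF b(3,4)] by blast
    have "Im (cis (-(c - -d)) * (K (p2 + d) - K p2)) < 0" using ord d e by (intro dirK_neg) linarith+
    moreover have "Im (cis (-(c - -d)) * (K (p1 + d + 2*pi) - K (p1 + 2*pi))) > 0"
      using ord d e by (intro dirK_period) linarith+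
    moreover have "Im (cis (-(c - -d)) * gap s1 s2 (\<alpha> - d)) = Im (cis (-(c - -d)) * gap s1 s2 \<alpha>)
        + Im (cis (-(c - -d)) * (K (p2 + d) - K p2)) - Im (cis (-(c - -d)) * (K (p1 + d + 2*pi) - K (p1 + 2*pi)))"
      unfolding Sm S0 by (simp add: algebra_simps)
    moreover have "norm (gap s1 s2 \<alpha>) * sin (-d) < 0" using sind W(2) by simp
    ultimately have "Im (cis (-(c - -d)) * gap s1 s2 (\<alpha> - d)) < 0" unfolding W' by linarith
    moreover have "b - (\<alpha> - d) = c - -d" by (simp add: c_def)
    ultimately show "defect s1 s2 (\<alpha> - d) < 0" using defect_sign(2)[OF b(3,4)] by blast
  qed (use e in auto)
qed

section \<open>The family of copies over the triangle of contact pairs\<close>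

definition "D = {(s1, s2). t1 \<le> s1 \<and> s1 \<le> s2 \<and> s2 \<le> t2}"

text \<open>On the diagonal \<open>tilt\<close> is arbitrary, but \<open>scal\<close> vanishes there, so \<open>place\<close> is constant.\<close>
definition "tilt z = (THE \<alpha>. \<alpha> \<in> {\<theta> (fst z) - pi/2..\<theta> (snd z) + pi/2} \<and> defect (fst z) (snd z) \<alpha> = 0)"
text \<open>The complex factor that carries the segment between the feet to the chord. That its
  argument is the tilt is a consequence of the defect equation.\<close>

definition "scal z = (g (snd z) - g (fst z)) / gap (fst z) (snd z) (tilt z)"
definition "offs z = g (fst z) - scal z * foot_l (\<theta> (fst z) - tilt z)"
definition "place z p = scal z * K p + offs z"

lemma continuous_gap: "continuous_on (D \<times> UNIV) (\<lambda>x. gap (fst (fst x)) (snd (fst x)) (snd x))"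
  unfolding gap_def
proof (intro continuous_intros)
  have "continuous_on (D \<times> UNIV) (\<lambda>x. \<theta> (snd (fst x)))" "continuous_on (D \<times> UNIV) (\<lambda>x. \<theta> (fst (fst x)))"
    by (auto intro!: continuous_on_compose2[OF contt] continuous_intros simp: D_def)
  then have *: "continuous_on (D \<times> UNIV) (\<lambda>x. \<theta> (snd (fst x)) - snd x)" "continuous_on (D \<times> UNIV) (\<lambda>x. \<theta> (fst (fst x)) - snd x)"
    by (auto intro!: continuous_intros)
  show "continuous_on (D \<times> UNIV) (\<lambda>x. foot_r (\<theta> (snd (fst x)) - snd x))"
    by (rule continuous_on_compose2[OF continuous_foot_r *(1)]) auto
  show "continuous_on (D \<times> UNIV) (\<lambda>x. foot_l (\<theta> (fst (fst x)) - snd x))"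
    by (rule continuous_on_compose2[OF continuous_foot_l *(2)]) auto
qed

lemma continuous_chord: "continuous_on D (\<lambda>z. g (snd z) - g (fst z))"
  by (auto intro!: continuous_on_compose2[OF contg] continuous_intros simp: D_def)

lemma continuous_defect: "continuous_on (D \<times> UNIV) (\<lambda>x. defect (fst (fst x)) (snd (fst x)) (snd x))"
  unfolding defect_def
proof -
  have "continuous_on (D \<times> UNIV) (\<lambda>x. g (snd (fst x)))" "continuous_on (D \<times> UNIV) (\<lambda>x. g (fst (fst x)))"
    by (auto intro!: continuous_on_compose2[OF contg] continuous_intros simp: D_def)
  then show "continuous_on (D \<times> UNIV) (\<lambda>x. Im (cnj (g (snd (fst x)) - g (fst (fst x))) * cis (snd x) * gap (fst (fst x)) (snd (fst x)) (snd x)))"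
    by (intro continuous_intros continuous_gap)
qed

lemma continuous_defect_tilt: "(s1, s2) \<in> D \<Longrightarrow> continuous_on S (defect s1 s2)"
  by (rule continuous_on_compose2[OF continuous_defect, of _ "\<lambda>a. ((s1,s2), a)", simplified])
    (auto intro!: continuous_intros)

lemma tilt_unique:
  assumes s: "t1 \<le> s1" "s1 < s2" "s2 \<le> t2"
    and "\<alpha> \<in> {\<theta> s1 - pi/2..\<theta> s2 + pi/2}" "defect s1 s2 \<alpha> = 0"
    and "\<beta> \<in> {\<theta> s1 - pi/2..\<theta> s2 + pi/2}" "defect s1 s2 \<beta> = 0"
  shows "\<alpha> = \<beta>"
proof (rule unique_upcrossing[of "\<theta> s1 - pi/2" "\<theta> s2 + pi/2" "defect s1 s2"])
  show "continuous_on {\<theta> s1 - pi/2..\<theta> s2 + pi/2} (defect s1 s2)"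
    using s by (intro continuous_defect_tilt) (auto simp: D_def)
qed (use assms defect_upcrossing[OF s] in auto)

lemma tilt:
  assumes s: "t1 \<le> s1" "s1 < s2" "s2 \<le> t2"
  shows "\<theta> s1 - pi/2 < tilt (s1,s2)" "tilt (s1,s2) < \<theta> s2 + pi/2" "defect s1 s2 (tilt (s1,s2)) = 0"
proof -
  have "\<theta> s1 - pi/2 \<le> \<theta> s2 + pi/2" using variation_lt_pi[of s1 s2] s by auto
  then have "\<exists>\<alpha>\<ge>\<theta> s1 - pi/2. \<alpha> \<le> \<theta> s2 + pi/2 \<and> defect s1 s2 \<alpha> = 0"
    using defect_at_ends[OF s] s by (intro IVT' continuous_defect_tilt) (auto simp: D_def)
  then have "\<exists>!\<alpha>. \<alpha> \<in> {\<theta> s1 - pi/2..\<theta> s2 + pi/2} \<and> defect s1 s2 \<alpha> = 0"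
    using tilt_unique[OF s] by (metis atLeastAtMost_iff)
  then have t: "tilt (s1,s2) \<in> {\<theta> s1 - pi/2..\<theta> s2 + pi/2}" and z: "defect s1 s2 (tilt (s1,s2)) = 0"
    unfolding tilt_def by (metis (mono_tags, lifting) fst_conv snd_conv theI')+
  then show "defect s1 s2 (tilt (s1,s2)) = 0" by blast
  show "\<theta> s1 - pi/2 < tilt (s1,s2)" "tilt (s1,s2) < \<theta> s2 + pi/2"
    using t z defect_at_ends[OF s] by (auto simp: less_le)
qed

text \<open>The chord has angle \<open>b\<close> and the gap has angle \<open>b\<close> minus the
  tilt, so their quotient has the tilt as its argument. The copy is thus rotated by exactly the
  amount that makes the tangents at both feet agree with those of the arc.\<close>

lemma scal_polar:
  assumes s: "t1 \<le> s1" "s1 < s2" "s2 \<le> t2"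
  shows "scal (s1,s2) = complex_of_real (norm (scal (s1,s2))) * cis (tilt (s1,s2))" "scal (s1,s2) \<noteq> 0"
    "scal (s1,s2) * gap s1 s2 (tilt (s1,s2)) = g s2 - g s1"
proof -
  let ?a = "tilt (s1,s2)"
  obtain b where b: "\<theta> s2 < b" "b < \<theta> s1" "g s2 - g s1 = complex_of_real (norm (g s2 - g s1)) * cis b" "g s2 \<noteq> g s1"
    using chord_angle[OF s] by blast
  note W = gap_polar[OF s _ b tilt(3)[OF s]]
  have W: "gap s1 s2 ?a = complex_of_real (norm (gap s1 s2 ?a)) * cis (b - ?a)" "gap s1 s2 ?a \<noteq> 0"
    using W tilt[OF s] by auto
  show nz: "scal (s1,s2) \<noteq> 0" and "scal (s1,s2) * gap s1 s2 ?a = g s2 - g s1"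
    using W(2) b(4) by (auto simp: scal_def)
  have "scal (s1,s2) = (complex_of_real (norm (g s2 - g s1)) * cis b) / (complex_of_real (norm (gap s1 s2 ?a)) * cis (b - ?a))"
    unfolding scal_def fst_conv snd_conv using W(1) b(3) by argo
  also have "\<dots> = complex_of_real (norm (scal (s1,s2))) * (cis b / cis (b - ?a))"
    by (simp add: scal_def norm_divide)
  also have "cis b / cis (b - ?a) = cis ?a" unfolding cis_divide by simp
  finally show "scal (s1,s2) = complex_of_real (norm (scal (s1,s2))) * cis ?a" .
qed

lemma place_contacts:
  assumes s: "t1 \<le> s1" "s1 < s2" "s2 \<le> t2"
  shows "place (s1,s2) (\<theta> s2 - tilt (s1,s2)) = g s2" "place (s1,s2) (\<theta> s1 - tilt (s1,s2) + 2*pi) = g s1"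
proof -
  let ?a = "tilt (s1,s2)"
  have le: "\<theta> s2 < \<theta> s1" using decr s by auto
  have f: "foot_r (\<theta> s2 - ?a) = K (\<theta> s2 - ?a)" "foot_l (\<theta> s1 - ?a) = K (\<theta> s1 - ?a + 2*pi)"
    using tilt[OF s] le by (auto intro!: foot_r_eq foot_l_eq)
  show 1: "place (s1,s2) (\<theta> s1 - ?a + 2*pi) = g s1"
    by (simp add: place_def offs_def f)
  have "place (s1,s2) (\<theta> s2 - ?a) = g s1 + scal (s1,s2) * gap s1 s2 ?a"
    by (simp add: place_def offs_def gap_def f algebra_simps)
  then show "place (s1,s2) (\<theta> s2 - ?a) = g s2" using scal_polar(3)[OF s] by simp
qed

text \<open>The similarity multiplies heights over the tangents by the positive factor
  \<open>?r\<close>, so the claim is \<open>above_one_tangent\<close> in the frame of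
  \<open>K\<close>. There each foot is below the tangent at the other, because the arc lies below
  its tangents.\<close>

lemma place_above_one_tangent:
  assumes s: "t1 \<le> s1" "s1 < s2" "s2 \<le> t2"
    and q: "q \<in> {-pi/2..5*pi/2}" "q \<noteq> \<theta> s2 - tilt (s1,s2)" "q \<noteq> \<theta> s1 - tilt (s1,s2) + 2*pi"
  shows "Im (cis (-\<theta> s2) * (place (s1,s2) q - g s2)) > 0 \<or> Im (cis (-\<theta> s1) * (place (s1,s2) q - g s1)) > 0"
proof -
  let ?a = "tilt (s1,s2)" and ?r = "norm (scal (s1,s2))"
  define p1 where "p1 = \<theta> s1 - ?a"
  define p2 where "p2 = \<theta> s2 - ?a"
  have r: "?r > 0" using scal_polar(2)[OF s] by simp
  have le: "\<theta> s2 < \<theta> s1" using decr s by auto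
  have eqn: "cis (-t) * (scal (s1,s2) * z) = complex_of_real ?r * (cis (-(t - ?a)) * z)" for t z
  proof -
    have "cis (-t) * (scal (s1,s2) * z) = cis (-t) * ((complex_of_real ?r * cis ?a) * z)"
      using scal_polar(1)[OF s] by argo
    also have "\<dots> = complex_of_real ?r * ((cis (-t) * cis ?a) * z)" by (simp only: mult_ac)
    finally show ?thesis unfolding cis_mult by (simp add: algebra_simps)
  qed
  have d2: "place (s1,s2) x - g s2 = scal (s1,s2) * (K x - K p2)" for x
    unfolding place_contacts(1)[OF s, symmetric] by (simp add: place_def p2_def algebra_simps)
  have d1: "place (s1,s2) x - g s1 = scal (s1,s2) * (K x - K (p1 + 2*pi))" for x
    unfolding place_contacts(2)[OF s, symmetric] by (simp add: place_def p1_def algebra_simps)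
  have h2: "Im (cis (-\<theta> s2) * (place (s1,s2) x - g s2)) = ?r * Im (cis (-p2) * (K x - K p2))" for x
    unfolding d2 eqn p2_def by simp
  have h1: "Im (cis (-\<theta> s1) * (place (s1,s2) x - g s1)) = ?r * Im (cis (-p1) * (K x - K (p1 + 2*pi)))" for x
    unfolding d1 eqn p1_def by simp
  have "Im (cis (-p2) * (K q - K p2)) > 0 \<or> Im (cis (-p1) * (K q - K (p1 + 2*pi))) > 0"
  proof (rule above_one_tangent)
    have "Im (cis (-\<theta> s2) * (place (s1,s2) (p1 + 2*pi) - g s2)) < 0"
      using place_contacts(2)[OF s] below_tangent[of s2 s1] s by (simp add: p1_def)
    then show "Im (cis (-p2) * (K (p1 + 2*pi) - K p2)) < 0" unfolding h2 using r by (simp only: mult_less_0_iff) auto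
    have "Im (cis (-\<theta> s1) * (place (s1,s2) p2 - g s1)) < 0"
      using place_contacts(1)[OF s] below_tangent[of s1 s2] s by (simp add: p2_def)
    then show "Im (cis (-p1) * (K p2 - K (p1 + 2*pi))) < 0" unfolding h1 using r by (simp only: mult_less_0_iff) auto
  qed (use tilt[OF s] le q in \<open>auto simp: p1_def p2_def\<close>)
  then show ?thesis unfolding h1 h2 using r by (simp only: zero_less_mult_iff) blast
qed

lemma place_meets_arc:
  assumes s: "t1 \<le> s1" "s1 < s2" "s2 \<le> t2" and q: "q \<in> {-pi/2..5*pi/2}" "place (s1,s2) q \<in> g ` {t1..t2}"
  shows "q = \<theta> s2 - tilt (s1,s2) \<or> q = \<theta> s1 - tilt (s1,s2) + 2*pi"
proof (rule ccontr)
  assume "\<not> ?thesis"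
  then have h: "Im (cis (-\<theta> s2) * (place (s1,s2) q - g s2)) > 0 \<or> Im (cis (-\<theta> s1) * (place (s1,s2) q - g s1)) > 0"
    using place_above_one_tangent[OF s q(1)] by blast
  obtain t where t: "t \<in> {t1..t2}" "place (s1,s2) q = g t" using q by auto
  have le: "Im (cis (-\<theta> x) * (g t - g x)) \<le> 0" if "x \<in> {t1..t2}" for x
    using below_tangent[of x t] t that by (cases "t = x") auto
  show False using h le[of s1] le[of s2] s unfolding t(2) by auto
qed

text \<open>The strict signs of the defect at tilt - d and tilt + d persist for nearby pairs. They
  enclose a root, and uniqueness identifies this root with the tilt of the nearby pair.\<close>

lemma continuous_tilt:
  assumes s: "t1 \<le> s1" "s1 < s2" "s2 \<le> t2"
  shows "continuous (at (s1,s2) within D) tilt"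
  unfolding continuous_within
proof (rule tendstoI)
  fix e :: real assume e: "e > 0"
  let ?a = "tilt (s1,s2)"
  have "?a \<in> {\<theta> s1 - pi/2..\<theta> s2 + pi/2}" using tilt[OF s] by auto
  from defect_upcrossing[OF s this tilt(3)[OF s]] obtain e1 where
    e1: "e1 > 0" "\<And>d. 0 < d \<Longrightarrow> d < e1 \<Longrightarrow> defect s1 s2 (?a + d) > 0 \<and> defect s1 s2 (?a - d) < 0" by blast
  define d where "d = Min {e, e1, ?a - (\<theta> s1 - pi/2), \<theta> s2 + pi/2 - ?a} / 2"
  have m: "Min {e, e1, ?a - (\<theta> s1 - pi/2), \<theta> s2 + pi/2 - ?a} > 0" using e e1(1) tilt[OF s] by auto
  then have d: "0 < d" "d < e" "d < e1" "d < ?a - (\<theta> s1 - pi/2)" "d < \<theta> s2 + pi/2 - ?a"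
    unfolding d_def by (auto simp: min_def split: if_splits)
  have inD: "(s1,s2) \<in> D" using s by (auto simp: D_def)
  have contd: "((\<lambda>z. defect (fst z) (snd z) a) \<longlongrightarrow> defect s1 s2 a) (at (s1,s2) within D)" for a
  proof -
    have "continuous_on D (\<lambda>z. defect (fst z) (snd z) a)"
      by (rule continuous_on_compose2[OF continuous_defect, of _ "\<lambda>z. (z, a)", simplified]) (auto intro!: continuous_intros)
    then show ?thesis using inD by (fastforce simp: continuous_on_def)
  qed
  have "continuous_on D (\<lambda>z. \<theta> (fst z))" "continuous_on D (\<lambda>z. \<theta> (snd z))"
    by (auto intro!: continuous_on_compose2[OF contt] continuous_intros simp: D_def)
  then have ct: "((\<lambda>z. \<theta> (fst z)) \<longlongrightarrow> \<theta> s1) (at (s1,s2) within D)" "((\<lambda>z. \<theta> (snd z)) \<longlongrightarrow> \<theta> s2) (at (s1,s2) within D)"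
    using inD by (fastforce simp: continuous_on_def)+
  have c0: "((\<lambda>z. snd z - fst z) \<longlongrightarrow> s2 - s1) (at (s1,s2) within D)"
    by (auto intro!: tendsto_eq_intros)
  have 1: "\<forall>\<^sub>F z in at (s1,s2) within D. defect (fst z) (snd z) (?a + d) > 0"
    using order_tendstoD(1)[OF contd] e1(2)[OF d(1,3)] by blast
  have 2: "\<forall>\<^sub>F z in at (s1,s2) within D. defect (fst z) (snd z) (?a - d) < 0"
    using order_tendstoD(2)[OF contd] e1(2)[OF d(1,3)] by blast
  have 3: "\<forall>\<^sub>F z in at (s1,s2) within D. \<theta> (fst z) < ?a - d + pi/2"
    by (rule order_tendstoD(2)[OF ct(1)]) (use d in linarith)
  have 4: "\<forall>\<^sub>F z in at (s1,s2) within D. \<theta> (snd z) > ?a + d - pi/2"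
    by (rule order_tendstoD(1)[OF ct(2)]) (use d in linarith)
  have 5: "\<forall>\<^sub>F z in at (s1,s2) within D. snd z - fst z > 0"
    by (rule order_tendstoD(1)[OF c0]) (use s in simp)
  have 6: "\<forall>\<^sub>F z in at (s1,s2) within D. z \<in> D"
    by (simp add: eventually_at_filter)
  show "\<forall>\<^sub>F z in at (s1,s2) within D. dist (tilt z) ?a < e"
    using 1 2 3 4 5 6
  proof eventually_elim
    case (elim z)
    obtain x y where z: "z = (x,y)" by fastforce
    have xy: "t1 \<le> x" "x < y" "y \<le> t2" using elim z by (auto simp: D_def)
    have "\<exists>b\<ge>?a - d. b \<le> ?a + d \<and> defect x y b = 0"
      using elim z d(1) by (intro IVT' continuous_defect_tilt) auto
    then obtain b where b: "?a - d \<le> b" "b \<le> ?a + d" "defect x y b = 0" by blast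
    have "tilt z = b" unfolding z
      by (rule tilt_unique[OF xy]) (use tilt[OF xy] b elim z in auto)
    then show ?case using b d by (auto simp: dist_real_def)
  qed
qed

lemma D_cases: "z \<in> D \<Longrightarrow> (\<exists>s1 s2. z = (s1,s2) \<and> t1 \<le> s1 \<and> s1 < s2 \<and> s2 \<le> t2) \<or> (\<exists>s. z = (s,s) \<and> t1 \<le> s \<and> s \<le> t2)"
  by (auto simp: D_def less_le)

lemma place_diag: "place (s,s) q = g s" by (simp add: place_def scal_def offs_def)

lemma compact_D: "compact D" and convex_D: "convex D"
proof -
  have eq: "D = {z. inner (-1, 0) z \<le> -t1} \<inter> {z. inner (1, -1) z \<le> 0} \<inter> {z. inner (0, 1) z \<le> t2}"
    by (auto simp: inner_prod_def D_def)
  show "convex D" unfolding eq by (simp only: convex_Int convex_halfspace_le)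
  have "closed D" unfolding eq by (intro closed_Int closed_halfspace_le)
  moreover have "D \<subseteq> {t1..t2} \<times> {t1..t2}" by (auto simp: D_def)
  then have "bounded D" by (rule bounded_subset[rotated]) (auto intro!: bounded_Times)
  ultimately show "compact D" by (simp add: compact_eq_bounded_closed)
qed

text \<open>No limit of the tilt at the diagonal is at hand. The minimum is therefore taken over the
  compact set \<open>Y\<close> of all pairs with all admissible angles, diagonal included, where the
  gap has positive real part.\<close>

lemma gap_bound:
  obtains m where "m > 0" "\<And>s1 s2. \<lbrakk>t1 \<le> s1; s1 < s2; s2 \<le> t2\<rbrakk> \<Longrightarrow> norm (gap s1 s2 (tilt (s1,s2))) \<ge> m"
proof -
  define l u where "l = \<theta> t2 - pi/2" and "u = \<theta> t1 + pi/2"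
  define Y where "Y = (D \<times> {l..u}) \<inter> {x. \<theta> (fst (fst x)) - pi/2 \<le> snd x \<and> snd x \<le> \<theta> (snd (fst x)) + pi/2}"
  have "compact (D \<times> {l..u})" using compact_D by (intro compact_Times) auto
  have cY: "continuous_on (D \<times> {l..u}) (\<lambda>x. \<theta> (fst (fst x)))" "continuous_on (D \<times> {l..u}) (\<lambda>x. \<theta> (snd (fst x)))"
    by (auto intro!: continuous_on_compose2[OF contt] continuous_intros simp: D_def)
  have "Y = ((D \<times> {l..u}) \<inter> (\<lambda>x. snd x - \<theta> (fst (fst x))) -` {-pi/2..}) \<inter> ((D \<times> {l..u}) \<inter> (\<lambda>x. \<theta> (snd (fst x)) - snd x) -` {-pi/2..})"
    unfolding Y_def by auto
  moreover have "closed ((D \<times> {l..u}) \<inter> (\<lambda>x. snd x - \<theta> (fst (fst x))) -` {-pi/2..})"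
    by (rule continuous_closed_preimage)
      (auto intro!: continuous_intros cY compact_imp_closed \<open>compact (D \<times> {l..u})\<close>)
  moreover have "closed ((D \<times> {l..u}) \<inter> (\<lambda>x. \<theta> (snd (fst x)) - snd x) -` {-pi/2..})"
    by (rule continuous_closed_preimage)
      (auto intro!: continuous_intros cY compact_imp_closed \<open>compact (D \<times> {l..u})\<close>)
  ultimately have "closed Y" by auto
  then have "compact Y" using compact_Int_closed[OF \<open>compact (D \<times> {l..u})\<close>, of Y]
    by (simp add: Y_def Int_absorb1 inf.absorb2)
  have inY: "((s1,s2), tilt (s1,s2)) \<in> Y" if s: "t1 \<le> s1" "s1 < s2" "s2 \<le> t2" for s1 s2
    using tilt[OF s] s decr_le[of s1 t2] decr_le[of t1 s2] decr_le[of t1 s1] decr_le[of s2 t2]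
    by (auto simp: Y_def D_def l_def u_def)
  have "Y \<noteq> {}" using inY[of t1 t2] t12 by auto
  moreover have "continuous_on Y (\<lambda>x. norm (gap (fst (fst x)) (snd (fst x)) (snd x)))"
    by (intro continuous_on_norm continuous_on_subset[OF continuous_gap]) (auto simp: Y_def)
  ultimately obtain x0 where x0: "x0 \<in> Y" "\<And>x. x \<in> Y \<Longrightarrow> norm (gap (fst (fst x0)) (snd (fst x0)) (snd x0)) \<le> norm (gap (fst (fst x)) (snd (fst x)) (snd x))"
    using continuous_attains_inf[OF \<open>compact Y\<close>] by blast
  have "Re (gap (fst (fst x0)) (snd (fst x0)) (snd x0)) > 0"
    using x0(1) by (intro Re_gap_pos) (auto simp: Y_def D_def)
  then have "norm (gap (fst (fst x0)) (snd (fst x0)) (snd x0)) > 0" by auto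
  then show thesis by (rule that) (use x0(2)[OF inY] in simp)
qed

text \<open>Off the diagonal this is continuity of the tilt. At the diagonal the norm of
  \<open>scal\<close> is at most the length of the chord divided by \<open>m\<close>, and the feet
  are bounded, so \<open>scal\<close> and its product with a foot tend to 0 however the tilt
  behaves.\<close>

lemma continuous_scal_offs: "continuous_on D scal" "continuous_on D offs"
proof -
  obtain m where m: "m > 0" "\<And>s1 s2. \<lbrakk>t1 \<le> s1; s1 < s2; s2 \<le> t2\<rbrakk> \<Longrightarrow> norm (gap s1 s2 (tilt (s1,s2))) \<ge> m"
    using gap_bound by blast
  have iso: "isCont foot_l x" for x using continuous_foot_l by (simp add: continuous_on_eq_continuous_at)
  have "bounded (K ` {-pi/2..5*pi/2})"
    using contK compact_continuous_image compact_imp_bounded by blast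
  then obtain B where B: "\<And>x. x \<in> {-pi/2..5*pi/2} \<Longrightarrow> norm (K x) \<le> B" unfolding bounded_iff by blast
  have footB: "norm (foot_l x) \<le> B" for x
    unfolding foot_l_def using pi_gt_zero by (intro B) (auto simp: max_def min_def)
  have scal_le: "norm (scal z) \<le> norm (g (snd z) - g (fst z)) / m" if "z \<in> D" for z
    using D_cases[OF that]
  proof (elim disjE exE conjE)
    fix s1 s2 assume "z = (s1,s2)" "t1 \<le> s1" "s1 < s2" "s2 \<le> t2"
    then show ?thesis using m(2)[of s1 s2] m(1) by (simp add: scal_def norm_divide frac_le)
  qed (simp add: scal_def)
  have gf: "continuous_on D (\<lambda>z. g (fst z))" and tf: "continuous_on D (\<lambda>z. \<theta> (fst z))"
    by (auto intro!: continuous_on_compose2[OF contg] continuous_on_compose2[OF contt] continuous_intros simp: D_def)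
  have "continuous (at z within D) scal \<and> continuous (at z within D) offs" if z: "z \<in> D" for z
    using D_cases[OF z]
  proof (elim disjE exE conjE)
    fix s1 s2 assume s: "z = (s1,s2)" "t1 \<le> s1" "s1 < s2" "s2 \<le> t2"
    have ct: "(tilt \<longlongrightarrow> tilt z) (at z within D)" using continuous_tilt s by (simp add: continuous_within)
    have lg: "((\<lambda>z. g (snd z) - g (fst z)) \<longlongrightarrow> g (snd z) - g (fst z)) (at z within D)"
      using continuous_chord z by (simp add: continuous_on_def)
    have cg: "continuous (at (z, tilt z) within D \<times> UNIV) (\<lambda>x. gap (fst (fst x)) (snd (fst x)) (snd x))"
      using continuous_gap z by (simp add: continuous_on_eq_continuous_within)
    have "((\<lambda>w. gap (fst w) (snd w) (tilt w)) \<longlongrightarrow> gap (fst z) (snd z) (tilt z)) (at z within D)"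
      using continuous_within_tendsto_compose[OF cg, of "\<lambda>w. (w, tilt w)" "at z within D"]
        tendsto_Pair[OF tendsto_ident_at ct] by (simp add: eventually_at_filter)
    then have ls: "(scal \<longlongrightarrow> scal z) (at z within D)" unfolding scal_def
      using m(1) m(2)[OF s(2-)] s(1) by (intro tendsto_divide lg) auto
    have "((\<lambda>w. \<theta> (fst w) - tilt w) \<longlongrightarrow> \<theta> (fst z) - tilt z) (at z within D)"
      using tf z by (intro tendsto_diff ct) (simp add: continuous_on_def)
    then have "((\<lambda>w. foot_l (\<theta> (fst w) - tilt w)) \<longlongrightarrow> foot_l (\<theta> (fst z) - tilt z)) (at z within D)"
      by (rule isCont_tendsto_compose[OF iso])
    then have "(offs \<longlongrightarrow> offs z) (at z within D)" unfolding offs_def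
      using gf z by (intro tendsto_diff tendsto_mult ls) (auto simp: continuous_on_def)
    then show ?thesis using ls by (simp add: continuous_within)
  next
    fix s assume s: "z = (s,s)" "t1 \<le> s" "s \<le> t2"
    have lg: "((\<lambda>z. g (snd z) - g (fst z)) \<longlongrightarrow> 0) (at z within D)"
      using continuous_chord z s by (fastforce simp: continuous_on_def)
    have l0: "((\<lambda>w. norm (g (snd w) - g (fst w)) / m) \<longlongrightarrow> 0) (at z within D)"
      using tendsto_divide[OF tendsto_norm[OF lg] tendsto_const[of m]] m(1) by simp
    have ls: "(scal \<longlongrightarrow> 0) (at z within D)"
      by (rule Lim_null_comparison[OF _ l0]) (use scal_le in \<open>auto simp: eventually_at_filter\<close>)
    have l1: "((\<lambda>w. norm (scal w) * B) \<longlongrightarrow> 0) (at z within D)"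
      using tendsto_mult[OF tendsto_norm[OF ls] tendsto_const[of B]] by simp
    have "((\<lambda>w. scal w * foot_l (\<theta> (fst w) - tilt w)) \<longlongrightarrow> 0) (at z within D)"
      by (rule Lim_null_comparison[OF _ l1]) (simp add: norm_mult footB mult_left_mono)
    moreover have "((\<lambda>w. g (fst w)) \<longlongrightarrow> g s) (at z within D)"
      using gf z s by (fastforce simp: continuous_on_def)
    ultimately have "(offs \<longlongrightarrow> g s - 0) (at z within D)" unfolding offs_def by (intro tendsto_diff)
    moreover have "scal z = 0" "offs z = g s" using s by (auto simp: scal_def offs_def)
    ultimately show ?thesis using ls by (simp add: continuous_within)
  qed
  then show "continuous_on D scal" "continuous_on D offs"
    by (auto simp: continuous_on_eq_continuous_within)
qed

lemma continuous_place: "continuous_on (D \<times> {-pi/2..5*pi/2}) (\<lambda>x. place (fst x) (snd x))"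
  unfolding place_def
  by (intro continuous_intros continuous_on_compose2[OF continuous_scal_offs(1)]
      continuous_on_compose2[OF continuous_scal_offs(2)] continuous_on_compose2[OF contK]) auto

end

section \<open>Topology of the parameter triangle and of the Jordan domain\<close>

text \<open>Let \<open>S0\<close> be the component of \<open>G\<close> containing \<open>L\<close>.
  If \<open>P\<close> is not in it, let \<open>V\<close> be the component of \<open>D - S0\<close>
  around \<open>P\<close>. The closed sets \<open>D - V\<close> and \<open>closure V\<close> are
  connected, so by unicoherence their intersection \<open>Fr\<close> is connected. It lies in
  \<open>S0\<close>, and also in \<open>E2 \<union> E3\<close>, because elsewhere a relative ball in
  \<open>G\<close> would enlarge \<open>S0\<close> into \<open>V\<close>. Both \<open>X2\<close> and
  \<open>X3\<close> lead from outside \<open>V\<close> into \<open>V\<close> and hence meet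
  \<open>Fr\<close>. Two closed sets that cover a connected set and both meet it have a common point
  in it.\<close>

lemma component_frontier_crossing:
  fixes D :: "'a::euclidean_space set"
  assumes D: "convex D" "closed D" and cl: "closed G" "closed E2" "closed E3" and GD: "G \<subseteq> D"
    and L: "connected L" "L \<subseteq> G"
    and X2: "connected X2" "X2 \<subseteq> E2" "X2 \<subseteq> D" "X2 \<inter> L \<noteq> {}" "P \<in> X2"
    and X3: "connected X3" "X3 \<subseteq> E3" "X3 \<subseteq> D" "X3 \<inter> L \<noteq> {}" "P \<in> X3"
    and op: "\<And>x. x \<in> G - (E2 \<union> E3) \<Longrightarrow> \<exists>e>0. D \<inter> ball x e \<subseteq> G"
  shows "G \<inter> E2 \<inter> E3 \<noteq> {}"
proof -
  obtain l0 where l0: "l0 \<in> L" using X2 by blast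
  define S0 where "S0 = connected_component_set G l0"
  have S0: "connected S0" "closed S0" "S0 \<subseteq> G" "L \<subseteq> S0"
    unfolding S0_def using cl(1) connected_component_maximal[OF l0 L]
    by (auto simp: closed_connected_component connected_component_subset)
  show ?thesis
  proof (cases "P \<in> S0")
    case True then show ?thesis using S0 X2 X3 by auto
  next
    case False
    have PD: "P \<in> D - S0" using False X2 by auto
    define V where "V = connected_component_set (D - S0) P"
    have V: "connected V" "V \<subseteq> D - S0" "P \<in> V" "V \<in> components (D - S0)"
      unfolding V_def using PD by (auto simp: connected_component_subset[THEN subsetD] componentsI dest: connected_component_in)
    have nb: "\<exists>e>0. D \<inter> ball x e \<subseteq> V" if x: "x \<in> D - S0" "x \<in> closure V" for x
    proof -
      have "open (- S0)" using S0(2) by auto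
      then obtain e where e: "e > 0" "ball x e \<subseteq> - S0" using x(1) by (meson ComplI DiffD2 openE)
      obtain y where y: "y \<in> V" "y \<in> ball x e"
        using x(2) e(1) closure_approachable[of x V] by (auto simp: dist_commute)
      have "connected (V \<union> (D \<inter> ball x e))"
        using V(1,2) y D(1) by (intro connected_Un) (auto intro!: convex_connected convex_Int)
      moreover have "V \<union> (D \<inter> ball x e) \<subseteq> D - S0" using V e by auto
      ultimately have "V \<union> (D \<inter> ball x e) \<subseteq> V"
        unfolding V_def[of] using V(3) by (metis UnI1 V_def connected_component_maximal)
      then show ?thesis using e by auto
    qed
    have "closure (D - V) \<subseteq> D - V"
    proof
      fix x assume x: "x \<in> closure (D - V)"
      then have xD: "x \<in> D" using D(2) closure_minimal[of "D - V" D] by auto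
      have "x \<notin> V"
      proof
        assume "x \<in> V"
        then obtain e where "e > 0" "D \<inter> ball x e \<subseteq> V" using nb[of x] V(2) closure_subset by blast
        then show False using x unfolding closure_approachable by (fastforce simp: dist_commute)
      qed
      then show "x \<in> D - V" using xD by auto
    qed
    then have "closed (D - V)" using closure_subset_eq by blast
    have clV: "closure V \<subseteq> D" using V(2) D(2) by (meson Diff_subset closure_minimal subset_trans)
    define Fr where "Fr = (D - V) \<inter> closure V"
    have "connected (D - V)"
      using component_diff_connected[of S0 D V] S0 GD D(1) V(4) by (auto simp: convex_connected)
    moreover have "connected (closure V)" using V(1) by (rule connected_imp_connected_closure)
    moreover have "D = (D - V) \<union> closure V" using clV closure_subset[of V] by auto
    ultimately have connFr: "connected Fr" unfolding Fr_def
      by (intro unicoherentD[OF convex_imp_unicoherent[OF D(1)]])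
        (use \<open>closed (D - V)\<close> clV in \<open>auto simp: closed_subset\<close>)
    have FrS0: "Fr \<subseteq> S0" using nb unfolding Fr_def by (force simp: subset_iff)
    have FrE: "Fr \<subseteq> E2 \<union> E3"
    proof (rule ccontr)
      assume "\<not> ?thesis"
      then obtain x where x: "x \<in> Fr" "x \<notin> E2 \<union> E3" by blast
      then obtain e where e: "e > 0" "D \<inter> ball x e \<subseteq> G" using op[of x] FrS0 S0(3) by blast
      have "x \<in> S0" "x \<in> D" using x FrS0 by (auto simp: Fr_def)
      then have "connected (S0 \<union> (D \<inter> ball x e))"
        using S0(1) D(1) e by (intro connected_Un) (auto intro!: convex_connected convex_Int)
      moreover have "S0 \<union> (D \<inter> ball x e) \<subseteq> G" using S0 e by auto
      ultimately have "S0 \<union> (D \<inter> ball x e) \<subseteq> S0"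
        using S0(4) l0 by (metis UnI1 S0_def connected_component_maximal subsetD)
      moreover obtain y where "y \<in> V" "y \<in> ball x e"
        using x(1) e(1) closure_approachable[of x V] by (auto simp: Fr_def dist_commute)
      ultimately show False using V(2) by blast
    qed
    have meet: "X \<inter> Fr \<noteq> {}" if "connected X" "X \<subseteq> D" "X \<inter> L \<noteq> {}" "P \<in> X" for X
    proof
      assume "X \<inter> Fr = {}"
      then have "X \<inter> (D - V) \<inter> closure V = {}" by (auto simp: Fr_def)
      then have "(D - V) \<inter> X = {} \<or> closure V \<inter> X = {}"
        using connected_closedD[OF that(1), of "D - V" "closure V"] that(2) \<open>closed (D - V)\<close> closure_subset[of V]
        by (auto simp: Int_ac)
      moreover have "L \<subseteq> D - V" using S0 V(2) GD by auto
      ultimately show False using that V(3) closure_subset[of V] by auto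
    qed
    have "Fr \<inter> E2 \<noteq> {}" "Fr \<inter> E3 \<noteq> {}" using meet[of X2] meet[of X3] X2 X3 by auto
    moreover have "Fr \<inter> E2 = {} \<or> Fr \<inter> E3 = {}" if "E2 \<inter> E3 \<inter> Fr = {}"
      using connected_closedD[OF connFr that FrE cl(2,3)] by auto
    ultimately have "E2 \<inter> E3 \<inter> Fr \<noteq> {}" by blast
    then show ?thesis using FrS0 S0(3) by blast
  qed
qed

text \<open>The missing point may be in the middle of the lower edge, where deleting it destroys
  convexity. The opposite point of the upper edge still sees everything that is left.\<close>

lemma starlike_punctured_rectangle:
  fixes a b m r :: real
  assumes "a \<le> m" "m \<le> b" "r > 0"
  shows "starlike ({a..b} \<times> {0..r} - {(m, 0)})"
  unfolding starlike_def
proof (intro bexI[of _ "(m, r)"] ballI subsetI)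
  fix x y assume x: "x \<in> {a..b} \<times> {0..r} - {(m, 0)}" and y: "y \<in> closed_segment (m, r) x"
  have "convex ({a..b} \<times> {0..r})" by (intro convex_Times) auto
  then have "closed_segment (m, r) x \<subseteq> {a..b} \<times> {0..r}"
    using x assms by (intro closed_segment_subset) auto
  moreover have "y \<noteq> (m, 0)"
  proof
    assume e: "y = (m, 0)"
    obtain u where u: "0 \<le> u" "u \<le> 1" "y = (1 - u) *\<^sub>R (m, r) + u *\<^sub>R x"
      using y by (auto simp: closed_segment_def)
    have "(1 - u) * r + u * snd x = 0" using e u(3) by (metis snd_add snd_conv snd_scaleR real_scaleR_def)
    moreover have "0 \<le> (1 - u) * r" "0 \<le> u * snd x" using u assms x by auto
    ultimately have "(1 - u) * r = 0" by linarith
    then have "u = 1" using assms by simp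
    then have "y = x" using u(3) by (simp del: scaleR_Pair)
    then show False using e x by auto
  qed
  ultimately show "y \<in> {a..b} \<times> {0..r} - {(m, 0)}" using y by auto
qed (use assms in auto)

text \<open>Changing the angle by \<pi> would mean passing through the opposite direction. This
  covers the situation in which only a single ray, not a half-plane, is known to be avoided.\<close>

lemma continuous_angle_in_slit_plane:
  fixes b :: "'a::topological_space \<Rightarrow> real"
  assumes "connected S" "continuous_on S b" "\<And>x. x \<in> S \<Longrightarrow> cis (b x - b x0) \<noteq> -1" "x0 \<in> S" "x \<in> S"
  shows "\<bar>b x - b x0\<bar> < pi"
proof (rule ccontr)
  assume n: "\<not> ?thesis"
  have conn: "connected (b ` S)" using assms(1,2) connected_continuous_image by blast
  from n consider "b x \<ge> b x0 + pi" | "b x \<le> b x0 - pi" by linarith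
  then show False
  proof cases
    case 1
    then have "b x0 + pi \<in> b ` S"
      using connectedD_interval[OF conn, of "b x0" "b x" "b x0 + pi"] assms(4,5) by auto
    then obtain y where "y \<in> S" "b y - b x0 = pi" by force
    then show False using assms(3)[of y] by simp
  next
    case 2
    then have "b x0 - pi \<in> b ` S"
      using connectedD_interval[OF conn, of "b x" "b x0" "b x0 - pi"] assms(4,5) by auto
    then obtain y where y: "y \<in> S" "b y - b x0 = - pi" by force
    then have "cis (b y - b x0) = -1" by (simp add: complex_eq_iff)
    then show False using assms(3)[OF y(1)] by blast
  qed
qed

text \<open>The winding number drops by one when a point crosses the curve from left to right: the angle
  functions above and below the contact point differ by a full turn between the two sides.\<close>
lemma left_side_inside:
  assumes g: "jordan_param g" "ccw g"
    and \<delta>: "0 < \<delta>" "\<delta> < 1/2"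
    and below: "\<And>x. \<lbrakk>\<bar>x - s\<bar> \<le> \<delta>; x \<noteq> s\<rbrakk> \<Longrightarrow> Im (cis (-\<eta>) * (g x - g s)) < 0"
    and fwd: "\<And>x. \<lbrakk>s < x; x \<le> s + \<delta>\<rbrakk> \<Longrightarrow> Re (cis (-\<eta>) * (g x - g s)) > 0"
    and bwd: "\<And>x. \<lbrakk>s - \<delta> \<le> x; x < s\<rbrakk> \<Longrightarrow> Re (cis (-\<eta>) * (g x - g s)) < 0"
    and "e > 0"
  shows "\<exists>d. 0 < d \<and> d < e \<and> g s + cis \<eta> * (\<i> * complex_of_real d) \<in> inside (path_image g)"
proof -
  \<comment> \<open>Starting half a period earlier puts the contact point at parameter 1/2, in the
    interior of the unit interval.\<close>
  define h where "h x = g (s - 1/2 + x)" for x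
  define f where "f x = cis (-\<eta>) * (h x - g s)" for x
  have hfun: "h = (\<lambda>t. g (s - 1/2 + t))" by (simp add: h_def fun_eq_iff)
  note sh = jordan_param_shift[OF g(1), where s = "s - 1/2", folded hfun]
  have conth: "continuous_on {0..1} h" using sh(1) by (simp add: path_def)
  have contf: "continuous_on {0..1} f" unfolding f_def by (intro continuous_intros conth)
  have fnz: "f x \<noteq> 0" if "x \<in> {0..1}" "x \<noteq> 1/2" for x
  proof
    assume "f x = 0"
    then have eq: "g (s - 1/2 + x) = g s" by (simp add: f_def h_def)
    show False
    proof (cases "x = 1")
      case True
      then have "g (s - 1/2) = g s" using eq jordan_param_periodic[OF g(1), of "s - 1/2" 1] by simp
      then show False using jordan_param_inj[OF g(1), of "s - 1/2" s "s - 1/2"] by simp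
    next
      case False
      then show False using jordan_param_inj[OF g(1) eq, of "s - 1/2"] that by auto
    qed
  qed
  have f0: "f (1/2) = 0" by (simp add: f_def h_def)
  have f01: "f 0 = f 1" using sh(2) by (simp add: f_def pathstart_def pathfinish_def)
  have imf: "Im (f x) < 0" if "\<bar>x - 1/2\<bar> \<le> \<delta>" "x \<noteq> 1/2" for x
    using below[of "s - 1/2 + x"] that unfolding f_def h_def by simp
  have ref: "Re (f x) > 0" if "1/2 < x" "x \<le> 1/2 + \<delta>" for x
    using fwd[of "s - 1/2 + x"] that unfolding f_def h_def by simp
  have ref': "Re (f x) < 0" if "1/2 - \<delta> \<le> x" "x < 1/2" for x
    using bwd[of "s - 1/2 + x"] that unfolding f_def h_def by simp
  \<comment> \<open>Away from the contact the curve keeps the distance \<rho> from it. Hence for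
    \<open>r\<close> below \<rho> the normal segment of half-length \<open>r\<close> meets the curve
    only at the contact.\<close>
  define Q where "Q = {0..1/2-\<delta>} \<union> {1/2+\<delta>..1}"
  have "compact (f ` Q)" unfolding Q_def
    using \<delta> by (intro compact_continuous_image continuous_on_subset[OF contf] compact_Un) auto
  moreover have "0 \<notin> f ` Q" using fnz \<delta> by (force simp: Q_def)
  ultimately obtain \<rho> where \<rho>: "\<rho> > 0" "\<And>x. x \<in> Q \<Longrightarrow> norm (f x) \<ge> \<rho>"
    using separate_point_closed[of "f ` Q" 0] by (auto simp: compact_imp_closed)
  define r where "r = min e \<rho> / 2"
  have r: "0 < r" "r < e" "r < \<rho>" using \<open>e > 0\<close> \<rho>(1) by (auto simp: r_def min_def)
  have avoid: "f x \<noteq> \<i> * complex_of_real \<sigma>" "f x \<noteq> - \<i> * complex_of_real \<sigma>"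
    if "x \<in> {0..1}" "\<sigma> \<in> {0..r}" "(x, \<sigma>) \<noteq> (1/2, 0)" for x \<sigma>
  proof -
    have "f x \<noteq> \<i> * complex_of_real \<sigma> \<and> f x \<noteq> - \<i> * complex_of_real \<sigma>"
    proof (cases "x \<in> Q")
      case True
      then have "norm (f x) > \<bar>\<sigma>\<bar>" using \<rho>(2)[OF True] r that by auto
      then show ?thesis by (auto simp: norm_mult)
    next
      case False
      then have x: "\<bar>x - 1/2\<bar> \<le> \<delta>" using that by (auto simp: Q_def abs_le_iff)
      show ?thesis
      proof (cases "x = 1/2")
        case True
        then have "f x = 0" "\<sigma> \<noteq> 0" using f0 that by (simp_all only:) auto
        then show ?thesis by simp
      next
        case False
        then have "Re (f x) \<noteq> 0" using ref[of x] ref'[of x] x by (cases "x < 1/2") (auto simp: abs_le_iff)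
        then show ?thesis by auto
      qed
    qed
    then show "f x \<noteq> \<i> * complex_of_real \<sigma>" "f x \<noteq> - \<i> * complex_of_real \<sigma>" by auto
  qed
  define W where "W = {0..1} \<times> {0..r} - {(1/2::real, 0::real)}"
  define N where "N = {1/2-\<delta>..1/2+\<delta>} \<times> {0..r} - {(1/2::real, 0::real)}"
  have "contractible W" unfolding W_def using r
    by (intro starlike_imp_contractible starlike_punctured_rectangle) auto
  have "connected N" unfolding N_def using r \<delta>
    by (intro starlike_imp_connected starlike_punctured_rectangle) auto
  have NW: "N \<subseteq> W" using \<delta> by (auto simp: N_def W_def)
  have cfst: "continuous_on W (\<lambda>z. f (fst z))"
    by (rule continuous_on_compose2[OF contf]) (auto intro!: continuous_intros simp: W_def)
  define fp where "fp z = f (fst z) - \<i> * complex_of_real (snd z)" for z :: "real \<times> real"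
  define fm where "fm z = f (fst z) + \<i> * complex_of_real (snd z)" for z :: "real \<times> real"
  have cp: "continuous_on W fp" "continuous_on W fm" unfolding fp_def fm_def by (intro continuous_intros cfst)+
  have pnz: "fp z \<noteq> 0" "fm z \<noteq> 0" if "z \<in> W" for z
    using avoid[of "fst z" "snd z"] that by (auto simp: fp_def fm_def W_def add_eq_0_iff2)
  obtain Bp where Bp: "continuous_on W Bp" "\<And>z. z \<in> W \<Longrightarrow> fp z = complex_of_real (norm (fp z)) * cis (Bp z)"
    using angle_lift_exists[OF cp(1) \<open>contractible W\<close> pnz(1)] by blast
  obtain Bm where Bm: "continuous_on W Bm" "\<And>z. z \<in> W \<Longrightarrow> fm z = complex_of_real (norm (fm z)) * cis (Bm z)"
    using angle_lift_exists[OF cp(2) \<open>contractible W\<close> pnz(2)] by blast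
  define x0 where "x0 = (1/2::real, r)"
  have x0: "x0 \<in> N" "x0 \<in> W" using r \<delta> by (auto simp: x0_def N_def W_def)
  have cisp: "cis (Bp x0) = -\<i>"
  proof -
    have "fp x0 = complex_of_real r * (-\<i>)" by (simp add: fp_def x0_def f0)
    then have "complex_of_real r * cis (Bp x0) = complex_of_real r * (-\<i>)" using Bp(2)[OF x0(2)] r by (simp add: norm_mult)
    then show ?thesis using r by (simp only: mult_left_cancel of_real_eq_0_iff)
  qed
  have cism: "cis (Bm x0) = \<i>"
  proof -
    have "fm x0 = complex_of_real r * \<i>" by (simp add: fm_def x0_def f0)
    then have "complex_of_real r * cis (Bm x0) = complex_of_real r * \<i>" using Bm(2)[OF x0(2)] r by (simp add: norm_mult)
    then show ?thesis using r by (simp only: mult_left_cancel of_real_eq_0_iff)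
  qed
  have dp: "cis (Bp z - Bp x0) = \<i> * cis (Bp z)" for z
    unfolding cis_divide[symmetric] cisp by (simp add: divide_simps)
  have dm: "cis (Bm z - Bm x0) = -\<i> * cis (Bm z)" for z
    unfolding cis_divide[symmetric] cism by (simp add: divide_simps)
  have nearp: "\<bar>Bp z - Bp x0\<bar> < pi/2" if z: "z \<in> N" for z
  proof (rule continuous_angle_in_half_plane[OF \<open>connected N\<close> continuous_on_subset[OF Bp(1) NW] _ x0(1) _ z])
    fix y assume y: "y \<in> N"
    have y0: "snd y \<ge> 0" using y by (auto simp: N_def)
    have "Im (fp y) < 0"
    proof (cases "fst y = 1/2")
      case True
      then have "f (fst y) = 0" using f0 by metis
      moreover have "snd y \<noteq> 0" using y True by (metis N_def DiffD2 prod.collapse singletonI)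
      ultimately show ?thesis using y0 by (simp add: fp_def)
    next
      case False
      then have "Im (f (fst y)) < 0" using imf[of "fst y"] y by (auto simp: N_def abs_le_iff)
      then show ?thesis using y0 by (simp add: fp_def)
    qed
    moreover have "Im (fp y) = norm (fp y) * sin (Bp y)" using arg_cong[OF Bp(2)[of y], of Im] y NW by auto
    ultimately have "sin (Bp y) < 0" by (simp add: mult_less_0_iff)
    moreover have "cos (Bp y - Bp x0) = - sin (Bp y)" using arg_cong[OF dp[of y], of Re] by simp
    ultimately show "cos (Bp y - Bp x0) > 0" by simp
  qed simp
  \<comment> \<open>Seen from below, the nearby curve may be higher or lower than the viewpoint but
    never straight down, since its horizontal coordinate vanishes only at the contact. Only a slit
    is avoided here, whereas from above a whole half-plane is.\<close>
  have nearm: "\<bar>Bm z - Bm x0\<bar> < pi" if z: "z \<in> N" for z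
  proof (rule continuous_angle_in_slit_plane[OF \<open>connected N\<close> continuous_on_subset[OF Bm(1) NW] _ x0(1) z])
    fix y assume y: "y \<in> N"
    show "cis (Bm y - Bm x0) \<noteq> -1"
    proof
      assume "cis (Bm y - Bm x0) = -1"
      then have "cis (Bm y) = -\<i>" unfolding dm by (simp add: complex_eq_iff)
      then have fy: "fm y = complex_of_real (norm (fm y)) * (-\<i>)" using Bm(2)[of y] y NW by auto
      have "Re (fm y) = 0" "Im (fm y) \<le> 0" by (subst fy, simp)+
      then have "Re (f (fst y)) = 0" "Im (f (fst y)) + snd y \<le> 0" by (auto simp: fm_def)
      then have "fst y = 1/2" using ref[of "fst y"] ref'[of "fst y"] y
        by (cases "fst y < 1/2"; cases "fst y > 1/2") (auto simp: N_def)
      moreover from this have "f (fst y) = 0" using f0 by metis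
      moreover have "snd y \<ge> 0" using y by (auto simp: N_def)
      ultimately have "y = (1/2, 0)" using \<open>Im (f (fst y)) + snd y \<le> 0\<close> by (simp add: prod_eq_iff)
      then show False using y by (auto simp: N_def)
    qed
  qed
  define \<Delta> where "\<Delta> x = Bm (x, 0) - Bp (x, 0)" for x
  have cis\<Delta>: "cis (\<Delta> x) = 1" if "x \<in> {0..1}" "x \<noteq> 1/2" for x
  proof -
    have xW: "(x, 0) \<in> W" using that r by (auto simp: W_def)
    have "fp (x,0) = fm (x,0)" by (simp add: fp_def fm_def)
    then have "complex_of_real (norm (fm (x,0))) * cis (Bm (x,0)) = complex_of_real (norm (fm (x,0))) * cis (Bp (x,0))"
      using Bm(2)[OF xW] Bp(2)[OF xW] by metis
    then have "cis (Bm (x,0)) = cis (Bp (x,0))" using pnz(2)[OF xW] by simp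
    then show ?thesis unfolding \<Delta>_def cis_divide[symmetric] by simp
  qed
  have cont\<Delta>: "continuous_on ({0..1} - {1/2}) \<Delta>" unfolding \<Delta>_def
    by (intro continuous_intros continuous_on_compose2[OF Bm(1)] continuous_on_compose2[OF Bp(1)])
      (use r in \<open>auto simp: W_def\<close>)
  define c where "c = Bm x0 - Bp x0"
  have cisc: "cis c = -1" unfolding c_def cis_divide[symmetric] cisp cism by simp
  have pm: "y = pi \<or> y = -pi" if "cis y = -1" "\<bar>y\<bar> < 3*pi/2" for y
  proof -
    have "cis (y - pi) = 1" unfolding cis_divide[symmetric] that(1) by simp
    then have "cos (y - pi) = 1" by (metis cis.sel(1) one_complex.sel(1))
    then obtain n :: int where n: "y - pi = of_int n * 2 * pi" unfolding cos_one_2pi_int by blast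
    then have y: "y = (2 * of_int n + 1) * pi" by (simp add: algebra_simps)
    then have "\<bar>2 * real_of_int n + 1\<bar> * pi < 3/2 * pi" using that(2) by (simp add: abs_mult)
    then have "\<bar>2 * real_of_int n + 1\<bar> < 3/2" by (simp only: mult_less_cancel_right_pos pi_gt_zero)
    then have "n = 0 \<or> n = -1" by linarith
    then show ?thesis using y by auto
  qed
  \<comment> \<open>Both functions measure the same vector at height 0, so \<Delta> is a multiple of
    2\<pi>, while \<open>c\<close> is an odd multiple of \<pi>. The two bounds leave \<pi> and
    -\<pi>; which one occurs depends on the side of the contact.\<close>
  have \<Delta>c: "\<Delta> x - c = pi \<or> \<Delta> x - c = -pi" if "(x, 0) \<in> N" for x
  proof (rule pm)
    have "x \<in> {0..1}" "x \<noteq> 1/2" using that \<delta> by (auto simp: N_def)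
    then show "cis (\<Delta> x - c) = -1" unfolding cis_divide[symmetric] using cis\<Delta> cisc by simp
    show "\<bar>\<Delta> x - c\<bar> < 3*pi/2" using nearp[OF that] nearm[OF that] unfolding \<Delta>_def c_def by linarith
  qed
  define a where "a = 1/2 - \<delta>"
  define b where "b = 1/2 + \<delta>"
  have abN: "(a, 0) \<in> N" "(b, 0) \<in> N" using \<delta> r by (auto simp: N_def a_def b_def)
  have sgn: "Re (f x) = norm (f x) * sin (Bp (x,0) - Bp x0)" if "(x,0) \<in> N" for x
  proof -
    have "sin (Bp (x,0) - Bp x0) = cos (Bp (x,0))" using arg_cong[OF dp[of "(x,0)"], of Im] by simp
    moreover have "fp (x,0) = f x" by (simp add: fp_def)
    ultimately show ?thesis using arg_cong[OF Bp(2)[of "(x,0)"], of Re] that NW by auto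
  qed
  have \<Delta>a: "\<Delta> a = c + pi"
  proof -
    have "norm (f a) * sin (Bp (a,0) - Bp x0) < 0" using sgn[OF abN(1)] ref'[of a] \<delta> by (simp add: a_def)
    then have "sin (Bp (a,0) - Bp x0) < 0" by (simp add: mult_less_0_iff)
    moreover have "sin (Bp (a,0) - Bp x0) \<ge> 0" if "Bp (a,0) - Bp x0 \<ge> 0"
      using nearp[OF abN(1)] that by (intro sin_ge_zero) linarith+
    ultimately have "Bp (a,0) - Bp x0 < 0" by linarith
    then show ?thesis using \<Delta>c[OF abN(1)] nearm[OF abN(1)] unfolding \<Delta>_def c_def by linarith
  qed
  have \<Delta>b: "\<Delta> b = c - pi"
  proof -
    have "norm (f b) * sin (Bp (b,0) - Bp x0) > 0" using sgn[OF abN(2)] ref[of b] \<delta> by (simp add: b_def)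
    then have "sin (Bp (b,0) - Bp x0) > 0" by (simp add: zero_less_mult_iff)
    moreover have "sin (- (Bp (b,0) - Bp x0)) \<ge> 0" if "Bp (b,0) - Bp x0 \<le> 0"
      using nearp[OF abN(2)] that by (intro sin_ge_zero) linarith+
    ultimately have "Bp (b,0) - Bp x0 > 0" unfolding sin_minus by linarith
    then show ?thesis using \<Delta>c[OF abN(2)] nearm[OF abN(2)] unfolding \<Delta>_def c_def by linarith
  qed
  have "\<Delta> 0 = \<Delta> a"
    by (rule continuous_cis_constant[of "{0..a}" \<Delta> 1])
      (use \<delta> cis\<Delta> in \<open>auto simp: a_def intro!: continuous_on_subset[OF cont\<Delta>]\<close>)
  moreover have "\<Delta> b = \<Delta> 1"
    by (rule continuous_cis_constant[of "{b..1}" \<Delta> 1])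
      (use \<delta> cis\<Delta> in \<open>auto simp: b_def intro!: continuous_on_subset[OF cont\<Delta>]\<close>)
  ultimately have jump: "(Bp (1,0) - Bp (0,0)) - (Bm (1,0) - Bm (0,0)) = 2*pi"
    using \<Delta>a \<Delta>b by (simp add: \<Delta>_def)
  have sub: "(\<lambda>\<sigma>. (1,\<sigma>)) ` {0..r} \<subseteq> W" "(\<lambda>\<sigma>. (0,\<sigma>)) ` {0..r} \<subseteq> W" by (auto simp: W_def)
  \<comment> \<open>On the edges x = 0 and x = 1 the loop is at the same point, so the increment of
    an angle function over the loop is a multiple of 2\<pi> at every height, hence constant in the
    height.\<close>
  have const: "B (1,r) - B (0,r) = B (1,0) - B (0,0)"
    if B: "continuous_on W B" "\<And>z. z \<in> W \<Longrightarrow> F z = complex_of_real (norm (F z)) * cis (B z)"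
      "\<And>z. z \<in> W \<Longrightarrow> F z \<noteq> 0" "\<And>\<sigma>. F (1,\<sigma>) = F (0,\<sigma>)" for B F
  proof (rule continuous_cis_constant[of "{0..r}" "\<lambda>\<sigma>. B (1,\<sigma>) - B (0,\<sigma>)" 1])
    show "continuous_on {0..r} (\<lambda>\<sigma>. B (1,\<sigma>) - B (0,\<sigma>))"
      by (intro continuous_intros continuous_on_compose2[OF B(1) _ sub(1)] continuous_on_compose2[OF B(1) _ sub(2)])
    fix \<sigma> assume "\<sigma> \<in> {0..r}"
    then have w: "(1,\<sigma>) \<in> W" "(0,\<sigma>) \<in> W" using sub by auto
    have "complex_of_real (norm (F (0,\<sigma>))) * cis (B (1,\<sigma>)) = complex_of_real (norm (F (0,\<sigma>))) * cis (B (0,\<sigma>))"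
      using B(2)[OF w(1)] B(2)[OF w(2)] B(4)[of \<sigma>] by metis
    then have "cis (B (1,\<sigma>)) = cis (B (0,\<sigma>))" using B(3)[OF w(2)] by simp
    then show "cis (B (1,\<sigma>) - B (0,\<sigma>)) = 1" unfolding cis_divide[symmetric] by simp
  qed (use r in auto)
  define zp where "zp = g s + cis \<eta> * (\<i> * complex_of_real r)"
  define zm where "zm = g s - cis \<eta> * (\<i> * complex_of_real r)"
  have cc: "cis \<eta> * cis (-\<eta>) = 1" by (simp add: cis_mult)
  have hf: "h x - g s = cis \<eta> * f x" for x
    unfolding f_def mult.assoc[symmetric] cc by simp
  have hp: "h x - zp = cis \<eta> * fp (x, r)" for x
    using hf[of x] by (simp add: zp_def fp_def algebra_simps)
  have hm: "h x - zm = cis \<eta> * fm (x, r)" for x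
    using hf[of x] by (simp add: zm_def fm_def algebra_simps)
  have sr: "(\<lambda>x. (x, r)) ` {0..1} \<subseteq> W" using r by (auto simp: W_def)
  have wn: "z \<notin> path_image h \<and> winding_number h z = complex_of_real ((B (1,r) - B (0,r)) / (2*pi))"
    if B: "continuous_on W B" "\<And>z. z \<in> W \<Longrightarrow> F z = complex_of_real (norm (F z)) * cis (B z)"
      "\<And>z. z \<in> W \<Longrightarrow> F z \<noteq> 0" "\<And>x. h x - z = cis \<eta> * F (x, r)" for B F z
  proof
    show z: "z \<notin> path_image h"
    proof
      assume "z \<in> path_image h"
      then obtain x where x: "x \<in> {0..1}" "h x = z" by (auto simp: path_image_def)
      then have "F (x,r) = 0" using B(4)[of x] by simp
      then show False using B(3) sr x by blast
    qed
    have "winding_number h z = complex_of_real (((B (1,r) + \<eta>) - (B (0,r) + \<eta>)) / (2*pi))"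
    proof (rule winding_number_angle_lift[where b = "\<lambda>x. B (x,r) + \<eta>"])
      show "path h" "pathfinish h = pathstart h" by (fact sh)+
      show "continuous_on {0..1} (\<lambda>x. B (x,r) + \<eta>)"
        by (intro continuous_intros continuous_on_compose2[OF B(1) _ sr])
      fix x :: real assume "x \<in> {0..1}"
      then have w: "(x,r) \<in> W" using sr by auto
      have "h x - z = cis \<eta> * (complex_of_real (norm (F (x,r))) * cis (B (x,r)))" using B(4)[of x] B(2)[OF w] by argo
      moreover have "norm (h x - z) = norm (F (x,r))" using B(4)[of x] by (simp add: norm_mult)
      ultimately show "h x - z = complex_of_real (norm (h x - z)) * cis (B (x,r) + \<eta>)"
        unfolding cis_mult[symmetric] by (simp add: mult_ac)
    qed (fact z)
    then show "winding_number h z = complex_of_real ((B (1,r) - B (0,r)) / (2*pi))" by simp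
  qed
  have wp: "zp \<notin> path_image h \<and> winding_number h zp = complex_of_real ((Bp (1,r) - Bp (0,r)) / (2*pi))"
    by (rule wn[OF Bp pnz(1) hp])
  have wm: "zm \<notin> path_image h \<and> winding_number h zm = complex_of_real ((Bm (1,r) - Bm (0,r)) / (2*pi))"
    by (rule wn[OF Bm pnz(2) hm])
  have "Bp (1,r) - Bp (0,r) = Bp (1,0) - Bp (0,0)"
    by (rule const[OF Bp pnz(1)]) (simp_all add: fp_def f01)
  moreover have "Bm (1,r) - Bm (0,r) = Bm (1,0) - Bm (0,0)"
    by (rule const[OF Bm pnz(2)]) (simp_all add: fm_def f01)
  ultimately have j: "(Bp (1,r) - Bp (0,r)) - (Bm (1,r) - Bm (0,r)) = 2*pi" using jump by simp
  note gim = sh(3)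
  note wg = sh(4)
  have "winding_number g zp - winding_number g zm = 1"
  proof -
    have "winding_number g zp = complex_of_real ((Bp (1,r) - Bp (0,r)) / (2*pi))"
      "winding_number g zm = complex_of_real ((Bm (1,r) - Bm (0,r)) / (2*pi))"
      using wp wm wg gim by metis+
    then have "winding_number g zp - winding_number g zm = complex_of_real (((Bp (1,r) - Bp (0,r)) - (Bm (1,r) - Bm (0,r))) / (2*pi))"
      by (simp only: diff_divide_distrib of_real_diff)
    then show ?thesis unfolding j by simp
  qed
  \<comment> \<open>The orientation allows only the values 0 and 1 off the curve. The point on the
    left exceeds one of them by 1, so its winding number is not 0 and it is not outside.\<close>
  moreover have "winding_number g zm = 0 \<or> winding_number g zm = 1"
  proof (cases "zm \<in> inside (path_image g)")
    case True then show ?thesis using g(2) by (auto simp: ccw_def)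
  next
    case False
    then have "zm \<in> outside (path_image g)" using wm gim by (metis ComplI UnE inside_Un_outside)
    moreover have "path g" "pathfinish g = pathstart g"
      using g(1) jordan_param_periodic[OF g(1), of 0 1] by (auto simp: jordan_param_def simple_path_def pathfinish_def pathstart_def)
    ultimately show ?thesis using winding_number_zero_in_outside by blast
  qed
  ultimately have "winding_number g zp \<noteq> 0" by (auto simp: diff_eq_eq)
  then have "zp \<in> inside (path_image g)"
  proof -
    have "path g" "pathfinish g = pathstart g"
      using g(1) jordan_param_periodic[OF g(1), of 0 1] by (auto simp: jordan_param_def simple_path_def pathfinish_def pathstart_def)
    then have "zp \<notin> outside (path_image g)" using winding_number_zero_in_outside \<open>winding_number g zp \<noteq> 0\<close> by blast
    then show ?thesis using wp gim by (metis ComplI UnE inside_Un_outside)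
  qed
  then show ?thesis using r unfolding zp_def by blast
qed

section \<open>Normal forms of the two curves\<close>

text \<open>A rotation adds \<eta> to the angle function and leaves its increment unchanged.\<close>

lemma winding_number_rotate:
  assumes "path h" "pathfinish h = pathstart h" "z \<notin> path_image h"
  shows "winding_number (\<lambda>x. cis \<eta> * (h x - w)) (cis \<eta> * (z - w)) = winding_number h z"
    "cis \<eta> * (z - w) \<notin> (\<lambda>x. cis \<eta> * (h x - w)) ` {0..1}"
proof -
  have ch: "continuous_on {0..1} h" using assms(1) by (simp add: path_def)
  have nz: "h x - z \<noteq> 0" if "x \<in> {0..1}" for x using assms(3) that by (auto simp: path_image_def)
  show n: "cis \<eta> * (z - w) \<notin> (\<lambda>x. cis \<eta> * (h x - w)) ` {0..1}"
  proof
    assume "cis \<eta> * (z - w) \<in> (\<lambda>x. cis \<eta> * (h x - w)) ` {0..1}"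
    then obtain x where "x \<in> {0..1}" "cis \<eta> * (z - w) = cis \<eta> * (h x - w)" by blast
    then show False using nz[of x] by simp
  qed
  have "continuous_on {0..1} (\<lambda>x. h x - z)" by (intro continuous_intros ch)
  then obtain b where b: "continuous_on {0..1} b" "\<And>x. x \<in> {0..1} \<Longrightarrow> h x - z = complex_of_real (norm (h x - z)) * cis (b x)"
    using angle_lift_exists[of "{0..1}" "\<lambda>x. h x - z"] nz convex_imp_contractible[OF convex_real_interval(5)] by blast
  have "winding_number (\<lambda>x. cis \<eta> * (h x - w)) (cis \<eta> * (z - w)) = complex_of_real (((b 1 + \<eta>) - (b 0 + \<eta>)) / (2*pi))"
  proof (rule winding_number_angle_lift[where b = "\<lambda>x. b x + \<eta>"])
    show "path (\<lambda>x. cis \<eta> * (h x - w))" unfolding path_def by (intro continuous_intros ch)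
    show "pathfinish (\<lambda>x. cis \<eta> * (h x - w)) = pathstart (\<lambda>x. cis \<eta> * (h x - w))"
      using assms(2) by (simp add: pathfinish_def pathstart_def)
    show "cis \<eta> * (z - w) \<notin> path_image (\<lambda>x. cis \<eta> * (h x - w))" using n by (simp add: path_image_def)
    show "continuous_on {0..1} (\<lambda>x. b x + \<eta>)" by (intro continuous_intros b)
    fix x :: real assume x: "x \<in> {0..1}"
    have e: "cis \<eta> * (h x - w) - cis \<eta> * (z - w) = cis \<eta> * (h x - z)" by (simp add: algebra_simps)
    have "cis \<eta> * (h x - z) = cis \<eta> * (complex_of_real (norm (h x - z)) * cis (b x))" using b(2)[OF x] by argo
    also have "\<dots> = complex_of_real (norm (h x - z)) * cis (b x + \<eta>)" unfolding cis_mult[symmetric] by (simp only: mult_ac)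
    finally show "cis \<eta> * (h x - w) - cis \<eta> * (z - w) = complex_of_real (norm (cis \<eta> * (h x - w) - cis \<eta> * (z - w))) * cis (b x + \<eta>)"
      unfolding e by (simp add: norm_mult)
  qed
  also have "\<dots> = winding_number h z" using winding_number_angle_lift[OF assms b] by simp
  finally show "winding_number (\<lambda>x. cis \<eta> * (h x - w)) (cis \<eta> * (z - w)) = winding_number h z" .
qed

lemma curvature_speed:
  "Im (cnj (vd_iter 1 g t) * vd_iter 2 g t) / (norm (vd_iter 1 g t))\<^sup>2 = curvature g t * norm (vd_iter 1 g t)"
  by (cases "vd_iter 1 g t = 0") (simp_all add: curvature_def power2_eq_square power3_eq_cube)

lemma smooth_regular_onD:
  assumes "smooth_regular_on g S" "t \<in> S"
  shows "(g has_vector_derivative vd_iter 1 g t) (at t)"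
    "(vd_iter 1 g has_vector_derivative vd_iter 2 g t) (at t)" "vd_iter 1 g t \<noteq> 0"
proof -
  have *: "(vd_iter n g has_vector_derivative vd_iter (Suc n) g t) (at t)" for n
    using assms by (auto simp: smooth_regular_on_def)
  show "(g has_vector_derivative vd_iter 1 g t) (at t)" using *[of 0] by simp
  show "(vd_iter 1 g has_vector_derivative vd_iter 2 g t) (at t)" using *[of 1] by (simp add: numeral_2_eq_2)
  show "vd_iter 1 g t \<noteq> 0" using assms by (auto simp: smooth_regular_on_def)
qed

text \<open>The angle bounds concern the open interval only, so the end tangents may have the
  extreme angles \<open>e\<close> and \<open>e + pi\<close>. This is what permits the weak
  inequalities in \<open>dir\<close> and \<open>dirg\<close>.\<close>

lemma arc_direction_angle:
  fixes c c' :: "real \<Rightarrow> complex"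
  assumes "a < b" "continuous_on {a..b} c"
    and "\<And>t. t \<in> {a<..<b} \<Longrightarrow> (c has_vector_derivative c' t) (at t)"
    and "\<And>t. t \<in> {a<..<b} \<Longrightarrow> c' t \<noteq> 0"
    and "\<And>t. t \<in> {a<..<b} \<Longrightarrow> c' t = complex_of_real (norm (c' t)) * cis (\<theta> t)"
    and "\<And>t. t \<in> {a<..<b} \<Longrightarrow> e < \<theta> t \<and> \<theta> t < e + pi"
  shows "Im (cis (-e) * (c b - c a)) > 0"
proof (rule arc_direction[OF assms(1-3)])
  fix t assume t: "t \<in> {a<..<b}"
  have "cis (-e) * c' t = cis (-e) * (complex_of_real (norm (c' t)) * cis (\<theta> t))" using assms(5)[OF t] by argo
  also have "\<dots> = complex_of_real (norm (c' t)) * cis (\<theta> t - e)"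
    unfolding diff_conv_add_uminus cis_mult[symmetric] by (simp only: mult_ac)
  finally have "Im (cis (-e) * c' t) = norm (c' t) * sin (\<theta> t - e)" by simp
  moreover have "sin (\<theta> t - e) > 0" using assms(6)[OF t] by (intro sin_gt_zero) auto
  ultimately show "Im (cis (-e) * c' t) > 0" using assms(4)[OF t] by simp
qed

context normalized_cusp_curve
begin

text \<open>With both end values known, \<theta> is a homeomorphism onto an interval of length
  3\<pi>, and its inverse is the new parameter. Since \<open>dir\<close> speaks of chords, it
  carries over without differentiating the inverse.\<close>

lemma reparametrize_by_angle:
  obtains K where "cardioid_normal_form K" "K ` {-pi/2..5*pi/2} = c ` {0..1}"
proof -
  note end1 = turning_and_axis(1)
  have inj': "inj_on \<theta> {0..1}" using mono by (intro linorder_inj_onI) (force+)?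
  have img: "\<theta> ` {0..1} = {-pi/2..5*pi/2}"
  proof
    show "\<theta> ` {0..1} \<subseteq> {-pi/2..5*pi/2}"
    proof
      fix y assume "y \<in> \<theta> ` {0..1}"
      then obtain x where x: "x \<in> {0..1}" "y = \<theta> x" by blast
      have "\<theta> 0 \<le> \<theta> x" "\<theta> x \<le> \<theta> 1" using mono[of 0 x] mono[of x 1] x by (cases "x = 0"; cases "x = 1"; force)+
      then show "y \<in> {-pi/2..5*pi/2}" using x th0 end1 by simp
    qed
    show "{-pi/2..5*pi/2} \<subseteq> \<theta> ` {0..1}"
    proof
      fix y assume "y \<in> {-pi/2..5*pi/2}"
      then have "\<exists>x\<ge>0. x \<le> 1 \<and> \<theta> x = y" using th0 end1 contt by (intro IVT') auto
      then show "y \<in> \<theta> ` {0..1}" by force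
    qed
  qed
  define u where "u = inv_into {0..1} \<theta>"
  have u: "u p \<in> {0..1}" "\<theta> (u p) = p" if "p \<in> {-pi/2..5*pi/2}" for p
    using that unfolding img[symmetric] u_def by (rule inv_into_into, rule f_inv_into_f)
  have u': "u (\<theta> x) = x" if "x \<in> {0..1}" for x using that inj' by (simp add: u_def)
  have contu: "continuous_on {-pi/2..5*pi/2} u"
    using continuous_on_inv[OF contt compact_Icc, of u] u' img by auto
  have um: "u p < u q" if "p \<in> {-pi/2..5*pi/2}" "q \<in> {-pi/2..5*pi/2}" "p < q" for p q
  proof (rule ccontr)
    assume "\<not> u p < u q"
    then have "\<theta> (u q) \<le> \<theta> (u p)" using mono[of "u q" "u p"] u(1)[OF that(1)] u(1)[OF that(2)]
      by (cases "u p = u q") auto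
    then show False using u(2)[OF that(1)] u(2)[OF that(2)] that(3) by linarith
  qed
  have imu: "u ` {-pi/2..5*pi/2} = {0..1}" unfolding img[symmetric] using u' by (force simp: image_image)
  show thesis
  proof (rule that[of "c \<circ> u"])
    show "cardioid_normal_form (c \<circ> u)"
    proof
      show "continuous_on {- pi / 2..5 * pi / 2} (c \<circ> u)"
        by (intro continuous_on_compose contu) (simp only: imu cont)
      have "u (-pi/2) = 0" using u'[of 0] th0 by simp
      then show "(c \<circ> u) (- pi / 2) = 0" using ends by simp
      have "u (5*pi/2) = 1" using u'[of 1] end1 by simp
      then show "(c \<circ> u) (5 * pi / 2) = 0" using ends by simp
      show "0 < Im (cis (- e) * ((c \<circ> u) q - (c \<circ> u) p))"
        if "- pi / 2 \<le> p" "p < q" "q \<le> 5 * pi / 2" "e \<le> p" "q \<le> e + pi" for p q e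
      proof -
        have pq: "p \<in> {-pi/2..5*pi/2}" "q \<in> {-pi/2..5*pi/2}" using that by auto
        show ?thesis unfolding o_apply
          using u[OF pq(1)] u[OF pq(2)] um[OF pq that(2)] that by (intro dir) auto
      qed
      obtain t y where t: "t \<in> {0..1}" "y > 0" "c t = \<i> * complex_of_real y" using turning_and_axis(2) by blast
      show "\<exists>p\<in>{- pi / 2..5 * pi / 2}. \<exists>y>0. (c \<circ> u) p = \<i> * complex_of_real y"
      proof (intro bexI[of _ "\<theta> t"] exI[of _ y] conjI)
        show "(c \<circ> u) (\<theta> t) = \<i> * complex_of_real y" using u'[OF t(1)] t by simp
        show "\<theta> t \<in> {- pi / 2..5 * pi / 2}" using img t(1) by blast
      qed (fact t)
    qed
    show "(c \<circ> u) ` {-pi/2..5*pi/2} = c ` {0..1}" by (simp only: image_comp[symmetric] imu)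
  qed
qed

end

lemma cardioid_normalization:
  assumes "cardioid_like C"
  obtains K a b where "cardioid_normal_form K" "a \<noteq> 0" "K ` {-pi/2..5*pi/2} = (\<lambda>z. a * z + b) ` C"
proof -
  obtain g t0 where gp: "cardioid_param g t0" and C: "C = path_image g"
    using assms by (auto simp: cardioid_like_def)
  define S where "S = {t::real. \<forall>k::int. t \<noteq> t0 + of_int k}"
  have J: "jordan_param g" "ccw g" and sm: "smooth_regular_on g S"
    and curv: "\<And>t. t \<in> S \<Longrightarrow> curvature g t > 0" and inw: "inward_cusp g t0"
    using gp by (auto simp: cardioid_param_def S_def)
  obtain v where v: "cusp g t0 v" "\<forall>\<^sub>F s in at_right 0. g t0 - complex_of_real s * v \<in> inside (path_image g)"
    using inw by (auto simp: inward_cusp_def)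
  have inS: "t \<in> S" if "t \<in> {t0<..<t0+1}" for t
  proof -
    have "t \<noteq> t0 + of_int k" for k :: int
    proof
      assume "t = t0 + of_int k"
      then have "0 < real_of_int k" "real_of_int k < 1" using that by auto
      then show False by simp
    qed
    then show ?thesis by (simp add: S_def)
  qed
  have inS': "t \<in> S" if "t \<in> {t0-1<..<t0}" for t
    using inS[of "t+1"] that unfolding S_def
    by (auto simp: algebra_simps)
  note D = smooth_regular_onD[OF sm]
  have per: "vd_iter 1 g (t + 1) = vd_iter 1 g t" if "t \<in> S" for t
  proof -
    have "((g \<circ> (\<lambda>x. x - 1)) has_vector_derivative 1 *\<^sub>R vd_iter 1 g t) (at (t + 1))"
      by (rule vector_diff_chain_at) (use D(1)[OF that] in \<open>auto intro!: derivative_eq_intros\<close>)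
    moreover have "g \<circ> (\<lambda>x. x - 1) = g"
      using jordan_param_periodic[OF J(1), of _ "-1"] by (auto simp: fun_eq_iff)
    ultimately have "vector_derivative g (at (t + 1)) = vd_iter 1 g t"
      by (simp add: vector_derivative_at)
    then show ?thesis by simp
  qed
  let ?u = "\<lambda>t. vd_iter 1 g t / complex_of_real (norm (vd_iter 1 g t))"
  have nv: "norm v = 1" and lim0: "(?u \<longlongrightarrow> v) (at_right t0)" and liml: "(?u \<longlongrightarrow> -v) (at_left t0)"
    using v(1) by (auto simp: cusp_def)
  \<comment> \<open>The cusp condition describes the left limit at \<open>t0\<close>; periodicity
    moves it to the right end of the period.\<close>
  have lim1: "(?u \<longlongrightarrow> -v) (at_left (t0+1))"
  proof -
    have "((\<lambda>x. ?u (x + 1)) \<longlongrightarrow> -v) (at_left t0)"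
    proof (rule Lim_transform_eventually[OF liml])
      show "\<forall>\<^sub>F x in at_left t0. ?u x = ?u (x + 1)"
        unfolding eventually_at_left_field
        by (rule exI[of _ "t0 - 1"]) (use inS' per in auto)
    qed
    moreover have "at_left (t0 + 1) = filtermap (\<lambda>x. x + 1) (at_left t0)"
      using filtermap_at_left_shift[of "-1" t0] by (simp add: algebra_simps)
    ultimately show ?thesis by (simp add: filterlim_filtermap)
  qed
  have t01: "t0 < t0 + 1" by simp
  obtain \<theta> where \<theta>: "continuous_on {t0..t0+1} \<theta>" "cis (\<theta> t0) = v" "cis (\<theta> (t0+1)) = -v"
    "\<And>t. t \<in> {t0<..<t0+1} \<Longrightarrow> vd_iter 1 g t = complex_of_real (norm (vd_iter 1 g t)) * cis (\<theta> t)"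
    "\<And>t. t \<in> {t0<..<t0+1} \<Longrightarrow>
      (\<theta> has_real_derivative Im (cnj (vd_iter 1 g t) * vd_iter 2 g t) / (norm (vd_iter 1 g t))\<^sup>2) (at t)"
    by (rule tangent_angle_exists[OF t01 D(2)[OF inS] D(3)[OF inS] nv lim0 _ lim1]) (use nv that in \<open>simp_all\<close>)
  \<comment> \<open>This rotation takes the cusp direction \<open>v\<close> to \<open>-\<i>\<close>,
    that is, to tangent angle -\<pi>/2.\<close>
  define \<eta> where "\<eta> = - \<theta> t0 - pi/2"
  define c where "c x = cis \<eta> * (g (t0 + x) - g t0)" for x
  define \<psi> where "\<psi> x = \<theta> (t0 + x) + \<eta>" for x
  have contg: "continuous_on UNIV g" using J(1) by (simp add: jordan_param_def)
  have \<theta>mono: "\<theta> x < \<theta> y" if "t0 \<le> x" "x < y" "y \<le> t0 + 1" for x y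
  proof (rule DERIV_pos_imp_increasing_open[OF that(2)])
    fix t assume t: "x < t" "t < y"
    then have t': "t \<in> {t0<..<t0+1}" using that by auto
    have "curvature g t * norm (vd_iter 1 g t) > 0" using curv D(3) inS[OF t'] by simp
    then show "\<exists>d. (\<theta> has_real_derivative d) (at t) \<and> 0 < d"
      using \<theta>(5)[OF t'] unfolding curvature_speed by blast
  next
    show "continuous_on {x..y} \<theta>" using \<theta>(1) by (rule continuous_on_subset) (use that in auto)
  qed
  have \<eta>v: "cis \<eta> = -\<i> / v"
  proof -
    have "\<eta> = -pi/2 - \<theta> t0" by (simp add: \<eta>_def)
    then have "cis \<eta> = cis (-pi/2) / cis (\<theta> t0)" by (simp only: cis_divide)
    moreover have "cis (-pi/2) = -\<i>" by (simp add: complex_eq_iff)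
    ultimately show ?thesis using \<theta>(2) by simp
  qed
  have v0: "v \<noteq> 0" using nv by auto
  interpret normalized_cusp_curve c \<psi>
  proof
    show "continuous_on {0..1} c" unfolding c_def
      by (intro continuous_intros continuous_on_compose2[OF contg]) auto
    show "c 0 = 0" by (simp add: c_def)
    show "c 1 = 0" using jordan_param_periodic[OF J(1), of t0 1] by (simp add: c_def)
    show "c s \<noteq> c t" if st: "0 \<le> s" "s < t" "t \<le> 1" "(s, t) \<noteq> (0, 1)" for s t
    proof
      assume "c s = c t"
      then have eq: "g (t0 + s) = g (t0 + t)" by (simp add: c_def)
      show False
      proof (cases "t = 1")
        case True
        then have "g (t0 + s) = g t0" using eq jordan_param_periodic[OF J(1), of t0 1] by simp
        then show False using jordan_param_inj[OF J(1), of "t0 + s" t0 t0] st True by auto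
      next
        case False
        then show False using jordan_param_inj[OF J(1) eq, of t0] st by auto
      qed
    qed
    show "continuous_on {0..1} \<psi>" unfolding \<psi>_def
      by (intro continuous_intros continuous_on_compose2[OF \<theta>(1)]) auto
    show "\<psi> s < \<psi> t" if "0 \<le> s" "s < t" "t \<le> 1" for s t
      using \<theta>mono[of "t0+s" "t0+t"] that by (simp add: \<psi>_def)
    show "0 < Im (cis (- e) * (c t - c s))"
      if st: "0 \<le> s" "s < t" "t \<le> 1" "e \<le> \<psi> s" "\<psi> t \<le> e + pi" for s t e
    proof -
      have "Im (cis (-(e - \<eta>)) * (g (t0 + t) - g (t0 + s))) > 0"
      proof (rule arc_direction_angle[of _ _ _ "vd_iter 1 g" \<theta>])
        fix x assume x: "x \<in> {t0+s<..<t0+t}"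
        then have x': "x \<in> {t0<..<t0+1}" using st by auto
        show "(g has_vector_derivative vd_iter 1 g x) (at x)" "vd_iter 1 g x \<noteq> 0" using D inS[OF x'] by auto
        show "vd_iter 1 g x = complex_of_real (norm (vd_iter 1 g x)) * cis (\<theta> x)" by (rule \<theta>(4)[OF x'])
        have "\<theta> (t0+s) < \<theta> x" "\<theta> x < \<theta> (t0+t)" using \<theta>mono x st by auto
        then show "e - \<eta> < \<theta> x \<and> \<theta> x < e - \<eta> + pi" using st by (auto simp: \<psi>_def)
      qed (use st contg in \<open>auto intro: continuous_on_subset\<close>)
      moreover have "cis (-e) * (c t - c s) = (cis (-e) * cis \<eta>) * (g (t0 + t) - g (t0 + s))"
        by (simp add: c_def algebra_simps)
      moreover have "-e + \<eta> = -(e - \<eta>)" by simp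
      ultimately show ?thesis unfolding cis_mult by (simp only:)
    qed
    show "\<psi> 0 = - pi / 2" by (simp add: \<psi>_def \<eta>_def)
    show "cis (\<psi> 1) = \<i>"
      unfolding \<psi>_def cis_mult[symmetric] \<theta>(3) \<eta>v using v0 by simp
    show "\<forall>\<^sub>F \<sigma> in at_right 0. \<i> * complex_of_real \<sigma> \<notin> c ` {0..1} \<and> winding_number c (\<i> * complex_of_real \<sigma>) = 1"
      using v(2)
    proof eventually_elim
      case (elim \<sigma>)
      define z where "z = g t0 - complex_of_real \<sigma> * v"
      have z: "z \<in> inside (path_image g)" using elim by (simp add: z_def)
      then have zn: "z \<notin> path_image g" by (simp add: inside_def)
      have wz: "winding_number g z = 1" using J(2) z by (auto simp: ccw_def)
      note sh = jordan_param_shift[OF J(1), where s = t0]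
      have e: "cis \<eta> * (z - g t0) = \<i> * complex_of_real \<sigma>" unfolding \<eta>v z_def using v0 by simp
      have "z \<notin> path_image (\<lambda>t. g (t0 + t))" using zn sh(3) by simp
      note W = winding_number_rotate[OF sh(1,2) this, of \<eta> "g t0"]
      have cc: "c = (\<lambda>x. cis \<eta> * (g (t0 + x) - g t0))" by (auto simp: c_def fun_eq_iff)
      show ?case using W sh(4)[OF zn] wz unfolding e cc by simp
    qed
  qed
  obtain K where K: "cardioid_normal_form K" "K ` {-pi/2..5*pi/2} = c ` {0..1}"
    by (rule reparametrize_by_angle)
  have "C = (\<lambda>t. g (t0 + t)) ` {0..1}"
    using jordan_param_shift(3)[OF J(1), where s = t0] C by (simp add: path_image_def)
  then have "c ` {0..1} = (\<lambda>z. cis \<eta> * z + (- cis \<eta> * g t0)) ` C"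
    by (simp add: c_def image_image algebra_simps)
  then show thesis using that[OF K(1), of "cis \<eta>" "- cis \<eta> * g t0"] K(2) by auto
qed

text \<open>As the curvature is negative, its absolute value times the speed is the derivative of
  -\<theta>. By the fundamental theorem of calculus the given variation is the drop of \<theta>
  along the arc, with end values taken from the limits of the tangent at the cusps.\<close>

lemma deltoid_concave_arc_data:
  assumes "deltoid_param g t1 t2 t3" "concave_arc g t1 t2"
  obtains \<theta> where "concave_arc_data g \<theta> t1 t2"
proof -
  define S where "S = {t::real. \<forall>k::int. t \<noteq> t1 + of_int k \<and> t \<noteq> t2 + of_int k \<and> t \<noteq> t3 + of_int k}"
  have J: "jordan_param g" and sm: "smooth_regular_on g S" and ord: "t1 < t2" "t2 < t3" "t3 < t1 + 1"
    and cu: "outward_cusp g t1" "outward_cusp g t2"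
    using assms(1) by (auto simp: deltoid_param_def S_def)
  have neg: "curvature g t < 0" if "t \<in> {t1<..<t2}" for t using assms(2) that by (auto simp: concave_arc_def)
  obtain V where V: "((\<lambda>t. \<bar>curvature g t\<bar> * norm (vd_iter 1 g t)) has_integral V) {t1..t2}" "V < pi"
    using assms(2) by (auto simp: concave_arc_def tangent_variation_less_def)
  have inS: "t \<in> S" if t: "t \<in> {t1<..<t2}" for t
  proof -
    have "t \<noteq> t1 + of_int k" "t \<noteq> t2 + of_int k" "t \<noteq> t3 + of_int k" for k :: int
    proof -
      have k: "real_of_int k \<le> -1 \<or> real_of_int k = 0 \<or> real_of_int k \<ge> 1"
        using of_int_le_iff[of k "-1", where ?'a = real] of_int_le_iff[of 1 k, where ?'a = real] by auto
      show "t \<noteq> t1 + of_int k" "t \<noteq> t2 + of_int k" "t \<noteq> t3 + of_int k" using k t ord by auto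
    qed
    then show ?thesis by (simp add: S_def)
  qed
  note D = smooth_regular_onD[OF sm]
  let ?u = "\<lambda>t. vd_iter 1 g t / complex_of_real (norm (vd_iter 1 g t))"
  obtain v1 where v1: "norm v1 = 1" "(?u \<longlongrightarrow> v1) (at_right t1)" using cu(1) by (auto simp: outward_cusp_def cusp_def)
  obtain v2 where v2: "norm v2 = 1" "(?u \<longlongrightarrow> -v2) (at_left t2)" using cu(2) by (auto simp: outward_cusp_def cusp_def)
  obtain \<theta> where \<theta>: "continuous_on {t1..t2} \<theta>"
    "\<And>t. t \<in> {t1<..<t2} \<Longrightarrow> vd_iter 1 g t = complex_of_real (norm (vd_iter 1 g t)) * cis (\<theta> t)"
    "\<And>t. t \<in> {t1<..<t2} \<Longrightarrow>
      (\<theta> has_real_derivative Im (cnj (vd_iter 1 g t) * vd_iter 2 g t) / (norm (vd_iter 1 g t))\<^sup>2) (at t)"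
    by (rule tangent_angle_exists[OF ord(1) D(2)[OF inS] D(3)[OF inS] v1 _ v2(2)]) (use v2(1) that in \<open>simp_all\<close>)
  have contg: "continuous_on UNIV g" using J(1) by (simp add: jordan_param_def)
  have decr: "\<theta> y < \<theta> x" if "t1 \<le> x" "x < y" "y \<le> t2" for x y
  proof (rule DERIV_neg_imp_decreasing_open[OF that(2)])
    fix t assume t: "x < t" "t < y"
    then have t': "t \<in> {t1<..<t2}" using that by auto
    have "curvature g t * norm (vd_iter 1 g t) < 0" using neg[OF t'] D(3) inS[OF t'] by (simp add: mult_neg_pos)
    then show "\<exists>d. (\<theta> has_real_derivative d) (at t) \<and> d < 0"
      using \<theta>(3)[OF t'] unfolding curvature_speed by blast
  next
    show "continuous_on {x..y} \<theta>" using \<theta>(1) by (rule continuous_on_subset) (use that in auto)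
  qed
  have "((\<lambda>t. \<bar>curvature g t\<bar> * norm (vd_iter 1 g t)) has_integral ((- \<theta> t2) - (- \<theta> t1))) {t1..t2}"
  proof (rule fundamental_theorem_of_calculus_interior)
    show "continuous_on {t1..t2} (\<lambda>t. - \<theta> t)" by (intro continuous_intros \<theta>)
    fix t assume t: "t \<in> {t1<..<t2}"
    have "((\<lambda>t. - \<theta> t) has_real_derivative - (curvature g t * norm (vd_iter 1 g t))) (at t)"
      using \<theta>(3)[OF t] unfolding curvature_speed by (rule DERIV_minus)
    then show "((\<lambda>t. - \<theta> t) has_vector_derivative \<bar>curvature g t\<bar> * norm (vd_iter 1 g t)) (at t)"
      using neg[OF t] by (simp add: has_real_derivative_iff_has_vector_derivative)
  qed (use ord in auto)
  then have "V = \<theta> t1 - \<theta> t2" using has_integral_unique[OF V(1)] by fastforce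
  then have total: "\<theta> t1 - \<theta> t2 < pi" using V(2) by simp
  have "concave_arc_data g \<theta> t1 t2"
  proof
    show "t1 < t2" by (fact ord)
    show "continuous_on {t1..t2} g" using contg by (rule continuous_on_subset) auto
    show "0 < Im (cis (- e) * (g t - g s))"
      if st: "t1 \<le> s" "s < t" "t \<le> t2" "e \<le> \<theta> t" "\<theta> s \<le> e + pi" for s t e
    proof (rule arc_direction_angle[of _ _ _ "vd_iter 1 g" \<theta>])
      fix x assume x: "x \<in> {s<..<t}"
      then have x': "x \<in> {t1<..<t2}" using st by auto
      show "(g has_vector_derivative vd_iter 1 g x) (at x)" "vd_iter 1 g x \<noteq> 0" using D inS[OF x'] by auto
      show "vd_iter 1 g x = complex_of_real (norm (vd_iter 1 g x)) * cis (\<theta> x)" by (rule \<theta>(2)[OF x'])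
      have "\<theta> x < \<theta> s" "\<theta> t < \<theta> x" using decr x st by auto
      then show "e < \<theta> x \<and> \<theta> x < e + pi" using st by auto
    qed (use st contg in \<open>auto intro: continuous_on_subset\<close>)
  qed (use \<theta>(1) decr total in auto)
  then show thesis by (rule that)
qed

section \<open>Inscribed positions\<close>

locale inscription = contact_family K g \<theta> t1 t2
  for K g \<theta> t1 t2 +
  fixes t3 :: real
  assumes jordan: "jordan_param g" and orient: "ccw g" and t23: "t2 < t3" and t31: "t3 < t1 + 1"
begin

abbreviation "T \<equiv> path_image g"
abbreviation "side2 \<equiv> g ` {t2..t3}"
abbreviation "side3 \<equiv> g ` {t3..t1+1}"
abbreviation "I \<equiv> {-pi/2..5*pi/2}"

text \<open>The two feet cut the closed curve \<open>K\<close> into two arcs. The cusp, at parameter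
  -\<pi>/2, always lies on one of them and the parameter \<pi> on the other, so these two points can
  certify on which side of \<open>T\<close> the arcs are.\<close>

lemma witnesses_in_I: "-pi/2 \<in> I" "pi \<in> I"
proof -
  have "-pi/2 \<le> 5*pi/2" "-pi/2 \<le> pi" "pi \<le> 5*pi/2" using pi_gt_zero by linarith+
  then show "-pi/2 \<in> I" "pi \<in> I" unfolding atLeastAtMost_iff by blast+
qed

lemma T_eq: "T = g ` {t1..t2} \<union> side2 \<union> side3"
proof -
  have "T = (\<lambda>t. g (t1 + t)) ` {0..1}"
    using jordan_param_shift(3)[OF jordan, where s = t1] by (simp add: path_image_def)
  also have "\<dots> = g ` ((+) t1 ` {0..1})" by (simp only: image_image)
  also have "(+) t1 ` {0..1} = {t1..t1+1}" by simp
  also have "{t1..t1+1} = {t1..t2} \<union> {t2..t3} \<union> {t3..t1+1}" using t12 t23 t31 by auto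
  finally show ?thesis by (simp add: image_Un)
qed

lemma continuous_g: "continuous_on S g"
  using jordan by (auto simp: jordan_param_def intro: continuous_on_subset)

lemma compact_sides: "compact side2" "compact side3" "compact T"
proof -
  show "compact side2" "compact side3" by (auto intro!: compact_continuous_image continuous_g)
  show "compact T" unfolding path_image_def by (auto intro!: compact_continuous_image continuous_g)
qed

lemma frontier_inside_T: "frontier (inside T) = T"
proof -
  have "simple_path g" "pathfinish g = pathstart g"
    using jordan jordan_param_periodic[OF jordan, of 0 1]
    by (auto simp: jordan_param_def pathfinish_def pathstart_def)
  then show ?thesis using Jordan_inside_outside[of g] by auto
qed

lemma T_subset_closure_inside: "T \<subseteq> closure (inside T)"
  using frontier_inside_T by (metis closure_Un_frontier sup.cobounded2)

lemma closure_inside_cases: "x \<in> closure (inside T) \<Longrightarrow> x \<notin> T \<Longrightarrow> x \<in> inside T"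
  using frontier_inside_T closure_Un_frontier[of "inside T"] by auto

lemma open_inside_T: "open (inside T)"
  using compact_sides(3) by (simp add: open_inside compact_imp_closed)

lemma connected_into_inside:
  assumes "connected S" "S \<inter> T = {}" "x \<in> S" "x \<in> inside T"
  shows "S \<subseteq> inside T"
proof
  fix y assume "y \<in> S"
  then have "connected_component (- T) x y"
    using assms unfolding connected_component_def by (intro exI[of _ S]) auto
  then show "y \<in> inside T" using assms(4) inside_same_component by blast
qed

lemma inner_point_not_on_sides:
  assumes "t1 < s" "s < t2" shows "g s \<notin> side2 \<union> side3"
proof
  assume "g s \<in> side2 \<union> side3"
  then obtain x where "x \<in> {t2..t3} \<union> {t3..t1+1}" and eq: "g s = g x" by blast
  then have x: "t2 \<le> x" "x \<le> t1 + 1" using t12 t23 t31 by auto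
  show False
  proof (cases "x = t1 + 1")
    case True
    then have "g s = g t1" using eq jordan_param_periodic[OF jordan, of t1 1] by simp
    then show False using jordan_param_inj[OF jordan, of s t1 t1] assms t23 t31 by auto
  next
    case False
    then show False using jordan_param_inj[OF jordan eq, of t1] x assms t12 by auto
  qed
qed

text \<open>The number \<delta> is chosen so that the tangent turns by less than \<pi>/2 near
  \<open>s\<close>. Then \<open>dirg\<close>, applied to the direction turned back by \<pi>/2, gives
  the horizontal signs that \<open>left_side_inside\<close> asks for, and
  \<open>below_tangent\<close> gives the vertical one.\<close>

lemma left_of_arc_inside:
  assumes s: "t1 < s" "s < t2" and "e > 0"
  shows "\<exists>d. 0 < d \<and> d < e \<and> g s + cis (\<theta> s) * (\<i> * complex_of_real d) \<in> inside T"
proof -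
  have p: "pi/2 > 0" by simp
  obtain d0 where d0: "d0 > 0" "\<And>x. x \<in> {t1..t2} \<Longrightarrow> dist x s < d0 \<Longrightarrow> dist (\<theta> x) (\<theta> s) < pi/2"
    using contt p s unfolding continuous_on_iff by (metis atLeastAtMost_iff less_eq_real_def)
  define \<delta> where "\<delta> = Min {d0, s - t1, t2 - s, 1/2} / 2"
  have "Min {d0, s - t1, t2 - s, 1/2} > 0" using d0(1) s by auto
  moreover have "Min {d0, s - t1, t2 - s, 1/2} \<le> d0" "Min {d0, s - t1, t2 - s, 1/2} \<le> s - t1"
    "Min {d0, s - t1, t2 - s, 1/2} \<le> t2 - s" "Min {d0, s - t1, t2 - s, 1/2} \<le> 1/2"
    by (rule Min_le, simp, simp)+
  ultimately have \<delta>: "0 < \<delta>" "\<delta> < d0" "\<delta> < s - t1" "\<delta> < t2 - s" "\<delta> < 1/2" unfolding \<delta>_def by linarith+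
  have near: "\<bar>\<theta> x - \<theta> s\<bar> < pi/2" "x \<in> {t1..t2}" if "\<bar>x - s\<bar> \<le> \<delta>" for x
    using d0(2)[of x] that \<delta> by (auto simp: dist_real_def abs_le_iff)
  have rot: "Im (cis (-(\<theta> s - pi/2)) * z) = Re (cis (-\<theta> s) * z)" for z
  proof -
    have "cis (-(\<theta> s - pi/2)) = cis (-\<theta> s) * cis (pi/2)" unfolding cis_mult by simp
    then show ?thesis by simp
  qed
  show ?thesis
  proof (rule left_side_inside[OF jordan orient \<delta>(1,5) _ _ _ \<open>e > 0\<close>])
    show "Im (cis (-\<theta> s) * (g x - g s)) < 0" if "\<bar>x - s\<bar> \<le> \<delta>" "x \<noteq> s" for x
      using below_tangent[of s x] near(2)[OF that(1)] that s by auto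
    show "Re (cis (-\<theta> s) * (g x - g s)) > 0" if "s < x" "x \<le> s + \<delta>" for x
    proof -
      have "\<bar>x - s\<bar> \<le> \<delta>" using that by auto
      note n = near(1)[OF this] near(2)[OF this, unfolded atLeastAtMost_iff, THEN conjunct1]
        near(2)[OF this, unfolded atLeastAtMost_iff, THEN conjunct2]
      have "Im (cis (-(\<theta> s - pi/2)) * (g x - g s)) > 0"
        using n s that pi_gt_zero by (intro dirg) linarith+
      then show ?thesis unfolding rot .
    qed
    show "Re (cis (-\<theta> s) * (g x - g s)) < 0" if "s - \<delta> \<le> x" "x < s" for x
    proof -
      have "\<bar>x - s\<bar> \<le> \<delta>" using that by auto
      note n = near(1)[OF this] near(2)[OF this, unfolded atLeastAtMost_iff, THEN conjunct1]
        near(2)[OF this, unfolded atLeastAtMost_iff, THEN conjunct2]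
      have "Im (cis (-(\<theta> s - pi/2)) * (g s - g x)) > 0"
        using n s that pi_gt_zero by (intro dirg) linarith+
      then show ?thesis unfolding rot by (simp add: algebra_simps)
    qed
  qed
qed

text \<open>The part of the ball above the tangent is convex and misses \<open>T\<close>: the arc is
  below its tangent and the other sides avoid the ball. It contains an inside point arbitrarily
  close to \<open>g s\<close>, so it lies inside entirely.\<close>

lemma half_ball_inside:
  assumes s: "t1 < s" "s < t2" and B: "g s \<in> ball w e" "ball w e \<inter> (side2 \<union> side3) = {}"
    and x: "x \<in> ball w e" "Im (cis (-\<theta> s) * (x - g s)) > 0"
  shows "x \<in> inside T"
proof -
  define H where "H = ball w e \<inter> {z. Im (cis (-\<theta> s) * (z - g s)) > 0}"
  have "convex {z. Im (cis (-\<theta> s) * (z - g s)) > 0}"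
  proof -
    have eq: "{z. Im (cis (-\<theta> s) * (z - g s)) > 0} = {z. inner (\<i> * cis (\<theta> s)) z > Im (cis (-\<theta> s) * g s)}"
      by (auto simp: inner_complex_def algebra_simps)
    show ?thesis unfolding eq by (rule convex_halfspace_gt)
  qed
  then have "connected H" unfolding H_def by (intro convex_connected convex_Int) auto
  moreover have "H \<inter> T = {}"
  proof -
    have "Im (cis (-\<theta> s) * (g t - g s)) \<le> 0" if "t \<in> {t1..t2}" for t
      using below_tangent[of s t] that s by (cases "t = s") auto
    then have "z \<notin> g ` {t1..t2}" if "z \<in> H" for z using that by (force simp: H_def)
    moreover have "H \<inter> (side2 \<union> side3) = {}" using B(2) by (auto simp: H_def)
    ultimately show ?thesis unfolding T_eq by blast
  qed
  moreover obtain r where r: "r > 0" "ball (g s) r \<subseteq> ball w e" using B(1) open_ball openE by blast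
  then obtain d where d: "0 < d" "d < r" "g s + cis (\<theta> s) * (\<i> * complex_of_real d) \<in> inside T"
    using left_of_arc_inside[OF s] by blast
  moreover have "g s + cis (\<theta> s) * (\<i> * complex_of_real d) \<in> H"
  proof -
    have "g s + cis (\<theta> s) * (\<i> * complex_of_real d) \<in> ball w e"
      using d(1,2) by (intro subsetD[OF r(2)]) (simp add: dist_norm norm_mult)
    moreover have "cis (-\<theta> s) * (g s + cis (\<theta> s) * (\<i> * complex_of_real d) - g s) = \<i> * complex_of_real d"
      by (simp add: cis_mult flip: mult.assoc)
    then have "Im (cis (-\<theta> s) * (g s + cis (\<theta> s) * (\<i> * complex_of_real d) - g s)) = d"
      by (simp only:) simp
    ultimately show ?thesis using d(1) unfolding H_def by (simp only: Int_iff mem_Collect_eq)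
  qed
  ultimately have "H \<subseteq> inside T" using connected_into_inside by blast
  then show ?thesis using x by (auto simp: H_def)
qed

section \<open>Inscribed positions and positions touching the other sides\<close>

definition "E2 = {z \<in> D. \<exists>q\<in>I. place z q \<in> side2}"
definition "E3 = {z \<in> D. \<exists>q\<in>I. place z q \<in> side3}"
definition "G = {z \<in> D. \<forall>q\<in>I. place z q \<in> closure (inside T)}"

text \<open>This set is the projection of a compact set of pairs along the compact parameter
  interval.\<close>

lemma closed_meeting:
  assumes "compact S" shows "closed {z \<in> D. \<exists>q\<in>I. place z q \<in> S}"
proof -
  have DI: "compact (D \<times> I)" by (intro compact_Times compact_D) auto
  have "closed ((D \<times> I) \<inter> (\<lambda>x. place (fst x) (snd x)) -` S)"
    by (intro continuous_closed_preimage continuous_place compact_imp_closed DI assms)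
  then have "compact ((D \<times> I) \<inter> (\<lambda>x. place (fst x) (snd x)) -` S)"
    using compact_Int_closed[OF DI, of "(D \<times> I) \<inter> (\<lambda>x. place (fst x) (snd x)) -` S"] by simp
  then have "compact (fst ` ((D \<times> I) \<inter> (\<lambda>x. place (fst x) (snd x)) -` S))"
    by (intro compact_continuous_image continuous_intros)
  moreover have "fst ` ((D \<times> I) \<inter> (\<lambda>x. place (fst x) (snd x)) -` S) = {z \<in> D. \<exists>q\<in>I. place z q \<in> S}"
    by force
  ultimately show ?thesis by (simp add: compact_imp_closed)
qed

lemma closed_E: "closed E2" "closed E3"
  unfolding E2_def E3_def by (intro closed_meeting compact_sides)+

lemma continuous_place_at: "q \<in> I \<Longrightarrow> continuous_on D (\<lambda>z. place z q)"
  by (rule continuous_on_compose2[OF continuous_place, of _ "\<lambda>z. (z, q)", simplified])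
    (auto intro!: continuous_intros)

lemma closed_G: "closed G"
proof -
  have "G = (\<Inter>q\<in>I. D \<inter> (\<lambda>z. place z q) -` closure (inside T))"
    using pi_gt_zero by (auto simp: G_def intro!: exI[of _ 0])
  moreover have "closed (\<Inter>q\<in>I. D \<inter> (\<lambda>z. place z q) -` closure (inside T))"
    by (intro closed_INT ballI continuous_closed_preimage continuous_place_at compact_imp_closed compact_D closed_closure)
  ultimately show ?thesis by (simp only:)
qed

text \<open>A copy that avoids the other two sides meets \<open>T\<close> only at its two feet. Each
  remaining arc is connected and misses \<open>T\<close>, so one inside point on each suffices. The
  arc through the cusp appears as two parameter intervals, whose outer ends both give the
  cusp.\<close>

lemma arcs_inside:
  assumes s: "t1 \<le> s1" "s1 < s2" "s2 \<le> t2" and nE: "(s1, s2) \<notin> E2 \<union> E3"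
    and w: "place (s1,s2) (-pi/2) \<in> inside T" "place (s1,s2) pi \<in> inside T"
  shows "(s1, s2) \<in> G"
proof -
  let ?z = "(s1, s2)"
  define p2 where "p2 = \<theta> s2 - tilt ?z"
  define p1 where "p1 = \<theta> s1 - tilt ?z + 2*pi"
  have zD: "?z \<in> D" using s by (auto simp: D_def)
  have le: "\<theta> s2 < \<theta> s1" using decr s by auto
  have p: "-pi/2 < p2" "p2 < pi/2" "3*pi/2 < p1" "p1 < 5*pi/2"
    using tilt[OF s] le unfolding p1_def p2_def by linarith+
  have off: "place ?z q \<notin> T" if "q \<in> I" "q \<noteq> p1" "q \<noteq> p2" for q
  proof -
    have "place ?z q \<notin> g ` {t1..t2}" using place_meets_arc[OF s that(1)] that by (auto simp: p1_def p2_def)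
    moreover have "place ?z q \<notin> side2" "place ?z q \<notin> side3" using nE zD that(1) by (auto simp: E2_def E3_def)
    ultimately show ?thesis unfolding T_eq by auto
  qed
  have contp: "continuous_on I (place ?z)" unfolding place_def by (intro continuous_intros contK)
  have arc: "place ?z q \<in> inside T"
    if "connected J" "J \<subseteq> I" "p1 \<notin> J" "p2 \<notin> J" "q \<in> J" "q0 \<in> J" "place ?z q0 \<in> inside T" for J q q0
  proof -
    have "connected (place ?z ` J)"
      using that by (intro connected_continuous_image continuous_on_subset[OF contp])
    moreover have "place ?z ` J \<inter> T = {}" using off that by blast
    ultimately show ?thesis using connected_into_inside[of "place ?z ` J" "place ?z q0"] that by blast
  qed
  have same: "place ?z (5*pi/2) = place ?z (-pi/2)" using K_start K_end by (simp add: place_def)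
  have "place ?z q \<in> closure (inside T)" if q: "q \<in> I" for q
  proof -
    consider "q = p1" | "q = p2" | "q < p2" | "p2 < q" "q < p1" | "p1 < q" by linarith
    then show ?thesis
    proof cases
      case 1
      have "g s1 \<in> T" unfolding T_eq using s by auto
      then show ?thesis using 1 place_contacts(2)[OF s] T_subset_closure_inside by (auto simp: p1_def)
    next
      case 2
      have "g s2 \<in> T" unfolding T_eq using s by auto
      then show ?thesis using 2 place_contacts(1)[OF s] T_subset_closure_inside by (auto simp: p2_def)
    next
      case 3
      have "place ?z q \<in> inside T"
        by (rule arc[of "{-pi/2..<p2}" q "-pi/2"]) (use 3 q p w in auto)
      then show ?thesis using closure_subset by blast
    next
      case 4
      have "place ?z q \<in> inside T"
        by (rule arc[of "{p2<..<p1}" q pi]) (use 4 q p w pi_gt_zero in auto)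
      then show ?thesis using closure_subset by blast
    next
      case 5
      have "place ?z q \<in> inside T"
        by (rule arc[of "{p1<..5*pi/2}" q "5*pi/2"]) (use 5 q p w same in auto)
      then show ?thesis using closure_subset by blast
    qed
  qed
  then show ?thesis using zD by (auto simp: G_def)
qed

lemma witnesses_not_contacts:
  assumes s: "t1 \<le> s1" "s1 < s2" "s2 \<le> t2" and q: "q = -pi/2 \<or> q = pi"
  shows "q \<in> I" "q \<noteq> \<theta> s2 - tilt (s1,s2)" "q \<noteq> \<theta> s1 - tilt (s1,s2) + 2*pi"
proof -
  have le: "\<theta> s2 < \<theta> s1" using decr s by auto
  show "q \<in> I" using q witnesses_in_I by blast
  show "q \<noteq> \<theta> s2 - tilt (s1,s2)" "q \<noteq> \<theta> s1 - tilt (s1,s2) + 2*pi"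
    using q tilt[OF s] le pi_gt_zero by auto
qed

lemma diag_in_G: "t1 \<le> s \<Longrightarrow> s \<le> t2 \<Longrightarrow> (s, s) \<in> G"
  using T_subset_closure_inside by (auto simp: G_def D_def place_diag T_eq)

lemma eventually_in_D:
  assumes "z \<in> D" "\<forall>\<^sub>F w in at z within D. P w" "P z"
  shows "\<exists>e>0. \<forall>w \<in> D \<inter> ball z e. P w"
proof -
  obtain e where "e > 0" "\<And>w. w \<in> D \<Longrightarrow> w \<noteq> z \<Longrightarrow> dist w z < e \<Longrightarrow> P w"
    using assms(2) unfolding eventually_at by blast
  then show ?thesis using assms(3) by (intro exI[of _ e]) (metis IntD1 IntD2 dist_commute mem_ball)
qed

lemma place_tendsto: "q \<in> I \<Longrightarrow> z \<in> D \<Longrightarrow> ((\<lambda>w. place w q) \<longlongrightarrow> place z q) (at z within D)"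
  using continuous_place_at[of q] by (auto simp: continuous_on_def)

text \<open>Off the diagonal both witnesses are strictly inside and remain so for nearby pairs. On
  the diagonal the copy is a point of the arc and nothing is strictly inside. For nearby pairs,
  however, the witnesses lie in a ball that avoids the other sides, each above the tangent at one of
  the two contact points, and \<open>half_ball_inside\<close> applies.\<close>

lemma G_open_off_sides:
  assumes "z \<in> G - (E2 \<union> E3)"
  shows "\<exists>e>0. D \<inter> ball z e \<subseteq> G"
proof -
  have zD: "z \<in> D" using assms by (auto simp: G_def)
  note q = witnesses_in_I
  have evE: "\<forall>\<^sub>F w in at z within D. w \<notin> E2 \<union> E3"
  proof -
    have "open (- (E2 \<union> E3))" using closed_E by auto
    then have "\<forall>\<^sub>F w in at z within D. w \<in> - (E2 \<union> E3)"
      using assms by (intro topological_tendstoD[OF tendsto_ident_at]) auto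
    then show ?thesis by (rule eventually_mono) auto
  qed
  from D_cases[OF zD] show ?thesis
  proof (elim disjE exE conjE)
    fix s1 s2 assume s: "z = (s1, s2)" "t1 \<le> s1" "s1 < s2" "s2 \<le> t2"
    have ins: "place z x \<in> inside T" if x: "x = -pi/2 \<or> x = pi" for x
    proof (rule closure_inside_cases)
      have xI: "x \<in> I" using x q by auto
      then show "place z x \<in> closure (inside T)" using assms by (auto simp: G_def)
      have "place z x \<notin> g ` {t1..t2}"
        using place_meets_arc[OF s(2-) xI] witnesses_not_contacts[OF s(2-) x] s(1) by blast
      moreover have "place z x \<notin> side2" "place z x \<notin> side3" using assms zD xI by (auto simp: E2_def E3_def)
      ultimately show "place z x \<notin> T" unfolding T_eq by auto
    qed
    have 1: "\<forall>\<^sub>F w in at z within D. place w (-pi/2) \<in> inside T"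
      by (rule topological_tendstoD[OF place_tendsto[OF q(1) zD] open_inside_T]) (use ins in auto)
    have 2: "\<forall>\<^sub>F w in at z within D. place w pi \<in> inside T"
      by (rule topological_tendstoD[OF place_tendsto[OF q(2) zD] open_inside_T]) (use ins in auto)
    have 3: "\<forall>\<^sub>F w in at z within D. fst w < snd w"
    proof -
      have "((\<lambda>w. snd w - fst w) \<longlongrightarrow> s2 - s1) (at z within D)" unfolding s(1) by (auto intro!: tendsto_eq_intros)
      from order_tendstoD(1)[OF this, of 0] show ?thesis using s by simp
    qed
    have "\<forall>\<^sub>F w in at z within D. w \<in> D \<longrightarrow> w \<in> G" using 1 2 3 evE
    proof eventually_elim
      case (elim w)
      show ?case
      proof
        assume "w \<in> D"
        obtain x y where w: "w = (x, y)" by fastforce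
        then show "w \<in> G" using arcs_inside[of x y] elim \<open>w \<in> D\<close> by (auto simp: D_def)
      qed
    qed
    from eventually_in_D[OF zD this] show ?thesis using assms by blast
  next
    fix s assume s: "z = (s, s)" "t1 \<le> s" "s \<le> t2"
    \<comment> \<open>The two ends of the arc belong to the other sides, so a diagonal position
      outside \<open>E2 \<union> E3\<close> is an inner point of the arc.\<close>
    have "g t1 \<in> side3" using jordan_param_periodic[OF jordan, of t1 1] t31 by (auto intro!: image_eqI[of _ _ "t1+1"])
    moreover have "g t2 \<in> side2" using t23 by auto
    ultimately have "s \<noteq> t1" "s \<noteq> t2"
      using assms s zD q(2) by (auto simp: E2_def E3_def place_diag)
    then have s': "t1 < s" "s < t2" using s by auto
    have "closed (side2 \<union> side3)" using compact_sides by (auto intro!: compact_imp_closed)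
    then obtain e where e: "e > 0" "ball (g s) e \<inter> (side2 \<union> side3) = {}"
      using inner_point_not_on_sides[OF s'] by (metis Compl_iff open_Compl openE disjoint_eq_subset_Compl)
    have 1: "\<forall>\<^sub>F w in at z within D. place w (-pi/2) \<in> ball (g s) e"
      by (rule topological_tendstoD[OF place_tendsto[OF q(1) zD] open_ball]) (use e s in \<open>auto simp: place_diag\<close>)
    have 2: "\<forall>\<^sub>F w in at z within D. place w pi \<in> ball (g s) e"
      by (rule topological_tendstoD[OF place_tendsto[OF q(2) zD] open_ball]) (use e s in \<open>auto simp: place_diag\<close>)
    have gl: "((\<lambda>w. g (fst w)) \<longlongrightarrow> g s) (at z within D)" "((\<lambda>w. g (snd w)) \<longlongrightarrow> g s) (at z within D)"
    proof -
      have ic: "isCont g s" using continuous_g[of UNIV] by (simp add: continuous_on_eq_continuous_at)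
      have "(fst \<longlongrightarrow> s) (at z within D)" "(snd \<longlongrightarrow> s) (at z within D)"
        unfolding s(1) by (auto intro!: tendsto_eq_intros)
      then show "((\<lambda>w. g (fst w)) \<longlongrightarrow> g s) (at z within D)" "((\<lambda>w. g (snd w)) \<longlongrightarrow> g s) (at z within D)"
        using isCont_tendsto_compose[OF ic] by auto
    qed
    have 3: "\<forall>\<^sub>F w in at z within D. g (fst w) \<in> ball (g s) e"
      by (rule topological_tendstoD[OF gl(1) open_ball]) (use e in auto)
    have 4: "\<forall>\<^sub>F w in at z within D. g (snd w) \<in> ball (g s) e"
      by (rule topological_tendstoD[OF gl(2) open_ball]) (use e in auto)
    have lim: "(fst \<longlongrightarrow> s) (at z within D)" "(snd \<longlongrightarrow> s) (at z within D)"
      unfolding s(1) by (auto intro!: tendsto_eq_intros)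
    have 5: "\<forall>\<^sub>F w in at z within D. t1 < fst w" using order_tendstoD(1)[OF lim(1)] s' by auto
    have 6: "\<forall>\<^sub>F w in at z within D. snd w < t2" using order_tendstoD(2)[OF lim(2)] s' by auto
    have "\<forall>\<^sub>F w in at z within D. w \<in> D \<longrightarrow> w \<in> G" using 1 2 3 4 5 6 evE
    proof eventually_elim
      case (elim w)
      show ?case
      proof
        assume wD: "w \<in> D"
        obtain x y where w: "w = (x, y)" by fastforce
        show "w \<in> G"
        proof (cases "x = y")
          case True then show ?thesis using diag_in_G[of x] wD w by (auto simp: D_def)
        next
          case False
          then have xy: "t1 \<le> x" "x < y" "y \<le> t2" using wD w by (auto simp: D_def)
          have xy': "t1 < x" "x < t2" "t1 < y" "y < t2" using elim w xy by auto
          have "place (x,y) r \<in> inside T" if r: "r = -pi/2 \<or> r = pi" for r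
          proof -
            have rb: "place (x,y) r \<in> ball (g s) e" using r elim w by auto
            have "Im (cis (-\<theta> y) * (place (x,y) r - g y)) > 0 \<or> Im (cis (-\<theta> x) * (place (x,y) r - g x)) > 0"
              using place_above_one_tangent[OF xy witnesses_not_contacts[OF xy r]] .
            then show ?thesis
              using half_ball_inside[OF xy'(1,2) _ e(2) rb] half_ball_inside[OF xy'(3,4) _ e(2) rb] elim w by auto
          qed
          then show ?thesis using arcs_inside[OF xy] elim w by auto
        qed
      qed
    qed
    from eventually_in_D[OF zD this] show ?thesis using assms by blast
  qed
qed

text \<open>On the leg \<open>s2 = t2\<close> a foot stays at the cusp \<open>g t2\<close>, which
  belongs to the second side; on the leg \<open>s1 = t1\<close> a foot stays at \<open>g t1\<close>,
  which equals \<open>g (t1 + 1)\<close> and belongs to the third. The legs share the vertex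
  \<open>(t1, t2)\<close>, and each meets the diagonal.\<close>

lemma inscribed_position:
  obtains s1 s2 where "t1 \<le> s1" "s1 < s2" "s2 \<le> t2" "(s1, s2) \<in> G \<inter> E2 \<inter> E3"
proof -
  have g1: "g t1 \<in> side3" using jordan_param_periodic[OF jordan, of t1 1] t31 by (auto intro!: image_eqI[of _ _ "t1+1"])
  have g2: "g t2 \<in> side2" using t23 by auto
  have inI: "\<theta> y - tilt (x,y) \<in> I" "\<theta> x - tilt (x,y) + 2*pi \<in> I" if "t1 \<le> x" "x < y" "y \<le> t2" for x y
    using tilt[OF that] decr[of x y] that pi_gt_zero by auto
  have "G \<inter> E2 \<inter> E3 \<noteq> {}"
  proof (rule component_frontier_crossing[OF convex_D compact_imp_closed[OF compact_D] closed_G closed_E])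
    let ?L = "(\<lambda>s. (s, s)) ` {t1..t2}" and ?X2 = "(\<lambda>s. (s, t2)) ` {t1..t2}" and ?X3 = "(\<lambda>s. (t1, s)) ` {t1..t2}"
    show "G \<subseteq> D" by (auto simp: G_def)
    show "connected ?L" "connected ?X2" "connected ?X3"
      by (auto intro!: connected_continuous_image continuous_intros)
    show "?L \<subseteq> G" using diag_in_G by auto
    show "?X2 \<subseteq> D" "?X3 \<subseteq> D" by (auto simp: D_def)
    have "(t2, t2) \<in> ?X2 \<inter> ?L" "(t1, t1) \<in> ?X3 \<inter> ?L" using t12 by auto
    then show "?X2 \<inter> ?L \<noteq> {}" "?X3 \<inter> ?L \<noteq> {}" by blast+
    show "(t1, t2) \<in> ?X2" "(t1, t2) \<in> ?X3" using t12 by auto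
    show "?X2 \<subseteq> E2"
    proof
      fix z assume "z \<in> ?X2"
      then obtain s where s: "z = (s, t2)" "t1 \<le> s" "s \<le> t2" by auto
      have "\<exists>q\<in>I. place z q = g t2"
      proof (cases "s = t2")
        case True then show ?thesis using s by (intro bexI[OF _ witnesses_in_I(2)]) (simp add: place_diag)
      next
        case False
        then show ?thesis using s inI[of s t2] place_contacts(1)[of s t2] by (intro bexI[of _ "\<theta> t2 - tilt z"]) auto
      qed
      then show "z \<in> E2" using s g2 by (force simp: E2_def D_def)
    qed
    show "?X3 \<subseteq> E3"
    proof
      fix z assume "z \<in> ?X3"
      then obtain s where s: "z = (t1, s)" "t1 \<le> s" "s \<le> t2" by auto
      have "\<exists>q\<in>I. place z q = g t1"
      proof (cases "s = t1")
        case True then show ?thesis using s by (intro bexI[OF _ witnesses_in_I(2)]) (simp add: place_diag)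
      next
        case False
        then show ?thesis using s inI[of t1 s] place_contacts(2)[of t1 s] by (intro bexI[of _ "\<theta> t1 - tilt z + 2*pi"]) auto
      qed
      then show "z \<in> E3" using s g1 by (force simp: E3_def D_def)
    qed
  qed (fact G_open_off_sides)
  then obtain z where z: "z \<in> G \<inter> E2 \<inter> E3" by blast
  then have "z \<in> D" by (auto simp: G_def)
  from D_cases[OF this] show thesis
  proof (elim disjE exE conjE)
    fix s1 s2 assume "z = (s1, s2)" "t1 \<le> s1" "s1 < s2" "s2 \<le> t2"
    then show thesis using that z by blast
  next
    \<comment> \<open>A degenerate copy would be a single point on both other sides. Injectivity
      over one period forces it to be \<open>g t2\<close>, and this cusp is not on the third
      side.\<close>
    fix s assume s: "z = (s, s)" "t1 \<le> s" "s \<le> t2"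
    then obtain x y where x: "x \<in> {t2..t3}" "g s = g x" and y: "y \<in> {t3..t1+1}" "g s = g y"
      using z by (auto simp: E2_def E3_def place_diag)
    have "s = x" using jordan_param_inj[OF jordan x(2), of t1] x s t12 t31 t23 by auto
    then have "s = t2" using x s by auto
    have False
    proof (cases "y = t1 + 1")
      case True
      then have "g s = g t1" using y jordan_param_periodic[OF jordan, of t1 1] by simp
      then show False using jordan_param_inj[OF jordan, of s t1 t1] \<open>s = t2\<close> t12 t23 t31 by auto
    next
      case False
      then show False using jordan_param_inj[OF jordan y(2), of t1] y s \<open>s = t2\<close> t12 t23 t31 by auto
    qed
    then show thesis ..
  qed
qed

end

theorem theorem4p4:
  fixes C T :: "complex set" and g :: "real \<Rightarrow> complex" and t1 t2 t3 :: real
  assumes "cardioid_like C"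
    and "deltoid_like T"
    and "deltoid_param g t1 t2 t3" and "T = path_image g"
    and "concave_arc g t1 t2"
  shows "\<exists>\<phi>. similarity \<phi> \<and>
           \<phi> ` C \<subseteq> closure (inside T) \<and>
           \<phi> ` C \<inter> g ` {t1..t2} \<noteq> {} \<and>
           \<phi> ` C \<inter> g ` {t2..t3} \<noteq> {} \<and>
           \<phi> ` C \<inter> g ` {t3..t1 + 1} \<noteq> {} \<and>
           card (\<phi> ` C \<inter> g ` {t1..t2}) = 2"
proof -
  obtain K a b where K: "cardioid_normal_form K" "a \<noteq> 0" "K ` {-pi/2..5*pi/2} = (\<lambda>z. a * z + b) ` C"
    using cardioid_normalization[OF assms(1)] by blast
  obtain \<theta> where \<theta>: "concave_arc_data g \<theta> t1 t2" using deltoid_concave_arc_data[OF assms(3,5)] by blast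
  interpret cardioid_normal_form K by (fact K)
  interpret concave_arc_data g \<theta> t1 t2 by (fact \<theta>)
  interpret inscription K g \<theta> t1 t2 t3
    by unfold_locales (use assms(3) in \<open>auto simp: deltoid_param_def\<close>)
  obtain s1 s2 where s: "t1 \<le> s1" "s1 < s2" "s2 \<le> t2" and z: "(s1, s2) \<in> G \<inter> E2 \<inter> E3"
    by (rule inscribed_position)
  let ?z = "(s1, s2)"
  \<comment> \<open>The placement composed with the normalisation of \<open>C\<close>, expanded into
    one affine map. Its linear coefficient is nonzero because \<open>s1 < s2\<close>.\<close>
  define \<phi> where "\<phi> w = (scal ?z * a) * w + (scal ?z * b + offs ?z)" for w
  have img: "\<phi> ` C = place ?z ` {-pi/2..5*pi/2}"
  proof -
    have "place ?z ` {-pi/2..5*pi/2} = (\<lambda>w. scal ?z * w + offs ?z) ` (K ` {-pi/2..5*pi/2})"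
      by (simp add: place_def image_image)
    also have "\<dots> = \<phi> ` C" unfolding K(3) image_image \<phi>_def by (simp add: algebra_simps)
    finally show ?thesis by simp
  qed
  have inI: "\<theta> s2 - tilt ?z \<in> {-pi/2..5*pi/2}" "\<theta> s1 - tilt ?z + 2*pi \<in> {-pi/2..5*pi/2}"
    using tilt[OF s] decr[OF s] pi_gt_zero by auto
  have meet: "\<phi> ` C \<inter> g ` {t1..t2} = {g s1, g s2}"
  proof
    show "\<phi> ` C \<inter> g ` {t1..t2} \<subseteq> {g s1, g s2}"
    proof
      fix w assume "w \<in> \<phi> ` C \<inter> g ` {t1..t2}"
      then obtain q where q: "q \<in> {-pi/2..5*pi/2}" "w = place ?z q" "w \<in> g ` {t1..t2}" unfolding img by blast
      then have "q = \<theta> s2 - tilt ?z \<or> q = \<theta> s1 - tilt ?z + 2*pi" using place_meets_arc[OF s q(1)] by blast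
      then show "w \<in> {g s1, g s2}" using q(2) place_contacts[OF s] by auto
    qed
    have "g s1 \<in> \<phi> ` C" "g s2 \<in> \<phi> ` C"
      unfolding img using place_contacts[OF s] inI by (metis imageI)+
    then show "{g s1, g s2} \<subseteq> \<phi> ` C \<inter> g ` {t1..t2}" using s by auto
  qed
  have "g s2 \<noteq> g s1" using chord_angle[OF s] by blast
  show ?thesis
  proof (intro exI[of _ \<phi>] conjI)
    show "similarity \<phi>" unfolding similarity_def
      using scal_polar(2)[OF s] K(2) by (intro exI[of _ "scal ?z * a"] exI[of _ "scal ?z * b + offs ?z"]) (auto simp: \<phi>_def)
    show "\<phi> ` C \<subseteq> closure (inside T)" unfolding img assms(4) using z by (auto simp: G_def)
    show "\<phi> ` C \<inter> g ` {t1..t2} \<noteq> {}" unfolding meet by simp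
    show "\<phi> ` C \<inter> g ` {t2..t3} \<noteq> {}" unfolding img using z by (auto simp: E2_def)
    show "\<phi> ` C \<inter> g ` {t3..t1 + 1} \<noteq> {}" unfolding img using z by (auto simp: E3_def)
    show "card (\<phi> ` C \<inter> g ` {t1..t2}) = 2" unfolding meet using \<open>g s2 \<noteq> g s1\<close> by auto
  qed
qed

end
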